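(* The monoid ${\cal M}^{\sf P}_{\sf E3}={\cal RM}^{\sf P}/\!\equiv_{\sf E3}$ is regular.
   Context: Let $A=\{0,1\}$, and let $A^*$ be the set of all finite words over $A$ (including the empty word), $|x|$ the length of $x$. "Function" means partial function; ${\sf Dom}(f)$ is the domain of $f$. For words $v,w$: $v \parallel_{\sf pref} w$ means that one of $v,w$ is a prefix of the other. A prefix code is a set $P\subset A^*$ in which no two distinct elements are prefix-comparable. A right ideal is a set $R\subseteq A^*$ with $RA^*=R$; every right ideal $R$ equals $PA^*$ for a unique prefix code $P$. A function $f:A^*\to A^*$ is polynomially balanced iff there is a polynomial $p$ such that $|f(x)|\le p(|x|)$ and $|x|\le p(|f(x)|)$ for all $x\in{\sf Dom}(f)$. ${\sf fP}$ is the monoid of all polynomially balanced partial functions $A^*\to A^*$ computable by deterministic Turing machines in polynomial time. A right-ideal morphism is a partial function $h:A^*\to A^*$ such that ${\sf Dom}(h)$ is a right ideal and $h(xw)=h(x)\,w$ for all $x\in{\sf Dom}(h)$, $w\in A^*$. ${\sf domC}(h)$ is the prefix code that generates ${\sf Dom}(h)$ as a right ideal. ${\cal RM}^{\sf P}$ is the monoid (under composition) of all $f\in{\sf fP}$ that are right-ideal morphisms. For $L_1,L_2\subseteq A^*$: $L_1\equiv_{\sf end}L_2$ iff $L_1A^*$ and $L_2A^*$ intersect (i.e., meet in a nonempty set) the same right ideals of $A^*$. Let ${\sf E3}$ be the family of all elementary recursive functions ${\mathbb N}\to{\mathbb N}$, i.e., level 3 of the Grzegorczyk hierarchy (the primitive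 recursive functions with size bounded by a constant iteration of exponentials), where only those functions $\tau$ are taken that are increasing and satisfy $n\le\tau(n)$ for all $n$. For prefix codes $P_1,P_2$: $P_1\equiv_{\sf E3}P_2$ iff $P_1\equiv_{\sf end}P_2$ and there is $\tau\in{\sf E3}$ such that for all $x_1\in P_1$, $x_2\in P_2$ with $x_1\parallel_{\sf pref}x_2$: $|x_1|\le\tau(|x_2|)$ and $|x_2|\le\tau(|x_1|)$. For right-ideal morphisms: $f\equiv_{\sf E3}g$ iff ${\sf domC}(f)\equiv_{\sf E3}{\sf domC}(g)$ and $f,g$ agree on ${\sf Dom}(f)\cap{\sf Dom}(g)$. This is a congruence on ${\cal RM}^{\sf P}$, and ${\cal M}^{\sf P}_{\sf E3}$ is the quotient monoid. A monoid $M$ is regular iff for every $s\in M$ there is $s'\in M$ with $ss's=s$. *)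

theory Defs
  imports "HOL-Library.Sublist" "HOL-Algebra.Group" "HOL-Computational_Algebra.Polynomial"
begin

type_synonym word = "bool list"
type_synonym pfun = "word \<Rightarrow> word option"

definition pref_comparable :: "word \<Rightarrow> word \<Rightarrow> bool" where
  "pref_comparable v w \<longleftrightarrow> prefix v w \<or> prefix w v"

definition prefix_code :: "word set \<Rightarrow> bool" where
  "prefix_code P \<longleftrightarrow> (\<forall>v\<in>P. \<forall>w\<in>P. pref_comparable v w \<longrightarrow> v = w)"

text \<open>The set \<open>L A\<^sup>*\<close>.\<close>
definition ideal_gen :: "word set \<Rightarrow> word set" where
  "ideal_gen L = {x @ w | x w. x \<in> L}"

text \<open>The empty set is a right ideal, generated by the empty prefix code.\<close>
definition right_ideal :: "word set \<Rightarrow> bool" where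
  "right_ideal R \<longleftrightarrow> ideal_gen R = R"

lemma right_ideal_ex1_prefix_code:
  assumes "right_ideal R"
  shows "\<exists>!P. prefix_code P \<and> ideal_gen P = R"
proof -
  have gen: "x \<in> ideal_gen L \<longleftrightarrow> (\<exists>y\<in>L. prefix y x)" for x L
    by (auto simp: ideal_gen_def prefix_def)
  have up: "x \<in> R \<Longrightarrow> prefix x y \<Longrightarrow> y \<in> R" for x y
    using assms gen[of y R] by (auto simp: right_ideal_def)
  define P where "P = {x \<in> R. \<forall>y\<in>R. prefix y x \<longrightarrow> y = x}"
  have min: "\<exists>y\<in>P. prefix y x" if "x \<in> R" for x
    using that
  proof (induction x rule: length_induct)
    case (1 x)
    show ?case
    proof (cases "x \<in> P")
      case True
      then show ?thesis by auto
    next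
      case False
      then obtain y where y: "y \<in> R" "prefix y x" "y \<noteq> x"
        using 1 by (auto simp: P_def)
      then have "length y < length x"
        by (simp add: prefix_length_less prefix_order.less_le)
      with 1 y show ?thesis
        by (meson prefix_order.trans)
    qed
  qed
  show ?thesis
  proof (rule ex1I)
    show "prefix_code P \<and> ideal_gen P = R"
      using min up by (auto simp: prefix_code_def pref_comparable_def gen P_def)
  next
    fix Q assume Q: "prefix_code Q \<and> ideal_gen Q = R"
    have QR: "x \<in> R \<longleftrightarrow> (\<exists>y\<in>Q. prefix y x)" for x
      using Q gen by auto
    have "Q \<subseteq> R"
      using QR by auto
    show "Q = P"
    proof
      show "Q \<subseteq> P"
      proof
        fix x assume x: "x \<in> Q"
        have "y = x" if y: "y \<in> R" "prefix y x" for y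
        proof -
          obtain q where q: "q \<in> Q" "prefix q y"
            using y QR by auto
          then have "q = x"
            using Q x y prefix_order.trans
            unfolding prefix_code_def pref_comparable_def by blast
          with q y show ?thesis
            using prefix_order.antisym by blast
        qed
        then show "x \<in> P"
          using x \<open>Q \<subseteq> R\<close> by (auto simp: P_def)
      qed
      show "P \<subseteq> Q"
        using QR \<open>Q \<subseteq> R\<close> by (fastforce simp: P_def)
    qed
  qed
qed

text \<open>Multi-tape machines with two-way infinite tapes. States and tape symbols are natural numbers
  below given bounds. Symbol 0 is the blank, and 1 and 2 encode the letters. A tape is represented
  relative to its head, which always scans cell 0; moving the head shifts the tape.\<close>

datatype move = Left_Move | No_Move | Right_Move

record tm =
  tm_tapes :: nat
  tm_symbols :: nat
  tm_states :: nat
  tm_start :: nat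
  tm_accept :: nat
  tm_reject :: nat
  tm_delta :: "nat \<Rightarrow> nat list \<Rightarrow> nat \<times> (nat \<times> move) list"

definition wf_tm :: "tm \<Rightarrow> bool" where
  "wf_tm M \<longleftrightarrow>
     1 \<le> tm_tapes M \<and> 3 \<le> tm_symbols M \<and>
     tm_start M < tm_states M \<and> tm_accept M < tm_states M \<and> tm_reject M < tm_states M \<and>
     tm_accept M \<noteq> tm_reject M \<and>
     (\<forall>q ys. q < tm_states M \<and> length ys = tm_tapes M \<and> (\<forall>y\<in>set ys. y < tm_symbols M) \<longrightarrow>
        (case tm_delta M q ys of (q', acts) \<Rightarrow>
           q' < tm_states M \<and> length acts = tm_tapes M \<and> (\<forall>(s, d)\<in>set acts. s < tm_symbols M)))"

type_synonym tape = "int \<Rightarrow> nat"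
type_synonym config = "nat \<times> tape list"

definition word_tape :: "word \<Rightarrow> tape" where
  "word_tape x = (\<lambda>j. if 0 \<le> j \<and> j < int (length x) then (if x ! nat j then 2 else 1) else 0)"

fun act :: "tape \<Rightarrow> nat \<times> move \<Rightarrow> tape" where
  "act t (s, Left_Move) = (\<lambda>j. (t(0 := s)) (j - 1))"
| "act t (s, No_Move) = t(0 := s)"
| "act t (s, Right_Move) = (\<lambda>j. (t(0 := s)) (j + 1))"

definition tm_init :: "tm \<Rightarrow> word \<Rightarrow> config" where
  "tm_init M x = (tm_start M, word_tape x # replicate (tm_tapes M - 1) (\<lambda>_. 0))"

text \<open>Halting configurations are fixed points of the step function, so the configuration after
  \<open>n\<close> iterations is halting iff the machine halts within \<open>n\<close> steps.\<close>
fun tm_step :: "tm \<Rightarrow> config \<Rightarrow> config" where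
  "tm_step M (q, ts) =
     (if q = tm_accept M \<or> q = tm_reject M then (q, ts)
      else case tm_delta M q (map (\<lambda>t. t 0) ts) of (q', acts) \<Rightarrow> (q', map2 act ts acts))"

text \<open>The machine halts within polynomial time on every input. It accepts exactly the inputs in the
  domain of \<open>f\<close>, and then the first tape contains just the output, with the head on its
  first letter.\<close>
definition polytime_computable :: "pfun \<Rightarrow> bool" where
  "polytime_computable f \<longleftrightarrow>
     (\<exists>M (p :: nat poly). wf_tm M \<and>
        (\<forall>x. case (tm_step M ^^ poly p (length x)) (tm_init M x) of (q, ts) \<Rightarrow>
           (case f x of
              None \<Rightarrow> q = tm_reject M
            | Some y \<Rightarrow> q = tm_accept M \<and> hd ts = word_tape y)))"

definition polynomially_balanced :: "pfun \<Rightarrow> bool" where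
  "polynomially_balanced f \<longleftrightarrow>
     (\<exists>p :: nat poly. \<forall>x y. f x = Some y \<longrightarrow>
        length y \<le> poly p (length x) \<and> length x \<le> poly p (length y))"

definition fP :: "pfun set" where
  "fP = {f. polynomially_balanced f \<and> polytime_computable f}"

definition right_ideal_morphism :: "pfun \<Rightarrow> bool" where
  "right_ideal_morphism h \<longleftrightarrow>
     right_ideal (dom h) \<and> (\<forall>x\<in>dom h. \<forall>w. h (x @ w) = Some (the (h x) @ w))"

definition domC :: "pfun \<Rightarrow> word set" where
  "domC h = (THE P. prefix_code P \<and> ideal_gen P = dom h)"

definition RM_P :: "pfun monoid" where
  "RM_P = \<lparr>carrier = {f \<in> fP. right_ideal_morphism f}, monoid.mult = (\<circ>\<^sub>m), one = Some\<rparr>"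

text \<open>Kalmar's class. \<open>elementary k f\<close> says that \<open>f\<close>, restricted to lists of length \<open>k\<close>,
  is an elementary recursive function of \<open>k\<close> arguments. The bounded sum and product run over the
  first argument.\<close>
inductive elementary :: "nat \<Rightarrow> (nat list \<Rightarrow> nat) \<Rightarrow> bool" where
  zero: "elementary k (\<lambda>xs. 0)"
| succ: "elementary 1 (\<lambda>xs. Suc (xs ! 0))"
| proj: "i < k \<Longrightarrow> elementary k (\<lambda>xs. xs ! i)"
| add: "elementary 2 (\<lambda>xs. xs ! 0 + xs ! 1)"
| monus: "elementary 2 (\<lambda>xs. xs ! 0 - xs ! 1)"
| comp: "elementary (length gs) f \<Longrightarrow> (\<forall>g\<in>set gs. elementary k g) \<Longrightarrow>
    elementary k (\<lambda>xs. f (map (\<lambda>g. g xs) gs))"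
| bounded_sum: "elementary (Suc k) f \<Longrightarrow>
    elementary (Suc k) (\<lambda>xs. \<Sum>i<hd xs. f (i # tl xs))"
| bounded_prod: "elementary (Suc k) f \<Longrightarrow>
    elementary (Suc k) (\<lambda>xs. \<Prod>i<hd xs. f (i # tl xs))"

definition E3 :: "(nat \<Rightarrow> nat) set" where
  "E3 = {\<tau>. (\<exists>f. elementary 1 f \<and> (\<forall>n. \<tau> n = f [n])) \<and> mono \<tau> \<and> (\<forall>n. n \<le> \<tau> n)}"

definition end_equiv :: "word set \<Rightarrow> word set \<Rightarrow> bool" where
  "end_equiv L1 L2 \<longleftrightarrow>
     (\<forall>R. right_ideal R \<longrightarrow> (ideal_gen L1 \<inter> R \<noteq> {} \<longleftrightarrow> ideal_gen L2 \<inter> R \<noteq> {}))"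

definition E3_equiv_code :: "word set \<Rightarrow> word set \<Rightarrow> bool" where
  "E3_equiv_code P1 P2 \<longleftrightarrow>
     end_equiv P1 P2 \<and>
     (\<exists>\<tau>\<in>E3. \<forall>x1\<in>P1. \<forall>x2\<in>P2. pref_comparable x1 x2 \<longrightarrow>
        length x1 \<le> \<tau> (length x2) \<and> length x2 \<le> \<tau> (length x1))"

definition E3_equiv :: "pfun rel" where
  "E3_equiv = {(f, g). f \<in> carrier RM_P \<and> g \<in> carrier RM_P \<and>
     E3_equiv_code (domC f) (domC g) \<and> (\<forall>x\<in>dom f \<inter> dom g. f x = g x)}"

text \<open>The quotient by a congruence \<open>r\<close> on the carrier. The product of two classes is the
  class of the product of any two representatives; the unions avoid a choice of
  representatives.\<close>
definition quotient_monoid :: "('a, 'b) monoid_scheme \<Rightarrow> 'a rel \<Rightarrow> 'a set monoid" where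
  "quotient_monoid M r =
     \<lparr>carrier = carrier M // r,
      monoid.mult = (\<lambda>X Y. \<Union>x\<in>X. \<Union>y\<in>Y. r `` {x \<otimes>\<^bsub>M\<^esub> y}),
      one = r `` {\<one>\<^bsub>M\<^esub>}\<rparr>"

definition M_E3 :: "pfun set monoid" where
  "M_E3 = quotient_monoid RM_P E3_equiv"

definition regular_monoid :: "('a, 'b) monoid_scheme \<Rightarrow> bool" where
  "regular_monoid M \<longleftrightarrow>
     monoid M \<and> (\<forall>s\<in>carrier M. \<exists>s'\<in>carrier M. s \<otimes>\<^bsub>M\<^esub> s' \<otimes>\<^bsub>M\<^esub> s = s)"

end

theory Submission
  imports Defs
begin

text \<open>
  An inverse of \<open>f\<close> may be hard to compute, but inverting \<open>f\<close> on a padded input is not. If the input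
  is \<open>u = y @ z\<close> with \<open>z\<close> exponentially longer than a preimage of \<open>y\<close>, then an exhaustive search for a
  preimage takes time polynomial in the length of \<open>u\<close>. Since \<open>f\<close> is a right-ideal morphism, a word
  \<open>x\<close> with \<open>f x = y\<close> gives \<open>f (x @ z) = u\<close>. Restricting a morphism to such padded inputs lengthens the
  words of its domain code by an elementary amount only, and so it does not leave the
  \<open>E3_equiv\<close>-class.

  The search (\<open>padded_inverse\<close>) runs through the words in a fixed order and stops at the first \<open>x\<close>
  whose image is prefix-comparable with \<open>u\<close>, or after as many trials as \<open>u\<close> has letters. It
  succeeds iff \<open>f x\<close> is then a prefix of \<open>u\<close>. If \<open>f x\<close> is longer than \<open>u\<close>, it must give up: some
  extensions of \<open>u\<close> have the prefix \<open>f x\<close> and others do not, and going on to later candidates would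
  destroy compatibility with appending words. With this rule the result is a right-ideal morphism \<open>f'\<close>
  (\<open>morphism_padded_inverse\<close>), the composite of \<open>f'\<close> and then \<open>f\<close> is a partial identity
  (\<open>padded_inverse_inverts\<close>), and \<open>f'\<close> is defined on every sufficiently padded value of \<open>f\<close>
  (\<open>padded_inverse_defined\<close>). Hence the composite of \<open>f\<close>, \<open>f'\<close> and \<open>f\<close> is a restriction of \<open>f\<close> which is
  equivalent to \<open>f\<close> (\<open>padded_inverse_E3_inverse\<close>).

  Two further things have to be established. First, the quotient is a monoid, that is, \<open>E3_equiv\<close> is a
  congruence; the point is the length bound for the domain codes of composites
  (\<open>comp_code_bound\<close>). Second, composites and padded inverses are computable by
  Turing machines in polynomial time. For this, a small language of structured programs on tapes is
  compiled to Turing machines (\<open>compile_prog\<close>). Programs can run a given machine as a subroutine by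
  keeping its state in a tape cell (\<open>simulate_computes\<close>). In order to run it again and again,
  its used cells are kept non-blank, so that afterwards they can be found and erased
  (\<open>spans\<close>, \<open>runs_clean\<close>).
\<close>

section \<open>Right ideals and their prefix codes\<close>

lemma mem_ideal_gen: "x \<in> ideal_gen L \<longleftrightarrow> (\<exists>y\<in>L. prefix y x)"
  by (auto simp: ideal_gen_def prefix_def)

lemma right_ideal_iff: "right_ideal R \<longleftrightarrow> (\<forall>x w. x \<in> R \<longrightarrow> x @ w \<in> R)"
  unfolding right_ideal_def set_eq_iff mem_ideal_gen by (auto simp: prefix_def)

lemma right_ideal_prefix: "right_ideal R \<Longrightarrow> x \<in> R \<Longrightarrow> prefix x y \<Longrightarrow> y \<in> R"
  by (auto simp: right_ideal_iff prefix_def)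

lemma domC_generates:
  assumes "right_ideal (dom f)"
  shows "prefix_code (domC f)" "ideal_gen (domC f) = dom f"
  using theI'[OF right_ideal_ex1_prefix_code[OF assms]] by (auto simp: domC_def)

lemma in_dom_iff_domC:
  assumes "right_ideal (dom f)"
  shows "x \<in> dom f \<longleftrightarrow> (\<exists>y\<in>domC f. prefix y x)"
  using domC_generates[OF assms] mem_ideal_gen by auto

lemma domC_subset_dom: "right_ideal (dom f) \<Longrightarrow> x \<in> domC f \<Longrightarrow> x \<in> dom f"
  using in_dom_iff_domC by blast

lemma domC_minimal:
  assumes "right_ideal (dom f)" "x \<in> domC f" "y \<in> dom f" "prefix y x"
  shows "y = x"
proof -
  obtain z where z: "z \<in> domC f" "prefix z y"
    using assms in_dom_iff_domC by blast
  then have "prefix z x" using assms prefix_order.trans by blast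
  then have "z = x" using domC_generates(1)[OF assms(1)] z(1) assms(2)
    by (auto simp: prefix_code_def pref_comparable_def)
  then show ?thesis using z assms(4) prefix_order.antisym by blast
qed

lemma pref_comparable_iff_common_extension:
  "pref_comparable v w \<longleftrightarrow> (\<exists>u. prefix v u \<and> prefix w u)"
  unfolding pref_comparable_def using prefix_same_cases prefix_order.refl by blast

text \<open>Intersecting the same right ideals need only be tested on the cones \<open>x A\<^sup>*\<close>, the smallest right
  ideals.\<close>

lemma end_equiv_domC_iff:
  assumes f: "right_ideal (dom f)" and g: "right_ideal (dom g)"
  shows "end_equiv (domC f) (domC g) \<longleftrightarrow>
    (\<forall>x\<in>dom f. \<exists>w. x @ w \<in> dom g) \<and> (\<forall>x\<in>dom g. \<exists>w. x @ w \<in> dom f)"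
proof -
  have cone: "right_ideal {x @ w | w. True}" for x :: word
    by (auto simp: right_ideal_iff)
  have *: "\<exists>w. x @ w \<in> E" if "x \<in> D"
    "\<forall>R. right_ideal R \<longrightarrow> (D \<inter> R \<noteq> {} \<longleftrightarrow> E \<inter> R \<noteq> {})" for x :: word and D E
  proof -
    have "x \<in> D \<inter> {x @ w | w. True}" using that(1) by (auto intro: exI[of _ "[]"])
    then have "E \<inter> {x @ w | w. True} \<noteq> {}" using that(2) cone by blast
    then show ?thesis by auto
  qed
  have **: "R \<inter> E \<noteq> {}" if "\<forall>x\<in>D. \<exists>w. x @ w \<in> E" "right_ideal R" "R \<inter> D \<noteq> {}"
    for R D E :: "word set"
    using that by (fastforce simp: right_ideal_iff)
  show ?thesis
    unfolding end_equiv_def domC_generates(2)[OF f] domC_generates(2)[OF g]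
  proof (intro iffI conjI ballI allI impI)
    fix x assume "\<forall>R. right_ideal R \<longrightarrow> (dom f \<inter> R \<noteq> {} \<longleftrightarrow> dom g \<inter> R \<noteq> {})" "x \<in> dom f"
    then show "\<exists>w. x @ w \<in> dom g" using *[of x "dom f" "dom g"] by blast
  next
    fix x assume "\<forall>R. right_ideal R \<longrightarrow> (dom f \<inter> R \<noteq> {} \<longleftrightarrow> dom g \<inter> R \<noteq> {})" "x \<in> dom g"
    then show "\<exists>w. x @ w \<in> dom f" using *[of x "dom g" "dom f"] by blast
  next
    fix R assume "(\<forall>x\<in>dom f. \<exists>w. x @ w \<in> dom g) \<and> (\<forall>x\<in>dom g. \<exists>w. x @ w \<in> dom f)" "right_ideal R"
      "dom f \<inter> R \<noteq> {}"
    then show "dom g \<inter> R \<noteq> {}" using **[of "dom f" "dom g" R] by (metis Int_commute)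
  next
    fix R assume "(\<forall>x\<in>dom f. \<exists>w. x @ w \<in> dom g) \<and> (\<forall>x\<in>dom g. \<exists>w. x @ w \<in> dom f)" "right_ideal R"
      "dom g \<inter> R \<noteq> {}"
    then show "dom f \<inter> R \<noteq> {}" using **[of "dom g" "dom f" R] by (metis Int_commute)
  qed
qed

section \<open>Elementary bounds\<close>

text \<open>The inductive predicate constrains a function also on lists of other lengths than its arity; only
  the values on lists of length one matter here.\<close>

definition elementary_unary :: "(nat \<Rightarrow> nat) \<Rightarrow> bool" where
  "elementary_unary \<tau> \<longleftrightarrow> (\<exists>f. elementary 1 f \<and> (\<forall>n. \<tau> n = f [n]))"

lemma elementary_unary_comp:
  assumes "elementary_unary \<sigma>" "elementary_unary \<tau>"
  shows "elementary_unary (\<lambda>n. \<sigma> (\<tau> n))"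
proof -
  obtain f g where "elementary 1 f" "\<And>n. \<sigma> n = f [n]" "elementary 1 g" "\<And>n. \<tau> n = g [n]"
    using assms by (auto simp: elementary_unary_def)
  then show ?thesis using elementary.comp[of "[g]" f 1]
    by (auto simp: elementary_unary_def)
qed

lemma elementary_unary_binary:
  assumes "elementary 2 h" "elementary_unary \<sigma>" "elementary_unary \<tau>"
  shows "elementary_unary (\<lambda>n. h [\<sigma> n, \<tau> n])"
proof -
  obtain f g where "elementary 1 f" "\<And>n. \<sigma> n = f [n]" "elementary 1 g" "\<And>n. \<tau> n = g [n]"
    using assms by (auto simp: elementary_unary_def)
  then show ?thesis using elementary.comp[of "[f, g]" h 1] assms(1)
    by (auto simp: elementary_unary_def numeral_2_eq_2)
qed

lemma elementary_unary_id: "elementary_unary (\<lambda>n. n)"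
  using elementary.proj[of 0 1] by (auto simp: elementary_unary_def)

lemma elementary_unary_const: "elementary_unary (\<lambda>n. c)"
proof (induction c)
  case 0
  then show ?case using elementary.zero by (auto simp: elementary_unary_def)
next
  case (Suc c)
  have "elementary_unary Suc"
    using elementary.succ by (auto simp: elementary_unary_def)
  from elementary_unary_comp[OF this Suc] show ?case .
qed

lemma elementary_unary_add:
  "elementary_unary \<sigma> \<Longrightarrow> elementary_unary \<tau> \<Longrightarrow> elementary_unary (\<lambda>n. \<sigma> n + \<tau> n)"
  using elementary_unary_binary[OF elementary.add] by simp

text \<open>A product is a bounded sum of a constant summand.\<close>

lemma elementary_unary_mult:
  assumes "elementary_unary \<sigma>" "elementary_unary \<tau>"
  shows "elementary_unary (\<lambda>n. \<sigma> n * \<tau> n)"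
proof -
  have "elementary 2 (\<lambda>xs. \<Sum>i<hd xs. (i # tl xs) ! 1)"
    using elementary.bounded_sum[OF elementary.proj[of 1 "Suc 1"]] by (simp add: numeral_2_eq_2)
  from elementary_unary_binary[OF this assms] show ?thesis by simp
qed

lemma elementary_unary_poly: "elementary_unary (poly p)" for p :: "nat poly"
proof (induction p)
  case 0
  then show ?case using elementary_unary_const[of 0] by simp
next
  case (pCons a p)
  have "poly (pCons a p) = (\<lambda>n. a + n * poly p n)" by (rule ext) simp
  then show ?case
    using elementary_unary_add[OF elementary_unary_const
        elementary_unary_mult[OF elementary_unary_id pCons.IH]] by simp
qed

lemma elementary_unary_exp: "elementary_unary (\<lambda>n. 2 ^ n)"
proof -
  obtain c where c: "elementary 1 c" "\<And>n. c [n] = 2"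
    using elementary_unary_const[of 2] by (force simp: elementary_unary_def)
  have "elementary 1 (\<lambda>xs. \<Prod>i<hd xs. c (i # tl xs))"
    using elementary.bounded_prod[of 0 c] c by simp
  then show ?thesis using c(2) by (auto simp: elementary_unary_def intro!: exI)
qed

lemma E3_iff: "\<tau> \<in> E3 \<longleftrightarrow> elementary_unary \<tau> \<and> mono \<tau> \<and> (\<forall>n. n \<le> \<tau> n)"
  by (simp add: E3_def elementary_unary_def)

lemma E3_comp: "\<sigma> \<in> E3 \<Longrightarrow> \<tau> \<in> E3 \<Longrightarrow> (\<lambda>n. \<sigma> (\<tau> n)) \<in> E3"
  unfolding E3_iff using elementary_unary_comp by (meson monoD monoI le_trans)

lemma E3_add: "\<sigma> \<in> E3 \<Longrightarrow> \<tau> \<in> E3 \<Longrightarrow> (\<lambda>n. \<sigma> n + \<tau> n) \<in> E3"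
  unfolding E3_iff using elementary_unary_add
  by (auto simp: mono_def intro: add_mono trans_le_add1)

lemma E3_id: "(\<lambda>n. n) \<in> E3"
  using elementary_unary_id by (simp add: E3_iff mono_def)

lemma poly_nat_mono: "m \<le> n \<Longrightarrow> poly p m \<le> poly p n" for p :: "nat poly"
  by (induction p) (auto intro!: add_mono mult_mono)

lemma E3_add_poly: "\<tau> \<in> E3 \<Longrightarrow> (\<lambda>n. \<tau> n + poly p n) \<in> E3" for p :: "nat poly"
  unfolding E3_iff
  by (auto simp: mono_def intro!: add_mono poly_nat_mono elementary_unary_add elementary_unary_poly)
    (meson trans_le_add1)

lemma E3_exp: "(\<lambda>n. 2 ^ n) \<in> E3"
  using elementary_unary_exp by (auto simp: E3_iff mono_def less_exp less_imp_le)

section \<open>The congruence\<close>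

lemma RM_P_simps [simp]:
  "carrier RM_P = {f \<in> fP. right_ideal_morphism f}"
  "monoid.mult RM_P = (\<circ>\<^sub>m)" "one RM_P = Some"
  by (simp_all add: RM_P_def)

lemma morphismD:
  assumes "right_ideal_morphism h"
  shows "right_ideal (dom h)" "h x = Some y \<Longrightarrow> h (x @ w) = Some (y @ w)"
  using assms unfolding right_ideal_morphism_def by (force simp: dom_def)+

lemma morphism_iff:
  "right_ideal_morphism h \<longleftrightarrow> (\<forall>x y w. h x = Some y \<longrightarrow> h (x @ w) = Some (y @ w))"
  unfolding right_ideal_morphism_def right_ideal_iff by (auto simp: dom_def)

lemma morphism_comp:
  assumes "right_ideal_morphism f" "right_ideal_morphism g"
  shows "right_ideal_morphism (f \<circ>\<^sub>m g)"
  using assms unfolding morphism_iff by (auto simp: map_comp_Some_iff)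

lemma dom_map_comp_iff: "x \<in> dom (f \<circ>\<^sub>m g) \<longleftrightarrow> (\<exists>y. g x = Some y \<and> y \<in> dom f)"
  by (auto simp: map_comp_Some_iff)

lemma balanced_comp:
  assumes "polynomially_balanced f" "polynomially_balanced g"
  shows "polynomially_balanced (f \<circ>\<^sub>m g)"
proof -
  obtain p where p: "\<And>x y. f x = Some y \<Longrightarrow> length y \<le> poly p (length x) \<and> length x \<le> poly p (length y)"
    using assms(1) unfolding polynomially_balanced_def by blast
  obtain q where q: "\<And>x y. g x = Some y \<Longrightarrow> length y \<le> poly q (length x) \<and> length x \<le> poly q (length y)"
    using assms(2) unfolding polynomially_balanced_def by blast
  have "length z \<le> poly (pcompose p q + pcompose q p) (length x) \<and>
      length x \<le> poly (pcompose p q + pcompose q p) (length z)"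
    if xz: "(f \<circ>\<^sub>m g) x = Some z" for x z
  proof -
    obtain y where y: "g x = Some y" "f y = Some z" using xz by (auto simp: map_comp_Some_iff)
    have "length z \<le> poly p (poly q (length x))"
      using p[OF y(2)] q[OF y(1)] poly_nat_mono[of "length y" _ p] le_trans by blast
    moreover have "length x \<le> poly q (poly p (length z))"
      using p[OF y(2)] q[OF y(1)] poly_nat_mono[of "length y" _ q] le_trans by blast
    ultimately show ?thesis by (simp add: poly_pcompose)
  qed
  then show ?thesis unfolding polynomially_balanced_def by blast
qed

lemma E3_equiv_iff:
  assumes "f \<in> carrier RM_P" "g \<in> carrier RM_P"
  shows "(f, g) \<in> E3_equiv \<longleftrightarrow>
    (\<forall>x\<in>dom f. \<exists>w. x @ w \<in> dom g) \<and> (\<forall>x\<in>dom g. \<exists>w. x @ w \<in> dom f) \<and>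
    (\<forall>x y z. f x = Some y \<longrightarrow> g x = Some z \<longrightarrow> y = z) \<and>
    (\<exists>\<tau>\<in>E3. \<forall>x\<in>domC f. \<forall>y\<in>domC g. pref_comparable x y \<longrightarrow>
      length x \<le> \<tau> (length y) \<and> length y \<le> \<tau> (length x))"
proof -
  have "right_ideal (dom f)" "right_ideal (dom g)" using assms morphismD(1) by auto
  note * = end_equiv_domC_iff[OF this]
  have "(\<forall>x\<in>dom f \<inter> dom g. f x = g x) \<longleftrightarrow> (\<forall>x y z. f x = Some y \<longrightarrow> g x = Some z \<longrightarrow> y = z)"
  proof (intro iffI allI impI ballI)
    fix x y z assume "\<forall>x\<in>dom f \<inter> dom g. f x = g x" and fx: "f x = Some y" and gx: "g x = Some z"
    then have "f x = g x" by blast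
    then show "y = z" by (simp only: fx gx option.inject)
  next
    fix x assume *: "\<forall>x y z. f x = Some y \<longrightarrow> g x = Some z \<longrightarrow> y = z" and "x \<in> dom f \<inter> dom g"
    then obtain y z where fx: "f x = Some y" and gx: "g x = Some z" by blast
    then have "y = z" using * by blast
    then show "f x = g x" by (simp only: fx gx)
  qed
  then show ?thesis using assms by (simp add: E3_equiv_def E3_equiv_code_def * conj_ac)
qed

lemma E3_equivI:
  assumes "f \<in> carrier RM_P" "g \<in> carrier RM_P"
    and "\<And>x. x \<in> dom f \<Longrightarrow> \<exists>w. x @ w \<in> dom g" "\<And>x. x \<in> dom g \<Longrightarrow> \<exists>w. x @ w \<in> dom f"
    and "\<And>x y z. f x = Some y \<Longrightarrow> g x = Some z \<Longrightarrow> y = z"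
    and "\<tau> \<in> E3" "\<And>x y. x \<in> domC f \<Longrightarrow> y \<in> domC g \<Longrightarrow> pref_comparable x y \<Longrightarrow>
      length x \<le> \<tau> (length y) \<and> length y \<le> \<tau> (length x)"
  shows "(f, g) \<in> E3_equiv"
  unfolding E3_equiv_iff[OF assms(1,2)] using assms(3-) by (intro conjI allI impI ballI bexI[of _ \<tau>]) auto

lemma E3_equiv_carrier: "(f, g) \<in> E3_equiv \<Longrightarrow> f \<in> carrier RM_P \<and> g \<in> carrier RM_P"
  by (simp add: E3_equiv_def)

lemma sym_E3_equiv: "sym E3_equiv"
proof (rule symI)
  fix f g assume *: "(f, g) \<in> E3_equiv"
  then have car: "f \<in> carrier RM_P" "g \<in> carrier RM_P" using E3_equiv_carrier by blast+
  have comm: "pref_comparable x y = pref_comparable y x" for x y by (auto simp: pref_comparable_def)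
  note props = *[unfolded E3_equiv_iff[OF car]]
  obtain \<tau> where \<tau>: "\<tau> \<in> E3" "\<And>x y. x \<in> domC f \<Longrightarrow> y \<in> domC g \<Longrightarrow> pref_comparable x y \<Longrightarrow>
      length x \<le> \<tau> (length y) \<and> length y \<le> \<tau> (length x)" using props by blast
  show "(g, f) \<in> E3_equiv"
  proof (rule E3_equivI[OF car(2,1) _ _ _ \<tau>(1)])
    show "length x \<le> \<tau> (length y) \<and> length y \<le> \<tau> (length x)"
      if "x \<in> domC g" "y \<in> domC f" "pref_comparable x y" for x y
      using \<tau>(2)[of y x] that comm by blast
    show "y = z" if "g x = Some y" "f x = Some z" for x y z
      using props that by metis
  qed (use props in blast)+
qed

lemma refl_E3_equiv: "f \<in> carrier RM_P \<Longrightarrow> (f, f) \<in> E3_equiv"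
proof -
  assume f: "f \<in> carrier RM_P"
  then have "right_ideal (dom f)" using morphismD by auto
  then have "prefix_code (domC f)" using domC_generates by blast
  then have eq: "x = y" if "x \<in> domC f" "y \<in> domC f" "pref_comparable x y" for x y
    using that unfolding prefix_code_def by blast
  show ?thesis
  proof (rule E3_equivI[OF f f _ _ _ E3_id])
    show "length x \<le> length y \<and> length y \<le> length x"
      if "x \<in> domC f" "y \<in> domC f" "pref_comparable x y" for x y
      using eq[OF that] by simp
    show "\<exists>w. x @ w \<in> dom f" if "x \<in> dom f" for x using that by (metis append_Nil2)
    then show "\<exists>w. x @ w \<in> dom f" if "x \<in> dom f" for x using that .
  qed simp
qed

text \<open>Let \<open>x\<close> and \<open>z\<close> be comparable words of the outer codes. A common extension of both can be extended
  into the domain of \<open>g\<close>, hence it has an extension with a prefix \<open>y\<close> in the middle code, and \<open>y\<close> is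
  comparable with both. So the two given bounds can be composed. For agreement, common
  arguments of \<open>f\<close> and \<open>h\<close> are likewise extended into the domain of \<open>g\<close>, and the added suffix is
  cancelled from the values.\<close>

lemma trans_E3_equiv: "trans E3_equiv"
proof (rule transI)
  fix f g h assume fg: "(f, g) \<in> E3_equiv" and gh: "(g, h) \<in> E3_equiv"
  have car: "f \<in> carrier RM_P" "g \<in> carrier RM_P" "h \<in> carrier RM_P"
    using fg gh E3_equiv_carrier by blast+
  then have mor: "right_ideal_morphism f" "right_ideal_morphism g" "right_ideal_morphism h" by auto
  note ideal = mor[THEN morphismD(1)]
  note app = mor[THEN morphismD(2)]
  note fg' = fg[unfolded E3_equiv_iff[OF car(1,2)]] and gh' = gh[unfolded E3_equiv_iff[OF car(2,3)]]
  obtain \<sigma> where \<sigma>: "\<sigma> \<in> E3" "\<And>x y. x \<in> domC f \<Longrightarrow> y \<in> domC g \<Longrightarrow> pref_comparable x y \<Longrightarrow>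
    length x \<le> \<sigma> (length y) \<and> length y \<le> \<sigma> (length x)" using fg' by blast
  obtain \<tau> where \<tau>: "\<tau> \<in> E3" "\<And>x y. x \<in> domC g \<Longrightarrow> y \<in> domC h \<Longrightarrow> pref_comparable x y \<Longrightarrow>
    length x \<le> \<tau> (length y) \<and> length y \<le> \<tau> (length x)" using gh' by blast
  let ?\<rho> = "\<lambda>n. \<sigma> (\<tau> n) + \<tau> (\<sigma> n)"
  have \<rho>: "?\<rho> \<in> E3" using E3_add[OF E3_comp[OF \<sigma>(1) \<tau>(1)] E3_comp[OF \<tau>(1) \<sigma>(1)]] .
  show "(f, h) \<in> E3_equiv"
  proof (rule E3_equivI[OF car(1,3) _ _ _ \<rho>])
    show "length x \<le> ?\<rho> (length z) \<and> length z \<le> ?\<rho> (length x)"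
      if x: "x \<in> domC f" and z: "z \<in> domC h" and xz: "pref_comparable x z" for x z
    proof -
      obtain u where u: "prefix x u" "prefix z u"
        using xz pref_comparable_iff_common_extension by blast
      then have "u \<in> dom f"
        using x right_ideal_prefix[OF ideal(1)] domC_subset_dom[OF ideal(1)] by blast
      then obtain w where "u @ w \<in> dom g" using fg' by blast
      then obtain y where y: "y \<in> domC g" "prefix y (u @ w)" using in_dom_iff_domC[OF ideal(2)] by blast
      have "pref_comparable x y" "pref_comparable y z"
        using u y(2) pref_comparable_iff_common_extension prefix_prefix by blast+
      then have *: "length x \<le> \<sigma> (length y)" "length y \<le> \<sigma> (length x)"
        "length y \<le> \<tau> (length z)" "length z \<le> \<tau> (length y)"
        using \<sigma>(2)[OF x y(1)] \<tau>(2)[OF y(1) z] by auto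
      then have "\<sigma> (length y) \<le> \<sigma> (\<tau> (length z))" "\<tau> (length y) \<le> \<tau> (\<sigma> (length x))"
        using \<sigma>(1) \<tau>(1) unfolding E3_iff mono_def by blast+
      then show ?thesis using * by linarith
    qed
    show "y = z" if xyz: "f x = Some y" "h x = Some z" for x y z
    proof -
      obtain w where "x @ w \<in> dom g" using xyz fg' by blast
      then obtain v where "g (x @ w) = Some v" by blast
      then have "v = y @ w" "v = z @ w"
        using fg' gh' app(1)[OF xyz(1)] app(3)[OF xyz(2)] by blast+
      then show ?thesis by simp
    qed
    show "\<exists>w. x @ w \<in> dom h" if x: "x \<in> dom f" for x
    proof -
      obtain v where "x @ v \<in> dom g" using x fg' by blast
      then obtain w where "(x @ v) @ w \<in> dom h" using gh' by blast
      then show ?thesis by auto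
    qed
    show "\<exists>w. x @ w \<in> dom f" if x: "x \<in> dom h" for x
    proof -
      obtain v where "x @ v \<in> dom g" using x gh' by blast
      then obtain w where "(x @ v) @ w \<in> dom f" using fg' by blast
      then show ?thesis by auto
    qed
  qed
qed

lemma equiv_E3: "equiv (carrier RM_P) E3_equiv"
  by (rule equivI) (use E3_equiv_carrier sym_E3_equiv trans_E3_equiv refl_E3_equiv
      in \<open>auto intro: refl_onI\<close>)

text \<open>
  The length bound for composites, in one of the two directions. Only the case that \<open>x'\<close> properly
  extends \<open>x\<close> matters. Let \<open>q'\<close> be the prefix of \<open>x'\<close> in \<open>domC g'\<close>, and \<open>r'\<close> the prefix of \<open>g' x'\<close> in
  \<open>domC f'\<close>. They are comparable with the corresponding words \<open>q\<close> and \<open>r\<close> for \<open>x\<close>, because \<open>g x'\<close> and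
  \<open>g' x'\<close> are equal, and thus they are short in terms of \<open>x\<close>. The composite is already
  defined on the prefix of \<open>x'\<close> of length \<open>length q' + length r'\<close>: beyond \<open>q'\<close> every letter of
  the argument is a letter of the value. By minimality \<open>x'\<close> is not longer than that.
\<close>

lemma comp_code_bound:
  assumes f: "right_ideal_morphism f" "right_ideal_morphism f'"
    and g: "right_ideal_morphism g" "right_ideal_morphism g'"
    and agree: "\<And>x y z. g x = Some y \<Longrightarrow> g' x = Some z \<Longrightarrow> y = z"
    and \<sigma>: "\<sigma> \<in> E3" "\<And>x y. x \<in> domC f \<Longrightarrow> y \<in> domC f' \<Longrightarrow> pref_comparable x y \<Longrightarrow> length y \<le> \<sigma> (length x)"
    and \<tau>: "\<tau> \<in> E3" "\<And>x y. x \<in> domC g \<Longrightarrow> y \<in> domC g' \<Longrightarrow> pref_comparable x y \<Longrightarrow> length y \<le> \<tau> (length x)"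
    and p: "\<And>x y. g x = Some y \<Longrightarrow> length y \<le> poly p (length x)"
    and x: "x \<in> domC (f \<circ>\<^sub>m g)" and x': "x' \<in> domC (f' \<circ>\<^sub>m g')" and "pref_comparable x x'"
  shows "length x' \<le> \<tau> (length x) + \<sigma> (length x + poly p (length x))"
proof (cases "prefix x' x")
  case True
  then have "length x' \<le> length x" by (rule prefix_length_le)
  also have "\<dots> \<le> \<tau> (length x)" using \<tau>(1) by (simp add: E3_iff)
  finally show ?thesis by simp
next
  case False
  then obtain v where v: "x' = x @ v"
    using assms by (auto simp: pref_comparable_def prefix_def)
  note comp = morphism_comp[OF f(1) g(1)] morphism_comp[OF f(2) g(2)]
  obtain y where y: "g x = Some y" "y \<in> dom f"
    using domC_subset_dom[OF morphismD(1)[OF comp(1)] x, unfolded dom_map_comp_iff] by blast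
  obtain y' where y': "g' x' = Some y'" "y' \<in> dom f'"
    using domC_subset_dom[OF morphismD(1)[OF comp(2)] x', unfolded dom_map_comp_iff] by blast
  have y'_eq: "y' = y @ v"
    using agree[OF _ y'(1)] morphismD(2)[OF g(1) y(1), of v] v by blast
  obtain q where q: "q \<in> domC g" "prefix q x"
    using y(1) in_dom_iff_domC[OF morphismD(1)[OF g(1)]] by blast
  obtain q' where q': "q' \<in> domC g'" "prefix q' x'"
    using y'(1) in_dom_iff_domC[OF morphismD(1)[OF g(2)]] by blast
  obtain r where r: "r \<in> domC f" "prefix r y"
    using y(2) in_dom_iff_domC[OF morphismD(1)[OF f(1)]] by blast
  obtain r' where r': "r' \<in> domC f'" "prefix r' y'"
    using y'(2) in_dom_iff_domC[OF morphismD(1)[OF f(2)]] by blast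
  have "pref_comparable q q'"
    using q(2) q'(2) v prefix_prefix pref_comparable_iff_common_extension by blast
  then have "length q' \<le> \<tau> (length q)" using \<tau>(2) q(1) q'(1) by blast
  also have "\<dots> \<le> \<tau> (length x)"
    using \<tau>(1) prefix_length_le[OF q(2)] by (auto simp: E3_iff mono_def)
  finally have q'_len: "length q' \<le> \<tau> (length x)" .
  have "pref_comparable r r'"
    using r(2) r'(2) y'_eq prefix_prefix pref_comparable_iff_common_extension by blast
  then have "length r' \<le> \<sigma> (length r)" using \<sigma>(2) r(1) r'(1) by blast
  also have "\<dots> \<le> \<sigma> (length x + poly p (length x))"
    using \<sigma>(1) prefix_length_le[OF r(2)] p[OF y(1)] by (auto simp: E3_iff mono_def)
  finally have r'_len: "length r' \<le> \<sigma> (length x + poly p (length x))" .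
  \<comment> \<open>cut off \<open>x'\<close> where \<open>g'\<close> is already defined and its value already extends \<open>r'\<close>\<close>
  define w where "w = take (length q' + length r') x'"
  obtain t where t: "x' = q' @ t" using q'(2) by (auto simp: prefix_def)
  obtain s where s: "g' q' = Some s"
    using domC_subset_dom[OF morphismD(1)[OF g(2)] q'(1)] by blast
  have w_eq: "w = q' @ take (length r') t" by (simp add: w_def t)
  have gw: "g' w = Some (s @ take (length r') t)"
    unfolding w_eq by (rule morphismD(2)[OF g(2) s])
  have y'_st: "y' = s @ t" using morphismD(2)[OF g(2) s, of t] y'(1) t by simp
  have "prefix r' (s @ take (length r') t)"
  proof -
    have "r' = take (length r') y'" using r'(2) by (auto simp: prefix_def)
    also have "\<dots> = take (length r') (s @ take (length r') t)" by (simp add: y'_st)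
    finally show ?thesis using take_is_prefix by metis
  qed
  then have "w \<in> dom (f' \<circ>\<^sub>m g')"
    unfolding dom_map_comp_iff using gw in_dom_iff_domC[OF morphismD(1)[OF f(2)]] r'(1) by blast
  then have "w = x'"
    using domC_minimal[OF morphismD(1)[OF comp(2)] x'] take_is_prefix w_def by blast
  then have "length x' \<le> length q' + length r'" unfolding w_def by (metis length_take min.cobounded2)
  then show ?thesis using q'_len r'_len by linarith
qed

lemma E3_equiv_comp:
  assumes ff: "(f, f') \<in> E3_equiv" and gg: "(g, g') \<in> E3_equiv"
    and fg: "f \<circ>\<^sub>m g \<in> carrier RM_P" and fg': "f' \<circ>\<^sub>m g' \<in> carrier RM_P"
  shows "(f \<circ>\<^sub>m g, f' \<circ>\<^sub>m g') \<in> E3_equiv"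
proof -
  have car: "f \<in> carrier RM_P" "f' \<in> carrier RM_P" "g \<in> carrier RM_P" "g' \<in> carrier RM_P"
    using ff gg E3_equiv_carrier by blast+
  then have mor: "right_ideal_morphism f" "right_ideal_morphism f'"
    "right_ideal_morphism g" "right_ideal_morphism g'" by auto
  note app = mor[THEN morphismD(2)]
  note ff_prop = ff[unfolded E3_equiv_iff[OF car(1,2)]] and gg_prop = gg[unfolded E3_equiv_iff[OF car(3,4)]]
  obtain \<sigma> where \<sigma>: "\<sigma> \<in> E3" "\<And>x y. x \<in> domC f \<Longrightarrow> y \<in> domC f' \<Longrightarrow> pref_comparable x y \<Longrightarrow>
    length x \<le> \<sigma> (length y) \<and> length y \<le> \<sigma> (length x)" using ff_prop by blast
  obtain \<tau> where \<tau>: "\<tau> \<in> E3" "\<And>x y. x \<in> domC g \<Longrightarrow> y \<in> domC g' \<Longrightarrow> pref_comparable x y \<Longrightarrow>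
    length x \<le> \<tau> (length y) \<and> length y \<le> \<tau> (length x)" using gg_prop by blast
  have bal: "polynomially_balanced g" "polynomially_balanced g'" using car by (auto simp: fP_def)
  obtain p where p: "\<And>x y. g x = Some y \<Longrightarrow> length y \<le> poly p (length x)"
    using bal(1) unfolding polynomially_balanced_def by blast
  obtain p' where p': "\<And>x y. g' x = Some y \<Longrightarrow> length y \<le> poly p' (length x)"
    using bal(2) unfolding polynomially_balanced_def by blast
  have ff_ext: "x \<in> dom f \<Longrightarrow> \<exists>w. x @ w \<in> dom f'" "x \<in> dom f' \<Longrightarrow> \<exists>w. x @ w \<in> dom f"
    and gg_ext: "g x = Some y \<Longrightarrow> \<exists>w z. g' (x @ w) = Some z" "g' x = Some y \<Longrightarrow> \<exists>w z. g (x @ w) = Some z" for x y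
    using ff_prop gg_prop domI[of g x y] domI[of g' x y] by simp_all (metis domD)+
  have agree: "\<And>x y z. g x = Some y \<Longrightarrow> g' x = Some z \<Longrightarrow> y = z"
    and agree': "\<And>x y z. g' x = Some y \<Longrightarrow> g x = Some z \<Longrightarrow> y = z"
    and agree_f: "\<And>x y z. f x = Some y \<Longrightarrow> f' x = Some z \<Longrightarrow> y = z"
    using ff_prop gg_prop by blast+
  have comm: "pref_comparable x y \<Longrightarrow> pref_comparable y x" for x y by (auto simp: pref_comparable_def)
  define \<rho> where "\<rho> = (\<lambda>n. (\<tau> n + \<sigma> (n + poly p n)) + (\<tau> n + \<sigma> (n + poly p' n)))"
  have \<rho>: "\<rho> \<in> E3" unfolding \<rho>_def
    by (intro E3_add \<tau>(1) E3_comp[OF \<sigma>(1) E3_add_poly[OF E3_id]])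
  show ?thesis
  proof (rule E3_equivI[OF fg fg' _ _ _ \<rho>])
    show "length x \<le> \<rho> (length y) \<and> length y \<le> \<rho> (length x)"
      if "x \<in> domC (f \<circ>\<^sub>m g)" "y \<in> domC (f' \<circ>\<^sub>m g')" "pref_comparable x y" for x y
    proof -
      have b1: "length y \<le> \<tau> (length x) + \<sigma> (length x + poly p (length x))"
        by (rule comp_code_bound[OF mor agree \<sigma>(1) conjunct2[OF \<sigma>(2)] \<tau>(1) conjunct2[OF \<tau>(2)] p that])
      have \<sigma>': "length u \<le> \<sigma> (length v)"
        if "v \<in> domC f'" "u \<in> domC f" "pref_comparable v u" for u v
        using \<sigma>(2)[OF that(2,1) comm[OF that(3)]] by simp
      have \<tau>': "length u \<le> \<tau> (length v)"
        if "v \<in> domC g'" "u \<in> domC g" "pref_comparable v u" for u v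
        using \<tau>(2)[OF that(2,1) comm[OF that(3)]] by simp
      have b2: "length x \<le> \<tau> (length y) + \<sigma> (length y + poly p' (length y))"
        by (rule comp_code_bound[OF mor(2,1,4,3) _ \<sigma>(1) \<sigma>' \<tau>(1) \<tau>' p' that(2,1) comm[OF that(3)]])
          (rule agree')
      show ?thesis unfolding \<rho>_def using trans_le_add1[OF b1] trans_le_add2[OF b2] by blast
    qed
    show "\<exists>w. x @ w \<in> dom (f' \<circ>\<^sub>m g')" if x: "x \<in> dom (f \<circ>\<^sub>m g)" for x
    proof -
      obtain y where y: "g x = Some y" "y \<in> dom f" using x unfolding dom_map_comp_iff by blast
      obtain w z where "g' (x @ w) = Some z" using gg_ext(1)[OF y(1)] by blast
      then have w: "g' (x @ w) = Some (y @ w)" using agree[OF app(3)[OF y(1), of w]] by simp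
      have "y @ w \<in> dom f" using y(2) morphismD(1)[OF mor(1)] by (auto simp: right_ideal_iff)
      then obtain v where "(y @ w) @ v \<in> dom f'" using ff_ext(1) by blast
      then have "x @ w @ v \<in> dom (f' \<circ>\<^sub>m g')" using app(4)[OF w, of v] unfolding dom_map_comp_iff append_assoc by blast
      then show ?thesis by blast
    qed
    show "\<exists>w. x @ w \<in> dom (f \<circ>\<^sub>m g)" if x: "x \<in> dom (f' \<circ>\<^sub>m g')" for x
    proof -
      obtain y where y: "g' x = Some y" "y \<in> dom f'" using x unfolding dom_map_comp_iff by blast
      obtain w z where "g (x @ w) = Some z" using gg_ext(2)[OF y(1)] by blast
      then have w: "g (x @ w) = Some (y @ w)" using agree'[OF app(4)[OF y(1), of w]] by simp
      have "y @ w \<in> dom f'" using y(2) morphismD(1)[OF mor(2)] by (auto simp: right_ideal_iff)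
      then obtain v where "(y @ w) @ v \<in> dom f" using ff_ext(2) by blast
      then have "x @ w @ v \<in> dom (f \<circ>\<^sub>m g)" using app(3)[OF w, of v] unfolding dom_map_comp_iff append_assoc by blast
      then show ?thesis by blast
    qed
    show "y = z" if xyz: "(f \<circ>\<^sub>m g) x = Some y" "(f' \<circ>\<^sub>m g') x = Some z" for x y z
    proof -
      obtain u v where "g x = Some u" "f u = Some y" "g' x = Some v" "f' v = Some z"
        using xyz by (auto simp: map_comp_Some_iff)
      then show ?thesis using agree agree_f by metis
    qed
  qed
qed

section \<open>Quotient monoids\<close>

lemma quotient_mult_class:
  assumes eq: "equiv (carrier M) r"
    and cong: "\<And>a b c d. (a, b) \<in> r \<Longrightarrow> (c, d) \<in> r \<Longrightarrow> (a \<otimes>\<^bsub>M\<^esub> c, b \<otimes>\<^bsub>M\<^esub> d) \<in> r"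
    and ab: "a \<in> carrier M" "b \<in> carrier M"
  shows "r `` {a} \<otimes>\<^bsub>quotient_monoid M r\<^esub> r `` {b} = r `` {a \<otimes>\<^bsub>M\<^esub> b}"
proof -
  have "r `` {x \<otimes>\<^bsub>M\<^esub> y} = r `` {a \<otimes>\<^bsub>M\<^esub> b}" if "(a, x) \<in> r" "(b, y) \<in> r" for x y
    using equiv_class_eq[OF eq cong[OF that]] by simp
  then have "(\<Union>x\<in>r `` {a}. \<Union>y\<in>r `` {b}. r `` {x \<otimes>\<^bsub>M\<^esub> y}) =
      (\<Union>x\<in>r `` {a}. \<Union>y\<in>r `` {b}. r `` {a \<otimes>\<^bsub>M\<^esub> b})"
    by (intro SUP_cong refl) simp
  moreover have "a \<in> r `` {a}" "b \<in> r `` {b}"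
    using equiv_class_self[OF eq] ab by auto
  then have "(\<Union>x\<in>r `` {a}. \<Union>y\<in>r `` {b}. r `` {a \<otimes>\<^bsub>M\<^esub> b}) = r `` {a \<otimes>\<^bsub>M\<^esub> b}"
    by (metis SUP_const empty_iff)
  ultimately show ?thesis by (simp add: quotient_monoid_def)
qed

lemma monoid_quotient:
  assumes M: "monoid M" and eq: "equiv (carrier M) r"
    and cong: "\<And>a b c d. (a, b) \<in> r \<Longrightarrow> (c, d) \<in> r \<Longrightarrow> (a \<otimes>\<^bsub>M\<^esub> c, b \<otimes>\<^bsub>M\<^esub> d) \<in> r"
  shows "monoid (quotient_monoid M r)"
proof -
  interpret monoid M by fact
  note mult = quotient_mult_class[OF eq cong]
  have car: "carrier (quotient_monoid M r) = carrier M // r"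
    and one: "\<one>\<^bsub>quotient_monoid M r\<^esub> = r `` {\<one>\<^bsub>M\<^esub>}"
    by (simp_all add: quotient_monoid_def)
  show ?thesis
  proof (rule monoidI; unfold car one)
    fix X Y assume "X \<in> carrier M // r" "Y \<in> carrier M // r"
    then obtain a b where "X = r `` {a}" "a \<in> carrier M" "Y = r `` {b}" "b \<in> carrier M"
      by (auto elim!: quotientE)
    then show "X \<otimes>\<^bsub>quotient_monoid M r\<^esub> Y \<in> carrier M // r"
      using mult[of a b] by (simp add: quotientI)
  next
    show "r `` {\<one>\<^bsub>M\<^esub>} \<in> carrier M // r" by (auto intro: quotientI)
  next
    fix X Y Z assume "X \<in> carrier M // r" "Y \<in> carrier M // r" "Z \<in> carrier M // r"
    then obtain a b c where "X = r `` {a}" "a \<in> carrier M" "Y = r `` {b}" "b \<in> carrier M"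
      "Z = r `` {c}" "c \<in> carrier M"
      by (auto elim!: quotientE)
    then show "X \<otimes>\<^bsub>quotient_monoid M r\<^esub> Y \<otimes>\<^bsub>quotient_monoid M r\<^esub> Z =
        X \<otimes>\<^bsub>quotient_monoid M r\<^esub> (Y \<otimes>\<^bsub>quotient_monoid M r\<^esub> Z)"
      using mult[of a b] mult[of b c] mult[of "a \<otimes>\<^bsub>M\<^esub> b" c] mult[of a "b \<otimes>\<^bsub>M\<^esub> c"] by (simp add: m_assoc)
  next
    fix X assume "X \<in> carrier M // r"
    then obtain a where "X = r `` {a}" "a \<in> carrier M" by (auto elim!: quotientE)
    then show "r `` {\<one>\<^bsub>M\<^esub>} \<otimes>\<^bsub>quotient_monoid M r\<^esub> X = X" "X \<otimes>\<^bsub>quotient_monoid M r\<^esub> r `` {\<one>\<^bsub>M\<^esub>} = X"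
      using mult[of "\<one>\<^bsub>M\<^esub>" a] mult[of a "\<one>\<^bsub>M\<^esub>"] by simp_all
  qed
qed

section \<open>Structured programs on tapes\<close>

type_synonym store = "nat \<Rightarrow> tape"

text \<open>An action reads the scanned symbols of all tapes and prescribes a symbol and a move for each of
  them. Tests depend on the scanned symbols only. \<open>Fail\<close> rejects from within any nesting of
  constructs.\<close>

datatype prog =
    Act "(nat \<Rightarrow> nat) \<Rightarrow> nat \<Rightarrow> nat \<times> move"
  | Seq prog prog
  | Cond "(nat \<Rightarrow> nat) \<Rightarrow> bool" prog prog
  | Loop "(nat \<Rightarrow> nat) \<Rightarrow> bool" prog
  | Fail

definition scan :: "store \<Rightarrow> nat \<Rightarrow> nat" where
  "scan \<sigma> = (\<lambda>i. \<sigma> i 0)"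

definition stay :: "(nat \<Rightarrow> nat) \<Rightarrow> nat \<Rightarrow> nat \<times> move" where
  "stay r = (\<lambda>i. (r i, No_Move))"

definition acts :: "store \<Rightarrow> (nat \<Rightarrow> nat \<times> move) \<Rightarrow> store" where
  "acts \<sigma> a = (\<lambda>i. act (\<sigma> i) (a i))"

text \<open>The control state is the list of programs that remain to be executed; \<open>[]\<close> is the accepting and
  \<open>[Fail]\<close> the rejecting state. Both are repeated forever, as halting configurations of machines are.\<close>

fun next_action :: "prog list \<Rightarrow> (nat \<Rightarrow> nat) \<Rightarrow> prog list \<times> (nat \<Rightarrow> nat \<times> move)" where
  "next_action [] r = ([], stay r)"
| "next_action (Act A # k) r = (k, A r)"
| "next_action (Seq p q # k) r = (p # q # k, stay r)"
| "next_action (Cond b p q # k) r = ((if b r then p else q) # k, stay r)"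
| "next_action (Loop b p # k) r = (if b r then p # Loop b p # k else k, stay r)"
| "next_action (Fail # k) r = ([Fail], stay r)"

fun prog_step :: "prog list \<times> store \<Rightarrow> prog list \<times> store" where
  "prog_step (k, \<sigma>) = (case next_action k (scan \<sigma>) of (k', a) \<Rightarrow> (k', acts \<sigma> a))"

lemma acts_stay [simp]: "acts \<sigma> (stay (scan \<sigma>)) = \<sigma>"
  by (simp add: acts_def stay_def scan_def)

lemma prog_step_halt: "(prog_step ^^ n) ([], \<sigma>) = ([], \<sigma>)" "(prog_step ^^ n) ([Fail], \<sigma>) = ([Fail], \<sigma>)"
  by (induction n) auto

text \<open>The bound \<open>N\<close> need not be exact, so that time bounds may be simplified. The quantification over the
  continuation \<open>k\<close> makes the predicate compositional.\<close>

definition runs :: "prog \<Rightarrow> store \<Rightarrow> nat \<Rightarrow> store \<Rightarrow> bool" where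
  "runs p \<sigma> N \<tau> \<longleftrightarrow> (\<exists>n\<le>N. \<forall>k. (prog_step ^^ n) (p # k, \<sigma>) = (k, \<tau>))"

lemma runs_mono: "runs p \<sigma> M \<tau> \<Longrightarrow> M \<le> N \<Longrightarrow> runs p \<sigma> N \<tau>"
  unfolding runs_def using le_trans by blast

lemma runs_Act: "runs (Act A) \<sigma> 1 (acts \<sigma> (A (scan \<sigma>)))"
  unfolding runs_def by (rule exI[of _ 1]) simp

lemma runs_step:
  assumes "\<And>k. prog_step (p # k, \<sigma>) = (q # k, \<sigma>)" "runs q \<sigma> N \<tau>"
  shows "runs p \<sigma> (N + 1) \<tau>"
proof -
  obtain n where "n \<le> N" "\<And>k. (prog_step ^^ n) (q # k, \<sigma>) = (k, \<tau>)"
    using assms(2) unfolding runs_def by blast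
  then show ?thesis unfolding runs_def
    using assms(1) by (intro exI[of _ "Suc n"]) (simp del: funpow.simps add: funpow_Suc_right)
qed

lemma runs_step2:
  assumes "\<And>k. prog_step (p # k, \<sigma>) = (q # r # k, \<sigma>)" "runs q \<sigma> N \<rho>" "runs r \<rho> M \<tau>"
  shows "runs p \<sigma> (N + M + 1) \<tau>"
proof -
  obtain n where n: "n \<le> N" "\<And>k. (prog_step ^^ n) (q # k, \<sigma>) = (k, \<rho>)"
    using assms(2) unfolding runs_def by blast
  obtain m where m: "m \<le> M" "\<And>k. (prog_step ^^ m) (r # k, \<rho>) = (k, \<tau>)"
    using assms(3) unfolding runs_def by blast
  have "(prog_step ^^ (m + n + 1)) (p # k, \<sigma>) = (k, \<tau>)" for k
    unfolding funpow_add by (simp add: assms(1) n m del: prog_step.simps)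
  then show ?thesis unfolding runs_def using n(1) m(1) by (intro exI[of _ "m + n + 1"]) auto
qed

lemma runs_Seq: "runs p \<sigma> N \<rho> \<Longrightarrow> runs q \<rho> M \<tau> \<Longrightarrow> runs (Seq p q) \<sigma> (N + M + 1) \<tau>"
  by (rule runs_step2) auto

lemma runs_Cond_True: "b (scan \<sigma>) \<Longrightarrow> runs p \<sigma> N \<tau> \<Longrightarrow> runs (Cond b p q) \<sigma> (N + 1) \<tau>"
  by (rule runs_step) auto

lemma runs_Cond_False: "\<not> b (scan \<sigma>) \<Longrightarrow> runs q \<sigma> N \<tau> \<Longrightarrow> runs (Cond b p q) \<sigma> (N + 1) \<tau>"
  by (rule runs_step) auto

lemma runs_Loop_stop: "\<not> b (scan \<sigma>) \<Longrightarrow> runs (Loop b p) \<sigma> 1 \<sigma>"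
  unfolding runs_def by (rule exI[of _ 1]) simp

lemma runs_Loop_step:
  "b (scan \<sigma>) \<Longrightarrow> runs p \<sigma> N \<rho> \<Longrightarrow> runs (Loop b p) \<rho> M \<tau> \<Longrightarrow> runs (Loop b p) \<sigma> (N + M + 1) \<tau>"
  by (rule runs_step2) auto

text \<open>The stores between the iterations are given in advance as a sequence \<open>s\<close>.\<close>

lemma runs_Loop:
  assumes "\<And>i. i < n \<Longrightarrow> b (scan (s i)) \<and> runs p (s i) T (s (Suc i))"
    and "\<not> b (scan (s n))"
  shows "runs (Loop b p) (s 0) (n * (T + 1) + 1) (s n)"
  using assms
proof (induction n arbitrary: s)
  case 0
  then show ?case using runs_Loop_stop by simp
next
  case (Suc n)
  have "runs (Loop b p) (s (Suc 0)) (n * (T + 1) + 1) (s (Suc n))"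
    using Suc.IH[of "\<lambda>i. s (Suc i)"] Suc.prems by auto
  from runs_Loop_step[OF _ _ this] Suc.prems(1)[of 0]
  have "runs (Loop b p) (s 0) (T + (n * (T + 1) + 1) + 1) (s (Suc n))" by blast
  then show ?case by (rule runs_mono) simp
qed

section \<open>Compilation to Turing machines\<close>

text \<open>What makes a program a machine with \<open>K\<close> tapes and \<open>S\<close> symbols: symbols stay below \<open>S\<close>, and tapes
  from \<open>K\<close> on are never altered as long as they are blank.\<close>

fun wf_prog :: "nat \<Rightarrow> nat \<Rightarrow> prog \<Rightarrow> bool" where
  "wf_prog K S (Act A) \<longleftrightarrow> (\<forall>r. (\<forall>i. r i < S) \<longrightarrow> (\<forall>i. fst (A r i) < S)) \<and>
     (\<forall>r i. K \<le> i \<longrightarrow> r i = 0 \<longrightarrow> A r i = (0, No_Move))"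
| "wf_prog K S (Seq p q) \<longleftrightarrow> wf_prog K S p \<and> wf_prog K S q"
| "wf_prog K S (Cond b p q) \<longleftrightarrow> wf_prog K S p \<and> wf_prog K S q"
| "wf_prog K S (Loop b p) \<longleftrightarrow> wf_prog K S p"
| "wf_prog K S Fail \<longleftrightarrow> True"

text \<open>All continuations that can occur while \<open>p\<close> is executed in front of \<open>k\<close>, except \<open>k\<close> itself and
  \<open>[Fail]\<close>. There are finitely many of them, and they serve as the states of the machine.\<close>

fun continuations :: "prog \<Rightarrow> prog list \<Rightarrow> prog list set" where
  "continuations (Act A) k = {Act A # k}"
| "continuations (Seq p q) k = {Seq p q # k} \<union> continuations p (q # k) \<union> continuations q k"
| "continuations (Cond b p q) k = {Cond b p q # k} \<union> continuations p k \<union> continuations q k"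
| "continuations (Loop b p) k = {Loop b p # k} \<union> continuations p (Loop b p # k)"
| "continuations Fail k = {Fail # k}"

lemma finite_continuations: "finite (continuations p k)"
  by (induction p arbitrary: k) auto

lemma start_in_continuations: "p # k \<in> continuations p k"
  by (cases p) auto

lemma continuations_closed:
  "c \<in> continuations p k \<Longrightarrow> fst (next_action c r) \<in> continuations p k \<union> {k, [Fail]}"
proof (induction p arbitrary: k)
  case (Seq p q)
  then show ?case using start_in_continuations by fastforce
next
  case (Cond b p q)
  then show ?case using start_in_continuations by fastforce
next
  case (Loop b p)
  then show ?case using start_in_continuations by fastforce
qed auto

lemma continuations_wf:
  "c \<in> continuations p k \<Longrightarrow> wf_prog K S p \<Longrightarrow> \<exists>q c'. c = q # c' \<and> wf_prog K S q"
  by (induction p arbitrary: k) auto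

definition input_store :: "word \<Rightarrow> store" where
  "input_store x = (\<lambda>_ _. 0)(0 := word_tape x)"

definition control :: "prog \<Rightarrow> prog list set" where
  "control p = continuations p [] \<union> {[], [Fail]}"

lemma control_closed: "c \<in> control p \<Longrightarrow> fst (next_action c r) \<in> control p"
  unfolding control_def using continuations_closed[of c p "[]" r] by auto

lemma control_wf_action:
  assumes c: "c \<in> control p" and wf: "wf_prog K S p"
  shows "(\<forall>i. r i < S) \<Longrightarrow> fst (snd (next_action c r) i) < S"
    and "K \<le> i \<Longrightarrow> r i = 0 \<Longrightarrow> snd (next_action c r) i = (0, No_Move)"
proof -
  consider "c = []" | "c = [Fail]" | q c' where "c = q # c'" "wf_prog K S q"
    using c wf continuations_wf unfolding control_def by blast
  then have "((\<forall>i. r i < S) \<longrightarrow> fst (snd (next_action c r) i) < S) \<and>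
     (K \<le> i \<longrightarrow> r i = 0 \<longrightarrow> snd (next_action c r) i = (0, No_Move))"
  proof cases
    case 3
    then show ?thesis by (cases q) (auto simp: stay_def)
  qed (auto simp: stay_def)
  then show "(\<forall>i. r i < S) \<Longrightarrow> fst (snd (next_action c r) i) < S"
    and "K \<le> i \<Longrightarrow> r i = 0 \<Longrightarrow> snd (next_action c r) i = (0, No_Move)" by blast+
qed

text \<open>Since programs contain functions, their continuations cannot be numbered effectively; but any
  bijection of the finite set of continuations with an initial segment of the naturals will do. Steps
  of the program and of the machine then correspond one to one.\<close>

lemma compile_prog:
  assumes wf: "wf_prog K S p" and K: "1 \<le> K" and S: "3 \<le> S"
  obtains M where "wf_tm M"
    and "\<And>x n c \<sigma>. (prog_step ^^ n) ([p], input_store x) = (c, \<sigma>) \<Longrightarrow>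
       (c = [] \<longrightarrow> fst ((tm_step M ^^ n) (tm_init M x)) = tm_accept M) \<and>
       (c = [Fail] \<longrightarrow> fst ((tm_step M ^^ n) (tm_init M x)) = tm_reject M) \<and>
       hd (snd ((tm_step M ^^ n) (tm_init M x))) = \<sigma> 0"
proof -
  let ?C = "control p"
  have "finite ?C" by (simp add: control_def finite_continuations)
  then obtain e where e: "bij_betw e ?C {0..<card ?C}" using ex_bij_betw_finite_nat by blast
  define d where "d = inv_into ?C e"
  have d: "d (e c) = c" if "c \<in> ?C" for c
    using that e by (simp add: d_def bij_betw_inv_into_left)
  have d_in: "d q \<in> ?C" if "q < card ?C" for q
    using that bij_betw_inv_into[OF e] unfolding d_def by (auto simp: bij_betw_def)
  have e_lt: "e c < card ?C" if "c \<in> ?C" for c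
    using that e by (auto simp: bij_betw_def)
  have mem: "[] \<in> ?C" "[Fail] \<in> ?C" "[p] \<in> ?C"
    using start_in_continuations by (auto simp: control_def)
  define reading where "reading ys = (\<lambda>i. if i < K then ys ! i else 0)" for ys :: "nat list"
  define \<delta> where "\<delta> q ys = (case next_action (d q) (reading ys) of
      (c, a) \<Rightarrow> (e c, map a [0..<K]))" for q ys
  define M where "M = \<lparr>tm_tapes = K, tm_symbols = S, tm_states = card ?C, tm_start = e [p],
    tm_accept = e [], tm_reject = e [Fail], tm_delta = \<delta>\<rparr>"
  have M_simps: "tm_tapes M = K" "tm_symbols M = S" "tm_states M = card ?C" "tm_start M = e [p]"
    "tm_accept M = e []" "tm_reject M = e [Fail]" "tm_delta M = \<delta>"
    by (simp_all add: M_def)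
  have e_eq: "e c = e c' \<longleftrightarrow> c = c'" if "c \<in> ?C" "c' \<in> ?C" for c c'
    using d that by metis
  have "wf_tm M"
    unfolding wf_tm_def M_simps
  proof (intro conjI allI impI)
    show "e [] \<noteq> e [Fail]" using e_eq mem by simp
    fix q ys assume *: "q < card ?C \<and> length ys = K \<and> (\<forall>y\<in>set ys. y < S)"
    obtain c a where ca: "next_action (d q) (reading ys) = (c, a)" by fastforce
    have "c \<in> ?C" using control_closed[OF d_in, of q "reading ys"] * ca by simp
    moreover have "\<forall>i. reading ys i < S" using * S by (auto simp: reading_def)
    then have "fst (a i) < S" for i using control_wf_action(1)[OF d_in wf, of q "reading ys" i] * ca by simp
    then have "\<forall>i<K. case a i of (s, u) \<Rightarrow> s < S" by (simp add: case_prod_beta)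
    ultimately show "case \<delta> q ys of (q', as) \<Rightarrow>
        q' < card ?C \<and> length as = K \<and> (\<forall>(s, d)\<in>set as. s < S)"
      using e_lt by (auto simp: \<delta>_def ca)
  qed (use K S e_lt mem in auto)
  moreover
  define simulates :: "prog list \<times> store \<Rightarrow> config \<Rightarrow> bool"
    where "simulates = (\<lambda>(c, \<sigma>) cf. c \<in> ?C \<and> (\<forall>i\<ge>K. \<sigma> i = (\<lambda>_. 0)) \<and>
    cf = (e c, map \<sigma> [0..<K]))"
  have step: "simulates (prog_step z) (tm_step M cf)" if sim: "simulates z cf" for z cf
  proof -
    obtain c \<sigma> where z: "z = (c, \<sigma>)" by fastforce
    have c: "c \<in> ?C" and blank: "\<And>i. K \<le> i \<Longrightarrow> \<sigma> i = (\<lambda>_. 0)" and cf: "cf = (e c, map \<sigma> [0..<K])"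
      using sim by (auto simp: simulates_def z)
    obtain c' a where ca: "next_action c (scan \<sigma>) = (c', a)" by fastforce
    have c': "c' \<in> ?C" using control_closed[OF c, of "scan \<sigma>"] ca by simp
    have blank': "acts \<sigma> a i = (\<lambda>_. 0)" if "K \<le> i" for i
      using control_wf_action(2)[OF c wf that, of "scan \<sigma>"] blank[OF that] ca
      by (simp add: acts_def scan_def fun_upd_idem)
    have rd: "reading (map (\<lambda>t. t 0) (map \<sigma> [0..<K])) = scan \<sigma>"
      using blank by (auto simp: reading_def scan_def)
    show ?thesis
    proof (cases "c = [] \<or> c = [Fail]")
      case True
      then have "prog_step z = z" "tm_step M cf = cf" by (auto simp: z cf M_simps)
      then show ?thesis using sim by simp
    next
      case False
      then have "e c \<noteq> e []" "e c \<noteq> e [Fail]" using e_eq c mem by auto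
      then have "tm_step M cf = (e c', map2 act (map \<sigma> [0..<K]) (map a [0..<K]))"
        using rd ca by (simp add: cf M_simps \<delta>_def d[OF c])
      also have "map2 act (map \<sigma> [0..<K]) (map a [0..<K]) = map (acts \<sigma> a) [0..<K]"
        by (auto simp: acts_def intro!: nth_equalityI)
      finally show ?thesis using c' blank' ca by (simp add: simulates_def z)
    qed
  qed
  have sim: "simulates ((prog_step ^^ n) ([p], input_store x)) ((tm_step M ^^ n) (tm_init M x))" for n x
  proof (induction n)
    case 0
    have "map (input_store x) [0..<K] = word_tape x # replicate (K - 1) (\<lambda>_. 0)"
      using K by (intro nth_equalityI) (auto simp: input_store_def nth_Cons split: nat.splits)
    then show ?case using K mem
      by (auto simp: simulates_def tm_init_def M_simps) (simp add: input_store_def)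
  next
    case (Suc n)
    then show ?case using step by simp
  qed
  have "(c = [] \<longrightarrow> fst ((tm_step M ^^ n) (tm_init M x)) = tm_accept M) \<and>
       (c = [Fail] \<longrightarrow> fst ((tm_step M ^^ n) (tm_init M x)) = tm_reject M) \<and>
       hd (snd ((tm_step M ^^ n) (tm_init M x))) = \<sigma> 0"
    if "(prog_step ^^ n) ([p], input_store x) = (c, \<sigma>)" for x n c \<sigma>
    using sim[where n=n and x=x] K by (auto simp: that simulates_def M_simps hd_map)
  ultimately show ?thesis by (rule that)
qed

definition fails :: "prog \<Rightarrow> store \<Rightarrow> nat \<Rightarrow> bool" where
  "fails p \<sigma> N \<longleftrightarrow> (\<exists>n\<le>N. \<exists>\<tau>. \<forall>k. (prog_step ^^ n) (p # k, \<sigma>) = ([Fail], \<tau>))"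

lemma fails_mono: "fails p \<sigma> M \<Longrightarrow> M \<le> N \<Longrightarrow> fails p \<sigma> N"
  unfolding fails_def using le_trans by blast

lemma fails_Fail: "fails Fail \<sigma> 1"
  unfolding fails_def by (intro exI[of _ 1]) auto

lemma fails_step:
  assumes "\<And>k. prog_step (p # k, \<sigma>) = (q # k, \<sigma>)" "fails q \<sigma> N"
  shows "fails p \<sigma> (N + 1)"
proof -
  obtain n \<tau> where "n \<le> N" "\<And>k. (prog_step ^^ n) (q # k, \<sigma>) = ([Fail], \<tau>)"
    using assms(2) unfolding fails_def by blast
  then have "Suc n \<le> N + 1" "\<And>k. (prog_step ^^ (Suc n)) (p # k, \<sigma>) = ([Fail], \<tau>)"
    using assms(1) by (simp_all del: funpow.simps add: funpow_Suc_right)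
  then show ?thesis unfolding fails_def by blast
qed

lemma fails_Cond_True: "b (scan \<sigma>) \<Longrightarrow> fails p \<sigma> N \<Longrightarrow> fails (Cond b p q) \<sigma> (N + 1)"
  by (rule fails_step) auto

lemma fails_Cond_False: "\<not> b (scan \<sigma>) \<Longrightarrow> fails q \<sigma> N \<Longrightarrow> fails (Cond b p q) \<sigma> (N + 1)"
  by (rule fails_step) auto

lemma fails_Seq:
  assumes "runs p \<sigma> N \<rho>" "fails q \<rho> M"
  shows "fails (Seq p q) \<sigma> (N + M + 1)"
proof -
  obtain n where n: "n \<le> N" "\<And>k. (prog_step ^^ n) (p # k, \<sigma>) = (k, \<rho>)"
    using assms(1) unfolding runs_def by blast
  obtain m \<tau> where m: "m \<le> M" "\<And>k. (prog_step ^^ m) (q # k, \<rho>) = ([Fail], \<tau>)"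
    using assms(2) unfolding fails_def by blast
  have "(prog_step ^^ (m + n + 1)) (Seq p q # k, \<sigma>) = ([Fail], \<tau>)" for k
    unfolding funpow_add by (simp add: n m)
  then show ?thesis unfolding fails_def using n(1) m(1) by (intro exI[of _ "m + n + 1"]) auto
qed

text \<open>The only interface between programs and polynomial time computability that is used below. As both
  outcomes are fixed points of the step function, it suffices to halt within the time bound.\<close>

theorem polytime_computable_by_prog:
  fixes T :: "nat poly"
  assumes wf: "wf_prog K S p" "1 \<le> K" "3 \<le> S"
    and none: "\<And>x. f x = None \<Longrightarrow> fails p (input_store x) (poly T (length x))"
    and some: "\<And>x y. f x = Some y \<Longrightarrow>
      \<exists>\<tau>. runs p (input_store x) (poly T (length x)) \<tau> \<and> \<tau> 0 = word_tape y"
  shows "polytime_computable f"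
proof -
  obtain M where M: "wf_tm M"
    and sim: "\<And>x n c \<sigma>. (prog_step ^^ n) ([p], input_store x) = (c, \<sigma>) \<Longrightarrow>
       (c = [] \<longrightarrow> fst ((tm_step M ^^ n) (tm_init M x)) = tm_accept M) \<and>
       (c = [Fail] \<longrightarrow> fst ((tm_step M ^^ n) (tm_init M x)) = tm_reject M) \<and>
       hd (snd ((tm_step M ^^ n) (tm_init M x))) = \<sigma> 0"
    using compile_prog[OF wf] by metis
  have wait: "(prog_step ^^ N) z = (c, \<sigma>)"
    if "(prog_step ^^ n) z = (c, \<sigma>)" "n \<le> N" "c = [] \<or> c = [Fail]" for n N z c \<sigma>
  proof -
    have "(prog_step ^^ ((N - n) + n)) z = (c, \<sigma>)"
      unfolding funpow_add using that(1,3) prog_step_halt by auto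
    then show ?thesis using that(2) by simp
  qed
  have "case (tm_step M ^^ poly T (length x)) (tm_init M x) of (q, ts) \<Rightarrow>
      (case f x of None \<Rightarrow> q = tm_reject M | Some y \<Rightarrow> q = tm_accept M \<and> hd ts = word_tape y)" for x
  proof (cases "f x")
    case None
    then obtain \<tau> where "(prog_step ^^ poly T (length x)) ([p], input_store x) = ([Fail], \<tau>)"
      using none[OF None] wait unfolding fails_def by blast
    from sim[OF this] None show ?thesis by (auto simp: case_prod_beta)
  next
    case (Some y)
    then obtain \<tau> where \<tau>: "\<tau> 0 = word_tape y"
      "(prog_step ^^ poly T (length x)) ([p], input_store x) = ([], \<tau>)"
      using some[OF Some] wait unfolding runs_def by blast
    from sim[OF \<tau>(2)] Some \<tau>(1) show ?thesis by (auto simp: case_prod_beta)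
  qed
  then show ?thesis using M unfolding polytime_computable_def by blast
qed

lemma act_simps:
  "act t (s, Left_Move) = (\<lambda>j. (t(0 := s)) (j - 1))"
  "act t (s, No_Move) = t(0 := s)"
  "act t (s, Right_Move) = (\<lambda>j. (t(0 := s)) (j + 1))"
  by simp_all

section \<open>Simulation of a Turing machine by a program\<close>

abbreviation blank_tape :: tape where
  "blank_tape \<equiv> \<lambda>_. 0"

text \<open>A tape used as a register for one symbol.\<close>

definition cell :: "nat \<Rightarrow> tape" where
  "cell s = blank_tape(0 := s)"

text \<open>A simulated machine writes the symbol \<open>D\<close> wherever it would write a blank, and reads \<open>D\<close> as a blank.
  For \<open>D = 0\<close> both translations are the identity, and the simulation is literal.\<close>

definition mark :: "nat \<Rightarrow> nat \<Rightarrow> nat" where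
  "mark D s = (if s = 0 then D else s)"

definition unmark :: "nat \<Rightarrow> nat \<Rightarrow> nat" where
  "unmark D s = (if s = D then 0 else s)"

lemma unmark_act:
  "D = 0 \<or> s < D \<Longrightarrow> unmark D \<circ> act t (mark D s, d) = act (unmark D \<circ> t) (s, d)"
  by (cases d) (auto simp: fun_eq_iff mark_def unmark_def)

lemma unmark_0 [simp]: "unmark 0 \<circ> t = t"
  by (auto simp: unmark_def)

text \<open>One step of \<open>M\<close>. Its state is kept in tape \<open>c\<close>, and its tapes are the tapes listed in \<open>locs\<close>. The
  guard makes the action safe on symbols that are none of \<open>M\<close>'s, about which the transition function
  promises nothing.\<close>

definition sim_action :: "tm \<Rightarrow> nat \<Rightarrow> nat \<Rightarrow> nat list \<Rightarrow> (nat \<Rightarrow> nat) \<Rightarrow> nat \<Rightarrow> nat \<times> move" where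
  "sim_action M D c locs r j =
    (let ys = map (\<lambda>l. unmark D (r l)) locs in
     if r c < tm_states M \<and> (\<forall>y\<in>set ys. y < tm_symbols M) then
       (case tm_delta M (r c) ys of (q, as) \<Rightarrow>
          if j = c then (q, No_Move)
          else case map_of (zip locs as) j of None \<Rightarrow> stay r j | Some (s, d) \<Rightarrow> (mark D s, d))
     else stay r j)"

definition simulate :: "tm \<Rightarrow> nat \<Rightarrow> nat \<Rightarrow> nat list \<Rightarrow> prog" where
  "simulate M D c locs =
     Loop (\<lambda>r. r c \<noteq> tm_accept M \<and> r c \<noteq> tm_reject M) (Act (sim_action M D c locs))"

definition layout :: "tm \<Rightarrow> nat \<Rightarrow> nat \<Rightarrow> nat list \<Rightarrow> bool" where
  "layout M D c locs \<longleftrightarrow> wf_tm M \<and> distinct locs \<and> length locs = tm_tapes M \<and> c \<notin> set locs \<and>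
     (D = 0 \<or> tm_symbols M \<le> D)"

lemma wf_tm_delta:
  assumes "wf_tm M" "q < tm_states M" "length ys = tm_tapes M" "\<forall>y\<in>set ys. y < tm_symbols M"
    and "tm_delta M q ys = (q', as)"
  shows "q' < tm_states M" "length as = tm_tapes M" "\<And>s d. (s, d) \<in> set as \<Longrightarrow> s < tm_symbols M"
proof -
  have "q' < tm_states M \<and> length as = tm_tapes M \<and> (\<forall>(s, d)\<in>set as. s < tm_symbols M)"
    using assms unfolding wf_tm_def by (metis (mono_tags, lifting) case_prod_conv)
  then show "q' < tm_states M" "length as = tm_tapes M" "\<And>s d. (s, d) \<in> set as \<Longrightarrow> s < tm_symbols M"
    by auto
qed

lemma wf_prog_simulate:
  assumes lay: "layout M D c locs" and K: "c < K" "\<forall>l\<in>set locs. l < K"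
    and S: "tm_states M \<le> S" "tm_symbols M \<le> S" "D < S"
  shows "wf_prog K S (simulate M D c locs)"
  unfolding simulate_def wf_prog.simps
proof (intro conjI allI impI)
  fix r :: "nat \<Rightarrow> nat" and j assume r: "\<forall>i. r i < S"
  let ?ys = "map (\<lambda>l. unmark D (r l)) locs"
  obtain q as where \<delta>: "tm_delta M (r c) ?ys = (q, as)" by fastforce
  show "fst (sim_action M D c locs r j) < S"
  proof (cases "r c < tm_states M \<and> (\<forall>y\<in>set ?ys. y < tm_symbols M)")
    case True
    have *: "wf_tm M" "length ?ys = tm_tapes M" using lay by (auto simp: layout_def)
    note props = wf_tm_delta[OF *(1) conjunct1[OF True] *(2) conjunct2[OF True] \<delta>]
    have "mark D s < S" if "map_of (zip locs as) j = Some (s, d)" for s d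
    proof -
      have "(s, d) \<in> set as" using that by (meson map_of_SomeD set_zip_rightD)
      then have "s < S" using props(3) S by fastforce
      then show ?thesis using S by (simp add: mark_def)
    qed
    then show ?thesis using True \<delta> r S props(1)
      by (auto simp: sim_action_def stay_def Let_def split: option.split)
  next
    case False
    then show ?thesis using r unfolding sim_action_def Let_def stay_def by auto
  qed
next
  fix r :: "nat \<Rightarrow> nat" and j assume j: "K \<le> j" "r j = 0"
  then have "j \<noteq> c" "j \<notin> set locs" using K by auto
  then have "map_of (zip locs as) j = None" for as :: "(nat \<times> move) list"
    by (metis map_of_SomeD not_None_eq set_zip_leftD)
  then show "sim_action M D c locs r j = (0, No_Move)"
    using j \<open>j \<noteq> c\<close> by (auto simp: sim_action_def stay_def Let_def split: prod.split)
qed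

text \<open>The symbol bound belongs to the invariant because the guard of the simulation tests it.\<close>

definition represents :: "tm \<Rightarrow> nat \<Rightarrow> nat \<Rightarrow> nat list \<Rightarrow> store \<Rightarrow> config \<Rightarrow> bool" where
  "represents M D c locs \<sigma> = (\<lambda>(q, ts). \<sigma> c = cell q \<and> ts = map (\<lambda>l. unmark D \<circ> \<sigma> l) locs \<and>
     q < tm_states M \<and> (\<forall>l\<in>set locs. \<forall>j. unmark D (\<sigma> l j) < tm_symbols M))"

lemma sim_action_step:
  assumes lay: "layout M D c locs" and rep: "represents M D c locs \<sigma> (q, ts)"
    and run: "q \<noteq> tm_accept M" "q \<noteq> tm_reject M"
    and \<sigma>': "\<sigma>' = acts \<sigma> (sim_action M D c locs (scan \<sigma>))"
  shows "represents M D c locs \<sigma>' (tm_step M (q, ts))"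
    and "j \<notin> set locs \<Longrightarrow> j \<noteq> c \<Longrightarrow> \<sigma>' j = \<sigma> j"
    and "D \<noteq> 0 \<Longrightarrow> l \<in> set locs \<Longrightarrow> \<exists>s d. s \<noteq> 0 \<and> \<sigma>' l = act (\<sigma> l) (s, d)"
proof -
  have wf: "wf_tm M" and dist: "distinct locs" and len: "length locs = tm_tapes M"
    and c: "c \<notin> set locs" and D: "D = 0 \<or> tm_symbols M \<le> D"
    using lay by (auto simp: layout_def)
  have \<sigma>c: "\<sigma> c = cell q" and ts: "ts = map (\<lambda>l. unmark D \<circ> \<sigma> l) locs" and q: "q < tm_states M"
    and sym: "\<And>l j. l \<in> set locs \<Longrightarrow> unmark D (\<sigma> l j) < tm_symbols M"
    using rep by (auto simp: represents_def)
  let ?ys = "map (\<lambda>l. unmark D (scan \<sigma> l)) locs"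
  obtain q' as where \<delta>: "tm_delta M q ?ys = (q', as)" by fastforce
  have ys: "?ys = map (\<lambda>t. t 0) ts" by (simp add: ts scan_def)
  have ys_sym: "\<forall>y\<in>set ?ys. y < tm_symbols M" using sym by (auto simp: scan_def)
  have "length ?ys = tm_tapes M" using len by simp
  note \<delta>_props = wf_tm_delta[OF wf q this ys_sym \<delta>]
  have act: "sim_action M D c locs (scan \<sigma>) j = (if j = c then (q', No_Move)
      else case map_of (zip locs as) j of None \<Rightarrow> stay (scan \<sigma>) j | Some (s, d) \<Rightarrow> (mark D s, d))" for j
  proof -
    have "scan \<sigma> c = q" using \<sigma>c by (simp add: scan_def cell_def)
    then show ?thesis using ys_sym q \<delta> unfolding sim_action_def Let_def by auto
  qed
  have stepped: "tm_step M (q, ts) = (q', map2 act ts as)"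
    using run \<delta> by (simp add: ys)
  have loc: "\<sigma>' (locs ! i) = act (\<sigma> (locs ! i)) (mark D (fst (as ! i)), snd (as ! i))"
    if "i < length locs" for i
  proof -
    have "locs ! i \<noteq> c" using c that nth_mem by metis
    moreover have "map_of (zip locs as) (locs ! i) = Some (as ! i)"
      using dist len \<delta>_props(2) that by (simp add: map_of_zip_nth)
    ultimately show ?thesis using act by (simp add: \<sigma>' acts_def case_prod_beta)
  qed
  have as_sym: "fst (as ! i) < tm_symbols M" if "i < length locs" for i
    using \<delta>_props(2,3) len that by (metis nth_mem prod.collapse)
  have loc': "unmark D \<circ> \<sigma>' (locs ! i) = act (ts ! i) (as ! i)" if "i < length locs" for i
    using loc[OF that] unmark_act[of D "fst (as ! i)" "\<sigma> (locs ! i)" "snd (as ! i)"] D as_sym[OF that] that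
    by (auto simp: ts)
  have tapes: "map2 act ts as = map (\<lambda>l. unmark D \<circ> \<sigma>' l) locs"
    using loc' \<delta>_props(2) len by (intro nth_equalityI) (auto simp: ts simp del: o_apply)
  have act_sym: "act t (s, d) j < m" if "\<And>j. t j < m" "s < m" for t s d j and m :: nat
    using that by (cases d) auto
  have "unmark D (\<sigma>' (locs ! i) j) < tm_symbols M" if "i < length locs" for i j
  proof -
    have "(ts ! i) j < tm_symbols M" for j using sym[OF nth_mem[OF that]] that by (simp add: ts)
    then have "act (ts ! i) (fst (as ! i), snd (as ! i)) j < tm_symbols M"
      by (rule act_sym) (rule as_sym[OF that])
    then show ?thesis using loc'[OF that] by (metis comp_apply prod.collapse)
  qed
  then have "\<forall>l\<in>set locs. \<forall>j. unmark D (\<sigma>' l j) < tm_symbols M"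
    by (metis in_set_conv_nth)
  moreover have "\<sigma>' c = cell q'"
    by (simp add: \<sigma>' acts_def act \<sigma>c cell_def)
  ultimately show "represents M D c locs \<sigma>' (tm_step M (q, ts))"
    using \<delta>_props(1) tapes stepped by (simp add: represents_def)
  show "\<sigma>' j = \<sigma> j" if "j \<notin> set locs" "j \<noteq> c"
  proof -
    have "map_of (zip locs as) j = None"
      using that(1) by (metis map_of_SomeD not_None_eq set_zip_leftD)
    then have "\<sigma>' j = act (\<sigma> j) (stay (scan \<sigma>) j)"
      unfolding \<sigma>' acts_def act using that(2) by simp
    then show ?thesis by (simp add: stay_def scan_def)
  qed
  show "\<exists>s d. s \<noteq> 0 \<and> \<sigma>' l = act (\<sigma> l) (s, d)" if "D \<noteq> 0" "l \<in> set locs"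
  proof -
    obtain i where i: "i < length locs" "l = locs ! i" using \<open>l \<in> set locs\<close> by (metis in_set_conv_nth)
    then show ?thesis using loc[OF i(1)] \<open>D \<noteq> 0\<close> unfolding mark_def by (metis)
  qed
qed

text \<open>The non-blank cells form an interval of at most \<open>L\<close> cells, and the head is in it or adjacent to it:
  its position \<open>0\<close> lies between \<open>a - 1\<close> and \<open>b\<close>. Writing a non-blank symbol keeps this up because
  it at most adds a cell at one end.\<close>

definition spans :: "nat \<Rightarrow> tape \<Rightarrow> bool" where
  "spans L t \<longleftrightarrow> (\<exists>a b. a \<le> 1 \<and> 0 \<le> b \<and> a \<le> b \<and> b - a \<le> int L \<and> (\<forall>j. t j \<noteq> 0 \<longleftrightarrow> a \<le> j \<and> j < b))"

lemma spans_act: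
  assumes "spans L t" "s \<noteq> 0"
  shows "spans (Suc L) (act t (s, d))"
proof -
  obtain a b where ab: "a \<le> 1" "0 \<le> b" "a \<le> b" "b - a \<le> int L" "\<And>j. t j \<noteq> 0 \<longleftrightarrow> a \<le> j \<and> j < b"
    using assms(1) unfolding spans_def by blast
  have *: "(t(0 := s)) j \<noteq> 0 \<longleftrightarrow> min a 0 \<le> j \<and> j < max b 1" for j
  proof (cases "j = 0")
    case False
    then show ?thesis using ab(1-3) ab(5)[of j] by (simp add: min_def max_def) linarith
  qed (use assms(2) in simp)
  show ?thesis
  proof (cases d)
    case Left_Move
    then show ?thesis unfolding spans_def act_simps
      by (intro exI[of _ "min a 0 + 1"] exI[of _ "max b 1 + 1"]) (use ab * in \<open>auto simp del: fun_upd_apply\<close>)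
  next
    case No_Move
    then show ?thesis unfolding spans_def act_simps
      by (intro exI[of _ "min a 0"] exI[of _ "max b 1"]) (use ab * in \<open>auto simp del: fun_upd_apply\<close>)
  next
    case Right_Move
    then show ?thesis unfolding spans_def act_simps
      by (intro exI[of _ "min a 0 - 1"] exI[of _ "max b 1 - 1"]) (use ab * in \<open>auto simp del: fun_upd_apply\<close>)
  qed
qed

text \<open>Two units of time per machine step: the test of the loop and the action. With a non-zero
  \<open>D\<close> all writes are non-blank, and the intervals of visited cells grow by at most one cell per step.\<close>

lemma simulate_runs:
  assumes lay: "layout M D c locs"
  shows "represents M D c locs \<sigma> cf \<Longrightarrow> (tm_step M ^^ N) cf = (q, ts) \<Longrightarrow> q \<in> {tm_accept M, tm_reject M} \<Longrightarrow>
    \<exists>\<sigma>'. runs (simulate M D c locs) \<sigma> (2 * N + 1) \<sigma>' \<and> represents M D c locs \<sigma>' (q, ts) \<and>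
      (\<forall>j. j \<notin> set locs \<longrightarrow> j \<noteq> c \<longrightarrow> \<sigma>' j = \<sigma> j) \<and>
      (D \<noteq> 0 \<longrightarrow> (\<forall>l\<in>set locs. \<forall>L. spans L (\<sigma> l) \<longrightarrow> (\<exists>n\<le>N. spans (L + n) (\<sigma>' l))))"
proof (induction N arbitrary: \<sigma> cf)
  case 0
  have c0: "scan \<sigma> c = q" using 0 by (simp add: represents_def scan_def cell_def)
  have "runs (simulate M D c locs) \<sigma> 1 \<sigma>"
    unfolding simulate_def by (rule runs_Loop_stop) (use 0 c0 in auto)
  then show ?case using 0 by (intro exI[of _ \<sigma>]) auto
next
  case (Suc N)
  obtain q0 ts0 where cf: "cf = (q0, ts0)" by fastforce
  have c0: "scan \<sigma> c = q0" using Suc.prems(1) by (simp add: cf represents_def scan_def cell_def)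
  show ?case
  proof (cases "q0 \<in> {tm_accept M, tm_reject M}")
    case True
    have "tm_step M cf = cf" using True by (auto simp: cf)
    then have "(tm_step M ^^ n) cf = cf" for n by (induction n) auto
    then have eq: "cf = (q, ts)" using Suc.prems(2) by metis
    have "runs (simulate M D c locs) \<sigma> 1 \<sigma>"
      unfolding simulate_def by (rule runs_Loop_stop) (use True c0 in auto)
    then have "runs (simulate M D c locs) \<sigma> (2 * Suc N + 1) \<sigma>" by (rule runs_mono) simp
    then show ?thesis using Suc.prems(1) eq by (intro exI[of _ \<sigma>]) (auto intro: exI[of _ 0])
  next
    case False
    define \<rho> where "\<rho> = acts \<sigma> (sim_action M D c locs (scan \<sigma>))"
    have run: "q0 \<noteq> tm_accept M" "q0 \<noteq> tm_reject M" using False by auto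
    note step = sim_action_step[OF lay Suc.prems(1)[unfolded cf] run \<rho>_def]
    have "(tm_step M ^^ N) (tm_step M (q0, ts0)) = (q, ts)"
      using Suc.prems(2) by (simp add: cf funpow_swap1 del: tm_step.simps)
    from Suc.IH[OF step(1) this Suc.prems(3)] obtain \<sigma>' where
      \<sigma>': "runs (simulate M D c locs) \<rho> (2 * N + 1) \<sigma>'" "represents M D c locs \<sigma>' (q, ts)"
      "\<And>j. j \<notin> set locs \<Longrightarrow> j \<noteq> c \<Longrightarrow> \<sigma>' j = \<rho> j"
      "\<And>l L. D \<noteq> 0 \<Longrightarrow> l \<in> set locs \<Longrightarrow> spans L (\<rho> l) \<Longrightarrow> \<exists>n\<le>N. spans (L + n) (\<sigma>' l)"
      by blast
    have "runs (simulate M D c locs) \<sigma> (1 + (2 * N + 1) + 1) \<sigma>'"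
      unfolding simulate_def
      by (rule runs_Loop_step[OF _ _ \<sigma>'(1)[unfolded simulate_def]])
        (use run c0 runs_Act[of "sim_action M D c locs" \<sigma>] in \<open>auto simp: \<rho>_def\<close>)
    moreover have "\<exists>n\<le>Suc N. spans (L + n) (\<sigma>' l)" if "D \<noteq> 0" "l \<in> set locs" "spans L (\<sigma> l)" for l L
    proof -
      obtain s d where "s \<noteq> 0" "\<rho> l = act (\<sigma> l) (s, d)" using step(3)[OF \<open>D \<noteq> 0\<close> \<open>l \<in> set locs\<close>] by blast
      then have "spans (Suc L) (\<rho> l)" using spans_act \<open>spans L (\<sigma> l)\<close> by metis
      from \<sigma>'(4)[OF \<open>D \<noteq> 0\<close> \<open>l \<in> set locs\<close> this] obtain n where "n \<le> N" "spans (Suc L + n) (\<sigma>' l)" by blast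
      then show ?thesis by (intro exI[of _ "Suc n"]) auto
    qed
    moreover have "\<sigma>' j = \<sigma> j" if "j \<notin> set locs" "j \<noteq> c" for j
      using \<sigma>'(3)[OF that] step(2)[OF that] by simp
    ultimately show ?thesis using \<sigma>'(2) by (intro exI[of _ \<sigma>']) simp
  qed
qed

definition computes :: "tm \<Rightarrow> nat poly \<Rightarrow> pfun \<Rightarrow> bool" where
  "computes M p f \<longleftrightarrow> wf_tm M \<and>
        (\<forall>x. case (tm_step M ^^ poly p (length x)) (tm_init M x) of (q, ts) \<Rightarrow>
           (case f x of
              None \<Rightarrow> q = tm_reject M
            | Some y \<Rightarrow> q = tm_accept M \<and> hd ts = word_tape y))"

lemma word_tape_less_3: "word_tape x j < 3"
  by (simp add: word_tape_def)

lemma unmark_word_tape: "D = 0 \<or> 3 \<le> D \<Longrightarrow> unmark D (word_tape x j) = word_tape x j"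
  by (auto simp: unmark_def word_tape_def)

lemma spans_word_tape: "spans (length x) (word_tape x)"
  unfolding spans_def by (intro exI[of _ 0] exI[of _ "int (length x)"]) (auto simp: word_tape_def)

lemma spans_blank: "spans L blank_tape"
  unfolding spans_def by (intro exI[of _ 0]) auto

lemma spans_mono: "spans L t \<Longrightarrow> L \<le> L' \<Longrightarrow> spans L' t"
  unfolding spans_def using order_trans[of _ "int L" "int L'"] by fastforce

lemma simulate_computes:
  assumes comp: "computes M p f" and lay: "layout M D c (l # locs)"
    and \<sigma>: "\<sigma> c = cell (tm_start M)" "\<sigma> l = word_tape x" "\<And>k. k \<in> set locs \<Longrightarrow> \<sigma> k = blank_tape"
  shows "\<exists>\<sigma>'. runs (simulate M D c (l # locs)) \<sigma> (2 * poly p (length x) + 1) \<sigma>' \<and>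
      (case f x of None \<Rightarrow> \<sigma>' c = cell (tm_reject M)
        | Some y \<Rightarrow> \<sigma>' c = cell (tm_accept M) \<and> unmark D \<circ> \<sigma>' l = word_tape y) \<and>
      (\<forall>j. j \<notin> set (l # locs) \<longrightarrow> j \<noteq> c \<longrightarrow> \<sigma>' j = \<sigma> j) \<and>
      (D \<noteq> 0 \<longrightarrow> (\<forall>k\<in>set (l # locs). spans (length x + poly p (length x)) (\<sigma>' k)))"
proof -
  let ?N = "poly p (length x)"
  have wf: "wf_tm M" and len: "Suc (length locs) = tm_tapes M" and D: "D = 0 \<or> tm_symbols M \<le> D"
    using lay by (auto simp: layout_def)
  then have S: "3 \<le> tm_symbols M" and start: "tm_start M < tm_states M"
    by (auto simp: wf_tm_def)
  obtain q ts where qts: "(tm_step M ^^ ?N) (tm_init M x) = (q, ts)" by fastforce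
  then have res: "case f x of None \<Rightarrow> q = tm_reject M | Some y \<Rightarrow> q = tm_accept M \<and> hd ts = word_tape y"
    using comp unfolding computes_def by (metis (mono_tags, lifting) case_prod_conv)
  have D3: "D = 0 \<or> 3 \<le> D" using D S by auto
  have "map (\<lambda>l. unmark D \<circ> \<sigma> l) (l # locs) = word_tape x # replicate (length locs) blank_tape"
    using \<sigma> unmark_word_tape[OF D3]
    by (auto simp: fun_eq_iff unmark_def intro!: nth_equalityI)
  moreover have "unmark D (\<sigma> k j) < tm_symbols M" if "k \<in> set (l # locs)" for k j
  proof (cases "k = l")
    case True
    then show ?thesis using \<sigma>(2) unmark_word_tape[OF D3, of x j] word_tape_less_3[of x j] S by simp
  next
    case False
    then show ?thesis using \<sigma>(3)[of k] that S by (auto simp: unmark_def)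
  qed
  moreover have "tm_tapes M - 1 = length locs" using len by simp
  ultimately have rep: "represents M D c (l # locs) \<sigma> (tm_init M x)"
    using \<sigma>(1) start unfolding represents_def tm_init_def by simp
  have halted: "q \<in> {tm_accept M, tm_reject M}" using res by (auto split: option.splits)
  obtain \<sigma>' where \<sigma>': "runs (simulate M D c (l # locs)) \<sigma> (2 * ?N + 1) \<sigma>'"
      "represents M D c (l # locs) \<sigma>' (q, ts)"
      "\<forall>j. j \<notin> set (l # locs) \<longrightarrow> j \<noteq> c \<longrightarrow> \<sigma>' j = \<sigma> j"
      "D \<noteq> 0 \<longrightarrow> (\<forall>k\<in>set (l # locs). \<forall>L. spans L (\<sigma> k) \<longrightarrow> (\<exists>n\<le>?N. spans (L + n) (\<sigma>' k)))"
    using simulate_runs[OF lay rep qts halted] by blast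
  have "spans (length x + ?N) (\<sigma>' k)" if D0: "D \<noteq> 0" and k: "k \<in> set (l # locs)" for k
  proof -
    have "spans (length x) (\<sigma> k)"
      using k \<sigma> spans_word_tape spans_blank by (cases "k = l") auto
    then obtain n where "n \<le> ?N" "spans (length x + n) (\<sigma>' k)" using \<sigma>'(4) D0 k by blast
    then show ?thesis using spans_mono by simp
  qed
  moreover have "case f x of None \<Rightarrow> \<sigma>' c = cell (tm_reject M)
        | Some y \<Rightarrow> \<sigma>' c = cell (tm_accept M) \<and> unmark D \<circ> \<sigma>' l = word_tape y"
    using \<sigma>'(2) res by (auto simp: represents_def split: option.splits)
  ultimately show ?thesis using \<sigma>'(1,3) by blast
qed

definition put :: "nat \<Rightarrow> nat \<Rightarrow> prog" where
  "put i s = Act (\<lambda>r. (stay r)(i := (s, No_Move)))"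

lemma runs_put: "\<tau> = \<sigma>(i := (\<sigma> i)(0 := s)) \<Longrightarrow> runs (put i s) \<sigma> 1 \<tau>"
proof -
  assume "\<tau> = \<sigma>(i := (\<sigma> i)(0 := s))"
  moreover have "acts \<sigma> ((stay (scan \<sigma>))(i := (s, No_Move))) = \<sigma>(i := (\<sigma> i)(0 := s))"
    by (auto simp: acts_def stay_def scan_def fun_eq_iff)
  ultimately show ?thesis unfolding put_def using runs_Act by metis
qed

lemma wf_prog_put: "i < K \<Longrightarrow> s < S \<Longrightarrow> wf_prog K S (put i s)"
  by (auto simp: put_def stay_def)

definition skip :: prog where
  "skip = Act stay"

lemma runs_skip: "runs skip \<sigma> 1 \<sigma>"
  unfolding skip_def using runs_Act[of stay \<sigma>] by simp

lemma wf_prog_skip: "wf_prog K S skip"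
  by (auto simp: skip_def stay_def)

lemma polytime_computable_Some: "polytime_computable Some"
proof (rule polytime_computable_by_prog[of 1 3 skip _ 1])
  fix x y :: word assume "Some x = Some y"
  then show "\<exists>\<tau>. runs skip (input_store x) (poly 1 (length x)) \<tau> \<and> \<tau> 0 = word_tape y"
    using runs_skip by (intro exI[of _ "input_store x"]) (simp add: input_store_def)
qed (auto intro: wf_prog_skip)

text \<open>Both machines are simulated literally. They share tape \<open>0\<close>: the first machine leaves its output there
  in exactly the form in which the second one expects its input. All other tapes of the second
  machine are fresh, so nothing has to be cleaned up in between. Its running time is polynomial in the
  length of the original input since \<open>g\<close> is polynomially balanced.\<close>

lemma polytime_computable_comp:
  assumes f: "polytime_computable f" and g: "polytime_computable g" "polynomially_balanced g"
  shows "polytime_computable (f \<circ>\<^sub>m g)"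
proof -
  obtain M p where M: "computes M p f" using f unfolding polytime_computable_def computes_def by blast
  obtain N q where N: "computes N q g" using g unfolding polytime_computable_def computes_def by blast
  obtain b where b: "\<And>x y. g x = Some y \<Longrightarrow> length y \<le> poly b (length x)"
    using g(2) unfolding polynomially_balanced_def by blast
  define m where "m = tm_tapes M"
  define n where "n = tm_tapes N"
  have mn: "1 \<le> m" "1 \<le> n" using M N by (auto simp: computes_def wf_tm_def m_def n_def)
  define S where "S = tm_states M + tm_states N + tm_symbols M + tm_symbols N + 3"
  define runN where "runN = simulate N 0 n (0 # [1..<n])"
  define runM where "runM = simulate M 0 (n + m) (0 # [n + 1..<n + m])"
  define prog2 where "prog2 = Seq (put (n + m) (tm_start M)) (Seq runM
    (Cond (\<lambda>r. r (n + m) = tm_accept M) skip Fail))"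
  define prog1 where "prog1 = Seq (put n (tm_start N)) (Seq runN
    (Cond (\<lambda>r. r n = tm_accept N) prog2 Fail))"
  have layN: "layout N 0 n (0 # [1..<n])" and layM: "layout M 0 (n + m) (0 # [n + 1..<n + m])"
    using M N mn by (auto simp: layout_def computes_def n_def[symmetric] m_def[symmetric])
  have SM: "tm_start M < S" "tm_start N < S" "tm_accept M \<noteq> tm_reject M" "tm_accept N \<noteq> tm_reject N"
    using M N by (auto simp: S_def computes_def wf_tm_def)
  have wf: "wf_prog (n + m + 1) S prog1"
    unfolding prog1_def prog2_def runM_def runN_def wf_prog.simps
    by (intro conjI wf_prog_put wf_prog_simulate[OF layN] wf_prog_simulate[OF layM] wf_prog_skip TrueI)
      (use SM mn in \<open>auto simp: S_def\<close>)
  define T where "T = 2 * q + 2 * pcompose p b + [:12:]"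
  have T: "poly T k = 2 * poly q k + 2 * poly p (poly b k) + 12" for k
    by (simp add: T_def poly_pcompose numeral_poly)
  have N_run: "\<exists>\<sigma> \<tau>. runs (put n (tm_start N)) (input_store x) 1 \<sigma> \<and>
      runs runN \<sigma> (2 * poly q (length x) + 1) \<tau> \<and>
      (case g x of None \<Rightarrow> scan \<tau> n = tm_reject N
        | Some y \<Rightarrow> scan \<tau> n = tm_accept N \<and> \<tau> 0 = word_tape y) \<and> (\<forall>j>n. \<tau> j = blank_tape)" for x
  proof -
    let ?\<sigma> = "(input_store x)(n := cell (tm_start N))"
    have "runs (put n (tm_start N)) (input_store x) 1 ?\<sigma>"
      by (rule runs_put) (use mn in \<open>simp add: input_store_def cell_def\<close>)
    moreover have "?\<sigma> n = cell (tm_start N)" "?\<sigma> 0 = word_tape x"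
      "k \<in> set [1..<n] \<Longrightarrow> ?\<sigma> k = blank_tape" for k
      using mn by (auto simp: input_store_def)
    from simulate_computes[OF N layN this] obtain \<tau> where
      \<tau>: "runs runN ?\<sigma> (2 * poly q (length x) + 1) \<tau>" and
      res: "case g x of None \<Rightarrow> \<tau> n = cell (tm_reject N)
        | Some y \<Rightarrow> \<tau> n = cell (tm_accept N) \<and> unmark 0 \<circ> \<tau> 0 = word_tape y" and
      rest: "\<forall>j. j \<notin> set (0 # [1..<n]) \<longrightarrow> j \<noteq> n \<longrightarrow> \<tau> j = ?\<sigma> j"
      unfolding runN_def by blast
    have "case g x of None \<Rightarrow> scan \<tau> n = tm_reject N
        | Some y \<Rightarrow> scan \<tau> n = tm_accept N \<and> \<tau> 0 = word_tape y"
      using res by (auto simp: scan_def cell_def unmark_0 split: option.splits)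
    moreover have "\<forall>j>n. \<tau> j = blank_tape" using rest by (auto simp: input_store_def)
    ultimately show ?thesis using \<tau> by blast
  qed
  have M_run: "\<exists>\<sigma> \<tau>. runs (put (n + m) (tm_start M)) \<rho> 1 \<sigma> \<and>
      runs runM \<sigma> (2 * poly p (length z) + 1) \<tau> \<and>
      (case f z of None \<Rightarrow> scan \<tau> (n + m) = tm_reject M
        | Some y \<Rightarrow> scan \<tau> (n + m) = tm_accept M \<and> \<tau> 0 = word_tape y)"
    if \<rho>: "\<rho> 0 = word_tape z" "\<forall>j>n. \<rho> j = blank_tape" for \<rho> z
  proof -
    let ?\<sigma> = "\<rho>(n + m := cell (tm_start M))"
    have "runs (put (n + m) (tm_start M)) \<rho> 1 ?\<sigma>"
      by (rule runs_put) (use mn \<rho> in \<open>simp add: cell_def\<close>)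
    moreover have "?\<sigma> (n + m) = cell (tm_start M)" "?\<sigma> 0 = word_tape z"
      "k \<in> set [n + 1..<n + m] \<Longrightarrow> ?\<sigma> k = blank_tape" for k
      using mn \<rho> by auto
    from simulate_computes[OF M layM this] obtain \<tau> where
      \<tau>: "runs runM ?\<sigma> (2 * poly p (length z) + 1) \<tau>" and
      res: "case f z of None \<Rightarrow> \<tau> (n + m) = cell (tm_reject M)
        | Some y \<Rightarrow> \<tau> (n + m) = cell (tm_accept M) \<and> unmark 0 \<circ> \<tau> 0 = word_tape y"
      unfolding runM_def by blast
    have "case f z of None \<Rightarrow> scan \<tau> (n + m) = tm_reject M
        | Some y \<Rightarrow> scan \<tau> (n + m) = tm_accept M \<and> \<tau> 0 = word_tape y"
      using res by (auto simp: scan_def cell_def unmark_0 split: option.splits)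
    then show ?thesis using \<tau> calculation by blast
  qed
  have time: "poly p (length z) \<le> poly p (poly b (length x))" if "g x = Some z" for x z
    by (rule poly_nat_mono) (rule b[OF that])
  show ?thesis
  proof (rule polytime_computable_by_prog[OF wf, of _ T])
    show "1 \<le> n + m + 1" "3 \<le> S" by (auto simp: S_def)
  next
    fix x assume none: "(f \<circ>\<^sub>m g) x = None"
    obtain \<sigma>1 \<sigma>2 where 1: "runs (put n (tm_start N)) (input_store x) 1 \<sigma>1"
      "runs runN \<sigma>1 (2 * poly q (length x) + 1) \<sigma>2" "\<forall>j>n. \<sigma>2 j = blank_tape"
      and res: "case g x of None \<Rightarrow> scan \<sigma>2 n = tm_reject N
        | Some y \<Rightarrow> scan \<sigma>2 n = tm_accept N \<and> \<sigma>2 0 = word_tape y" using N_run[of x] by blast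
    show "fails prog1 (input_store x) (poly T (length x))"
    proof (cases "g x")
      case None
      have "fails prog1 (input_store x) (1 + ((2 * poly q (length x) + 1) + (1 + 1) + 1) + 1)"
        unfolding prog1_def
        by (intro fails_Seq[OF 1(1)] fails_Seq[OF 1(2)] fails_Cond_False fails_Fail)
          (use None res SM in simp)
      then show ?thesis by (rule fails_mono) (simp add: T)
    next
      case (Some z)
      then have "\<sigma>2 0 = word_tape z" and acc: "scan \<sigma>2 n = tm_accept N" using res by auto
      from M_run[OF this(1) 1(3)] obtain \<sigma>3 \<sigma>4 where 3: "runs (put (n + m) (tm_start M)) \<sigma>2 1 \<sigma>3"
        "runs runM \<sigma>3 (2 * poly p (length z) + 1) \<sigma>4"
        and res4: "case f z of None \<Rightarrow> scan \<sigma>4 (n + m) = tm_reject M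
        | Some y \<Rightarrow> scan \<sigma>4 (n + m) = tm_accept M \<and> \<sigma>4 0 = word_tape y" by blast
      have "f z = None" using none Some by simp
      then have "scan \<sigma>4 (n + m) \<noteq> tm_accept M" using res4 SM by simp
      then have "fails prog1 (input_store x) (1 + ((2 * poly q (length x) + 1) + ((1 +
          ((2 * poly p (length z) + 1) + (1 + 1) + 1) + 1) + 1) + 1) + 1)"
        unfolding prog1_def prog2_def
        by (intro fails_Seq[OF 1(1)] fails_Seq[OF 1(2)] fails_Cond_True[where b = "\<lambda>r. r n = tm_accept N", OF acc] fails_Seq[OF 3(1)]
            fails_Seq[OF 3(2)] fails_Cond_False fails_Fail)
      then show ?thesis by (rule fails_mono) (use time[OF Some] in \<open>simp add: T\<close>)
    qed
  next
    fix x y assume some: "(f \<circ>\<^sub>m g) x = Some y"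
    then obtain z where z: "g x = Some z" "f z = Some y" by (auto simp: map_comp_Some_iff)
    obtain \<sigma>1 \<sigma>2 where 1: "runs (put n (tm_start N)) (input_store x) 1 \<sigma>1"
      "runs runN \<sigma>1 (2 * poly q (length x) + 1) \<sigma>2" "\<forall>j>n. \<sigma>2 j = blank_tape"
      and acc: "scan \<sigma>2 n = tm_accept N" and "\<sigma>2 0 = word_tape z" using N_run[of x] z(1) by auto
    from M_run[OF this(5) this(3)] z(2) obtain \<sigma>3 \<sigma>4 where
      3: "runs (put (n + m) (tm_start M)) \<sigma>2 1 \<sigma>3" "runs runM \<sigma>3 (2 * poly p (length z) + 1) \<sigma>4"
      and acc': "scan \<sigma>4 (n + m) = tm_accept M" "\<sigma>4 0 = word_tape y" by auto
    have "runs prog1 (input_store x) (1 + ((2 * poly q (length x) + 1) + ((1 +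
          ((2 * poly p (length z) + 1) + (1 + 1) + 1) + 1) + 1) + 1) + 1) \<sigma>4"
      unfolding prog1_def prog2_def
      by (intro runs_Seq[OF 1(1)] runs_Seq[OF 1(2)] runs_Cond_True[where b = "\<lambda>r. r n = tm_accept N", OF acc] runs_Seq[OF 3(1)]
            runs_Seq[OF 3(2)] runs_Cond_True[where b = "\<lambda>r. r (n + m) = tm_accept M", OF acc'(1)] runs_skip)
    then have "runs prog1 (input_store x) (poly T (length x)) \<sigma>4"
      by (rule runs_mono) (use time[OF z(1)] in \<open>simp add: T\<close>)
    then show "\<exists>\<tau>. runs prog1 (input_store x) (poly T (length x)) \<tau> \<and> \<tau> 0 = word_tape y"
      using acc'(2) by blast
  qed
qed

section \<open>Tapes holding words\<close>

definition symbol :: "bool \<Rightarrow> nat" where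
  "symbol b = (if b then 2 else 1)"

definition letter_at :: "word \<Rightarrow> nat \<Rightarrow> nat" where
  "letter_at w n = (if n < length w then symbol (w ! n) else 0)"

text \<open>A tape that contains the word \<open>l @ r\<close> with the head on the first letter of \<open>r\<close>, or on the blank
  after the word if \<open>r\<close> is empty.\<close>

definition split_tape :: "word \<Rightarrow> word \<Rightarrow> tape" where
  "split_tape l r = (\<lambda>j. if 0 \<le> j then letter_at r (nat j) else letter_at (rev l) (nat (- j - 1)))"

text \<open>The head is on the blank before the word, where a leftward scan ends.\<close>

definition edge_tape :: "word \<Rightarrow> tape" where
  "edge_tape r = (\<lambda>j. word_tape r (j - 1))"

lemma letter_at_simps [simp]: "letter_at [] n = 0" "letter_at (c # w) 0 = symbol c"
  "letter_at (c # w) (Suc n) = letter_at w n"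
  by (auto simp: letter_at_def)

lemma symbol_simps [simp]: "symbol b \<noteq> 0" "0 < symbol b" "symbol b = symbol c \<longleftrightarrow> b = c" "symbol b < 3"
  "symbol b = 1 \<or> symbol b = 2" "symbol b = 2 \<longleftrightarrow> b" "symbol b = Suc 0 \<longleftrightarrow> \<not> b"
  by (auto simp: symbol_def)

lemma split_tape_nonneg [simp]: "split_tape l r (int n) = letter_at r n"
  by (simp add: split_tape_def)

lemma split_tape_neg [simp]: "split_tape l r (- 1 - int n) = letter_at (rev l) n"
  by (simp add: split_tape_def)

lemma split_tape_eqI:
  assumes "\<And>n. t (int n) = letter_at r n" "\<And>n. t (- 1 - int n) = letter_at (rev l) n"
  shows "t = split_tape l r"
proof
  fix j show "t j = split_tape l r j"
  proof (cases "0 \<le> j")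
    case True
    then show ?thesis using assms(1)[of "nat j"] by (simp add: split_tape_def)
  next
    case False
    then show ?thesis using assms(2)[of "nat (- j - 1)"] by (simp add: split_tape_def)
  qed
qed

lemma split_tape_Nil: "split_tape [] r = word_tape r"
  by (rule sym, rule split_tape_eqI) (auto simp: word_tape_def letter_at_def symbol_def)

lemma word_tape_Nil [simp]: "word_tape [] = blank_tape"
  by (auto simp: word_tape_def)

lemma split_tape_scan [simp]: "split_tape l [] 0 = 0" "split_tape l (c # r) 0 = symbol c"
  using split_tape_nonneg[of l _ 0] by (metis letter_at_simps(1,2) of_nat_0)+

lemma upd_right:
  assumes "\<And>n. t (int (Suc n)) = letter_at r n" "\<And>n. t (- 1 - int n) = letter_at (rev l) n"
  shows "act t (symbol d, Right_Move) = split_tape (l @ [d]) r"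
proof (rule split_tape_eqI)
  show "act t (symbol d, Right_Move) (int n) = letter_at r n" for n
    using assms(1)[of n] by (simp add: add.commute)
  show "act t (symbol d, Right_Move) (- 1 - int n) = letter_at (rev (l @ [d])) n" for n
    using assms(2)[of "n - 1"] by (cases n) auto
qed

lemma split_tape_right: "act (split_tape l (c # r)) (symbol d, Right_Move) = split_tape (l @ [d]) r"
  by (rule upd_right) (simp_all only: split_tape_nonneg split_tape_neg letter_at_simps)

lemma split_tape_append: "act (split_tape l []) (symbol d, Right_Move) = split_tape (l @ [d]) []"
  by (rule upd_right) (simp_all only: split_tape_nonneg split_tape_neg letter_at_simps)

lemma split_tape_write: "(split_tape l (c # r))(0 := symbol d) = split_tape l (d # r)"
  "(split_tape l [])(0 := symbol d) = split_tape l [d]"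
proof -
  show "(split_tape l (c # r))(0 := symbol d) = split_tape l (d # r)"
  proof (rule split_tape_eqI)
    show "((split_tape l (c # r))(0 := symbol d)) (int n) = letter_at (d # r) n" for n
      by (cases n) (auto simp del: of_nat_Suc)
  qed simp
  show "(split_tape l [])(0 := symbol d) = split_tape l [d]"
  proof (rule split_tape_eqI)
    show "((split_tape l [])(0 := symbol d)) (int n) = letter_at [d] n" for n
      by (cases n) (auto simp del: of_nat_Suc)
  qed simp
qed

lemma split_tape_left:
  "act (split_tape (l @ [c]) r) (split_tape (l @ [c]) r 0, Left_Move) = split_tape l (c # r)"
proof (rule split_tape_eqI)
  fix n
  show "act (split_tape (l @ [c]) r) (split_tape (l @ [c]) r 0, Left_Move) (int n) = letter_at (c # r) n"
    using split_tape_nonneg[of "l @ [c]" r "n - 1"] split_tape_neg[of "l @ [c]" r 0] by (cases n) auto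
  show "act (split_tape (l @ [c]) r) (split_tape (l @ [c]) r 0, Left_Move) (- 1 - int n) = letter_at (rev l) n"
    using split_tape_neg[of "l @ [c]" r "Suc n"] by (simp add: algebra_simps)
qed

lemma split_tape_erase: "act (split_tape [] (c # r)) (0, Right_Move) = split_tape [] r"
proof (rule split_tape_eqI)
  fix n
  show "act (split_tape [] (c # r)) (0, Right_Move) (int n) = letter_at r n"
    using split_tape_nonneg[of "[]" "c # r" "Suc n"] by (simp add: add.commute)
  show "act (split_tape [] (c # r)) (0, Right_Move) (- 1 - int n) = letter_at (rev []) n"
    using split_tape_neg[of "[]" "c # r" "n - 1"] by (cases n) auto
qed

lemma edge_tape_left: "act (split_tape [] r) (split_tape [] r 0, Left_Move) = edge_tape r"
  by (rule ext) (auto simp: split_tape_Nil edge_tape_def)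

lemma edge_tape_scan [simp]: "edge_tape r 0 = 0"
  by (simp add: edge_tape_def word_tape_def)

lemma edge_tape_right: "act (edge_tape r) (0, Right_Move) = split_tape [] r"
  using edge_tape_scan[of r] by (simp only: act_simps fun_upd_idem) (simp add: split_tape_Nil edge_tape_def)

section \<open>Basic tape programs\<close>

definition act1 :: "nat \<Rightarrow> (nat \<Rightarrow> nat \<times> move) \<Rightarrow> prog" where
  "act1 i g = Act (\<lambda>r. (stay r)(i := g (r i)))"

lemma acts_upd: "acts \<sigma> ((stay (scan \<sigma>))(i := a)) = \<sigma>(i := act (\<sigma> i) a)"
  by (auto simp: acts_def stay_def scan_def fun_eq_iff)

lemma runs_act1: "runs (act1 i g) \<sigma> 1 (\<sigma>(i := act (\<sigma> i) (g (\<sigma> i 0))))"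
  unfolding act1_def using runs_Act[of "\<lambda>r. (stay r)(i := g (r i))" \<sigma>] by (simp add: acts_upd) (simp add: scan_def)

lemma wf_prog_act1: "i < K \<Longrightarrow> (\<And>s. s < S \<Longrightarrow> fst (g s) < S) \<Longrightarrow> wf_prog K S (act1 i g)"
  by (auto simp: act1_def stay_def)

definition shift :: "nat \<Rightarrow> move \<Rightarrow> prog" where
  "shift i d = act1 i (\<lambda>s. (s, d))"

lemma runs_shift: "runs (shift i d) \<sigma> 1 (\<sigma>(i := act (\<sigma> i) (\<sigma> i 0, d)))"
  unfolding shift_def using runs_act1[of i "\<lambda>s. (s, d)" \<sigma>] by simp

definition rewind :: "nat \<Rightarrow> prog" where
  "rewind i = Seq (shift i Left_Move)
     (Seq (Loop (\<lambda>r. r i \<noteq> 0) (shift i Left_Move)) (shift i Right_Move))"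

lemma runs_rewind_loop:
  "\<sigma> i = split_tape l (c # r) \<Longrightarrow> runs (Loop (\<lambda>r. r i \<noteq> 0) (shift i Left_Move)) \<sigma> (2 * length l + 3)
     (\<sigma>(i := edge_tape (l @ c # r)))"
proof (induction l arbitrary: c r \<sigma> rule: rev_induct)
  case Nil
  let ?\<tau> = "\<sigma>(i := edge_tape (c # r))"
  have "runs (shift i Left_Move) \<sigma> 1 ?\<tau>"
    using runs_shift[of i Left_Move \<sigma>] unfolding Nil edge_tape_left .
  moreover have "runs (Loop (\<lambda>r. r i \<noteq> 0) (shift i Left_Move)) ?\<tau> 1 ?\<tau>"
    by (rule runs_Loop_stop) (simp add: scan_def)
  ultimately have "runs (Loop (\<lambda>r. r i \<noteq> 0) (shift i Left_Move)) \<sigma> (1 + 1 + 1) ?\<tau>"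
    by (rule runs_Loop_step[rotated]) (simp add: scan_def Nil)
  then show ?case unfolding append_Nil by (rule runs_mono) simp
next
  case (snoc d l)
  let ?\<rho> = "\<sigma>(i := split_tape l (d # c # r))"
  have "runs (shift i Left_Move) \<sigma> 1 ?\<rho>"
    using runs_shift[of i Left_Move \<sigma>] unfolding snoc.prems split_tape_left .
  moreover have "runs (Loop (\<lambda>r. r i \<noteq> 0) (shift i Left_Move)) ?\<rho> (2 * length l + 3)
     (?\<rho>(i := edge_tape (l @ d # c # r)))"
    by (rule snoc.IH) simp
  ultimately have "runs (Loop (\<lambda>r. r i \<noteq> 0) (shift i Left_Move)) \<sigma> (1 + (2 * length l + 3) + 1)
     (?\<rho>(i := edge_tape (l @ d # c # r)))"
    by (rule runs_Loop_step[rotated]) (simp add: scan_def snoc.prems)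
  then show ?case unfolding fun_upd_upd append_assoc append.simps by (rule runs_mono) simp
qed

lemma runs_rewind:
  assumes "\<sigma> i = split_tape l r" "\<tau> = \<sigma>(i := split_tape [] (l @ r))"
  shows "runs (rewind i) \<sigma> (2 * length l + 5) \<tau>"
proof (cases l rule: rev_cases)
  case Nil
  let ?\<rho> = "\<sigma>(i := edge_tape r)"
  have 1: "runs (shift i Left_Move) \<sigma> 1 ?\<rho>"
    using runs_shift[of i Left_Move \<sigma>] unfolding assms(1) Nil edge_tape_left .
  have 2: "runs (Loop (\<lambda>r. r i \<noteq> 0) (shift i Left_Move)) ?\<rho> 1 ?\<rho>"
    by (rule runs_Loop_stop) (simp add: scan_def)
  have 3: "runs (shift i Right_Move) ?\<rho> 1 \<tau>"
    using runs_shift[of i Right_Move ?\<rho>] by (simp add: assms Nil edge_tape_right del: act.simps)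
  show ?thesis unfolding rewind_def
    by (rule runs_mono[OF runs_Seq[OF 1 runs_Seq[OF 2 3]]]) simp
next
  case (snoc l' c)
  let ?\<rho> = "\<sigma>(i := split_tape l' (c # r))"
  have 1: "runs (shift i Left_Move) \<sigma> 1 ?\<rho>"
    using runs_shift[of i Left_Move \<sigma>] unfolding assms(1) snoc split_tape_left .
  let ?\<rho>' = "?\<rho>(i := edge_tape (l' @ c # r))"
  have 2: "runs (Loop (\<lambda>r. r i \<noteq> 0) (shift i Left_Move)) ?\<rho> (2 * length l' + 3) ?\<rho>'"
    by (rule runs_rewind_loop) simp
  have 3: "runs (shift i Right_Move) ?\<rho>' 1 \<tau>"
    using runs_shift[of i Right_Move ?\<rho>'] by (simp add: assms snoc edge_tape_right del: act.simps)
  show ?thesis unfolding rewind_def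
    by (rule runs_mono[OF runs_Seq[OF 1 runs_Seq[OF 2 3]]]) (simp add: snoc)
qed

definition copy :: "nat \<Rightarrow> nat \<Rightarrow> prog" where
  "copy i j = Loop (\<lambda>r. r i \<noteq> 0) (Act (\<lambda>r. (stay r)(i := (r i, Right_Move), j := (r i, Right_Move))))"

lemma runs_copy:
  assumes "i \<noteq> j" "\<sigma> i = split_tape l r" "\<sigma> j = split_tape m []"
    and "\<tau> = \<sigma>(i := split_tape (l @ r) [], j := split_tape (m @ r) [])"
  shows "runs (copy i j) \<sigma> (2 * length r + 1) \<tau>"
  using assms
proof (induction r arbitrary: l m \<sigma>)
  case Nil
  then have "\<tau> = \<sigma>" by auto
  then show ?case using runs_Loop_stop Nil by (simp add: copy_def scan_def)
next
  case (Cons c r)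
  let ?A = "\<lambda>r. (stay r)(i := (r i, Right_Move), j := (r i, Right_Move))"
  let ?\<rho> = "\<sigma>(i := split_tape (l @ [c]) r, j := split_tape (m @ [c]) [])"
  have "acts \<sigma> (?A (scan \<sigma>)) = ?\<rho>"
  proof
    fix k show "acts \<sigma> (?A (scan \<sigma>)) k = ?\<rho> k"
      using Cons.prems(1,2,3) split_tape_right[of l c r c] split_tape_append[of m c]
      by (auto simp: acts_def stay_def scan_def simp del: act.simps(1,3))
  qed
  then have 1: "runs (Act ?A) \<sigma> 1 ?\<rho>" using runs_Act[of ?A \<sigma>] by simp
  have 2: "runs (copy i j) ?\<rho> (2 * length r + 1) \<tau>"
    by (rule Cons.IH) (use Cons.prems in auto)
  have "runs (copy i j) \<sigma> (1 + (2 * length r + 1) + 1) \<tau>"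
    unfolding copy_def by (rule runs_Loop_step[OF _ 1 2[unfolded copy_def]]) (simp add: scan_def Cons.prems)
  then show ?case by simp
qed

lemma wf_prog_copy: "i < K \<Longrightarrow> j < K \<Longrightarrow> wf_prog K S (copy i j)"
  by (auto simp: copy_def stay_def)

definition erase :: "nat \<Rightarrow> prog" where
  "erase i = Loop (\<lambda>r. r i \<noteq> 0) (act1 i (\<lambda>s. (0, Right_Move)))"

lemma runs_erase:
  assumes "\<sigma> i = split_tape [] r" "\<tau> = \<sigma>(i := blank_tape)"
  shows "runs (erase i) \<sigma> (2 * length r + 1) \<tau>"
  using assms
proof (induction r arbitrary: \<sigma>)
  case Nil
  then have "\<tau> = \<sigma>" by (auto simp: split_tape_Nil)
  then show ?case using runs_Loop_stop Nil by (simp add: erase_def scan_def)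
next
  case (Cons c r)
  let ?\<rho> = "\<sigma>(i := split_tape [] r)"
  have 1: "runs (act1 i (\<lambda>s. (0, Right_Move))) \<sigma> 1 ?\<rho>"
    using runs_act1[of i "\<lambda>s. (0, Right_Move)" \<sigma>] unfolding Cons.prems split_tape_erase .
  have 2: "runs (erase i) ?\<rho> (2 * length r + 1) \<tau>"
    by (rule Cons.IH) (use Cons.prems in auto)
  have "runs (erase i) \<sigma> (1 + (2 * length r + 1) + 1) \<tau>"
    unfolding erase_def by (rule runs_Loop_step[OF _ 1 2[unfolded erase_def]]) (simp add: scan_def Cons.prems)
  then show ?case by simp
qed

text \<open>Read with the least significant letter first, words are the bijective base-2 numerals with the digits
  1 for \<open>False\<close> and 2 for \<open>True\<close>. Incrementing therefore runs through all words, and on a tape it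
  is a single sweep that ends at the first letter that is not \<open>True\<close>.\<close>

fun succ_word :: "word \<Rightarrow> word" where
  "succ_word [] = [False]"
| "succ_word (False # w) = True # w"
| "succ_word (True # w) = False # succ_word w"

definition increment :: "nat \<Rightarrow> prog" where
  "increment i = Seq (Loop (\<lambda>r. r i = 2) (act1 i (\<lambda>s. (1, Right_Move))))
     (Seq (act1 i (\<lambda>s. (if s = 1 then 2 else 1, No_Move))) (rewind i))"

lemma runs_increment_loop:
  assumes "\<sigma> i = split_tape l x"
  shows "\<exists>m r. runs (Loop (\<lambda>r. r i = 2) (act1 i (\<lambda>s. (1, Right_Move)))) \<sigma> (2 * length x + 1)
      (\<sigma>(i := split_tape (l @ m) r)) \<and> length m \<le> length x \<and>
      (r = [] \<and> succ_word x = m @ [False] \<or> (\<exists>w. r = False # w \<and> succ_word x = m @ True # w))"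
  using assms
proof (induction x arbitrary: l \<sigma> rule: succ_word.induct)
  case 1
  then have "runs (Loop (\<lambda>r. r i = 2) (act1 i (\<lambda>s. (1, Right_Move)))) \<sigma> 1 \<sigma>"
    by (intro runs_Loop_stop) (simp add: scan_def)
  then show ?case using 1 by (intro exI[of _ "[]"]) (auto simp: fun_upd_idem)
next
  case (2 w)
  then have "runs (Loop (\<lambda>r. r i = 2) (act1 i (\<lambda>s. (1, Right_Move)))) \<sigma> 1 \<sigma>"
    by (intro runs_Loop_stop) (simp add: scan_def)
  then have "runs (Loop (\<lambda>r. r i = 2) (act1 i (\<lambda>s. (1, Right_Move)))) \<sigma> (2 * length (False # w) + 1) \<sigma>"
    by (rule runs_mono) simp
  then show ?case using 2 by (intro exI[of _ "[]"] exI[of _ "False # w"]) (auto simp: fun_upd_idem)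
next
  case (3 w)
  let ?\<rho> = "\<sigma>(i := split_tape (l @ [False]) w)"
  have "act (split_tape l (True # w)) (1, Right_Move) = split_tape (l @ [False]) w"
    using split_tape_right[of l True w False] unfolding symbol_def by simp
  then have 1: "runs (act1 i (\<lambda>s. (1, Right_Move))) \<sigma> 1 ?\<rho>"
    using runs_act1[of i "\<lambda>s. (1, Right_Move)" \<sigma>] unfolding 3(2) by simp
  have "?\<rho> i = split_tape (l @ [False]) w" by simp
  from 3(1)[where \<sigma> = "?\<rho>" and l = "l @ [False]", OF this] obtain m r where
    2: "runs (Loop (\<lambda>r. r i = 2) (act1 i (\<lambda>s. (1, Right_Move)))) ?\<rho> (2 * length w + 1)
      (?\<rho>(i := split_tape ((l @ [False]) @ m) r))" "length m \<le> length w"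
    "r = [] \<and> succ_word w = m @ [False] \<or> (\<exists>v. r = False # v \<and> succ_word w = m @ True # v)"
    by blast
  have "runs (Loop (\<lambda>r. r i = 2) (act1 i (\<lambda>s. (1, Right_Move)))) \<sigma> (1 + (2 * length w + 1) + 1)
      (?\<rho>(i := split_tape ((l @ [False]) @ m) r))"
    by (rule runs_Loop_step[OF _ 1 2(1)]) (simp add: scan_def 3)
  then have "runs (Loop (\<lambda>r. r i = 2) (act1 i (\<lambda>s. (1, Right_Move)))) \<sigma> (2 * length (True # w) + 1)
      (\<sigma>(i := split_tape (l @ (False # m)) r))"
    unfolding fun_upd_upd append_assoc append.simps by (rule runs_mono) simp
  moreover have "length (False # m) \<le> length (True # w)" using 2(2) by simp
  moreover have "r = [] \<and> succ_word (True # w) = (False # m) @ [False] \<or>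
      (\<exists>v. r = False # v \<and> succ_word (True # w) = (False # m) @ True # v)"
    using 2(3) by auto
  ultimately show ?case by blast
qed

lemma runs_increment:
  assumes "\<sigma> i = split_tape [] x" "\<tau> = \<sigma>(i := split_tape [] (succ_word x))"
  shows "runs (increment i) \<sigma> (4 * length x + 9) \<tau>"
proof -
  obtain m r where
    1: "runs (Loop (\<lambda>r. r i = 2) (act1 i (\<lambda>s. (1, Right_Move)))) \<sigma> (2 * length x + 1)
      (\<sigma>(i := split_tape m r))" and m: "length m \<le> length x" and
    r: "r = [] \<and> succ_word x = m @ [False] \<or> (\<exists>v. r = False # v \<and> succ_word x = m @ True # v)"
    using runs_increment_loop[of \<sigma> i "[]" x, OF assms(1)] by auto
  obtain r' where r': "succ_word x = m @ r'"
    "(split_tape m r)(0 := (if split_tape m r 0 = 1 then 2 else 1)) = split_tape m r'"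
  proof (cases "r = []")
    case True
    then show ?thesis using r that[of "[False]"] split_tape_write(2)[of m False] by (auto simp: symbol_def)
  next
    case False
    then obtain v where "r = False # v" "succ_word x = m @ True # v" using r by auto
    then show ?thesis using that[of "True # v"] split_tape_write(1)[of m False v True] by (auto simp: symbol_def)
  qed
  let ?\<rho> = "\<sigma>(i := split_tape m r')"
  have 2: "runs (act1 i (\<lambda>s. (if s = 1 then 2 else 1, No_Move))) (\<sigma>(i := split_tape m r)) 1 ?\<rho>"
    using runs_act1[of i "\<lambda>s. (if s = 1 then 2 else 1, No_Move)" "\<sigma>(i := split_tape m r)"] r'(2)
    by simp
  have 3: "runs (rewind i) ?\<rho> (2 * length m + 5) \<tau>"
    by (rule runs_rewind[of _ _ m r']) (auto simp: assms(2) r'(1))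
  show ?thesis unfolding increment_def
    by (rule runs_mono[OF runs_Seq[OF 1 runs_Seq[OF 2 3]]]) (use m in simp)
qed


section \<open>Cleaning and comparing\<close>

text \<open>Erases a tape whose non-blank cells form an interval next to the head. The initial write makes sure
  that the head is inside the interval; otherwise the leftward scan could stop at once on the wrong
  side of it.\<close>

definition clean :: "nat \<Rightarrow> prog" where
  "clean i = Seq (put i 1) (Seq (Loop (\<lambda>r. r i \<noteq> 0) (shift i Left_Move))
     (Seq (shift i Right_Move) (erase i)))"

lemma runs_clean:
  assumes "spans L (\<sigma> i)" "\<tau> = \<sigma>(i := blank_tape)"
  shows "runs (clean i) \<sigma> (4 * L + 12) \<tau>"
proof -
  obtain a0 b0 where ab0: "a0 \<le> 1" "0 \<le> b0" "a0 \<le> b0" "b0 - a0 \<le> int L" "\<And>j. \<sigma> i j \<noteq> 0 \<longleftrightarrow> a0 \<le> j \<and> j < b0"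
    using assms(1) unfolding spans_def by blast
  define t where "t = (\<sigma> i)(0 := 1)"
  \<comment> \<open>the interval after the initial write, which may have filled one cell next to \<open>{a0..<b0}\<close>\<close>
  define a where "a = min a0 0"
  define b where "b = max b0 1"
  have ab: "a \<le> 0" "0 < b" "b - a \<le> int L + 1"
    using ab0 by (auto simp: a_def b_def)
  have t: "t j \<noteq> 0 \<longleftrightarrow> a \<le> j \<and> j < b" for j
  proof (cases "j = 0")
    case False
    then show ?thesis using ab0(1-3) ab0(5)[of j] by (simp add: t_def a_def b_def min_def max_def) linarith
  qed (simp add: t_def a_def b_def)
  have t0: "t j = 0" if "j < a \<or> b \<le> j" for j using t[of j] that by auto
  let ?\<rho>1 = "\<sigma>(i := t)"
  have 1: "runs (put i 1) \<sigma> 1 ?\<rho>1" by (rule runs_put) (simp add: t_def)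
  define n where "n = nat (1 - a)"
  let ?s = "\<lambda>k. \<sigma>(i := (\<lambda>j. t (j - int k)))"
  have "runs (Loop (\<lambda>r. r i \<noteq> 0) (shift i Left_Move)) (?s 0) (n * (1 + 1) + 1) (?s n)"
  proof (rule runs_Loop)
    fix k assume k: "k < n"
    have "act (\<lambda>j. t (j - int k)) (t (0 - int k), Left_Move) = (\<lambda>j. t (j - int (Suc k)))"
      by (auto simp: fun_eq_iff algebra_simps)
    then have "runs (shift i Left_Move) (?s k) 1 (?s (Suc k))"
      using runs_shift[of i Left_Move "?s k"] by (simp del: act.simps of_nat_Suc)
    moreover have "t (- int k) \<noteq> 0" using t k ab by (auto simp: n_def)
    ultimately show "scan (?s k) i \<noteq> 0 \<and> runs (shift i Left_Move) (?s k) 1 (?s (Suc k))"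
      by (simp add: scan_def)
  next
    show "\<not> scan (?s n) i \<noteq> 0" using t0[of "a - 1"] ab by (simp add: scan_def n_def)
  qed
  then have 2: "runs (Loop (\<lambda>r. r i \<noteq> 0) (shift i Left_Move)) ?\<rho>1 (n * 2 + 1) (?s n)"
    by (simp only: of_nat_0 diff_zero one_add_one)
  let ?u = "\<lambda>k. \<sigma>(i := (\<lambda>j. if j < 0 then 0 else t (j + a + int k)))"
  have "act (\<lambda>j. t (j - int n)) (t (- int n), Right_Move) = (\<lambda>j. t (j + a))"
  proof
    fix x
    have "int n = 1 - a" using ab by (simp add: n_def)
    then have "- int n = a - 1" "x + 1 - int n = x + a" by simp_all
    then show "act (\<lambda>j. t (j - int n)) (t (- int n), Right_Move) x = t (x + a)"
      by (cases "x = - 1") (simp_all only: act_simps fun_upd_apply, simp_all)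
  qed
  also have "\<dots> = (\<lambda>j. if j < 0 then 0 else t (j + a + int 0))" using t0 by auto
  finally have 3: "runs (shift i Right_Move) (?s n) 1 (?u 0)"
    using runs_shift[of i Right_Move "?s n"] by (simp del: act.simps of_nat_Suc of_nat_0)
  define m where "m = nat (b - a)"
  have "runs (erase i) (?u 0) (m * (1 + 1) + 1) (?u m)"
    unfolding erase_def
  proof (rule runs_Loop)
    fix k assume k: "k < m"
    have "act (\<lambda>j. if j < 0 then 0 else t (j + a + int k)) (0, Right_Move) =
        (\<lambda>j. if j < 0 then 0 else t (j + a + int (Suc k)))"
      by (auto simp: fun_eq_iff algebra_simps)
    then have "runs (act1 i (\<lambda>s. (0, Right_Move))) (?u k) 1 (?u (Suc k))"
      using runs_act1[of i "\<lambda>s. (0, Right_Move)" "?u k"] by (simp del: act.simps of_nat_Suc)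
    moreover have "t (a + int k) \<noteq> 0" using t k ab by (auto simp: m_def)
    ultimately show "scan (?u k) i \<noteq> 0 \<and> runs (act1 i (\<lambda>s. (0, Right_Move))) (?u k) 1 (?u (Suc k))"
      by (simp add: scan_def)
  next
    show "\<not> scan (?u m) i \<noteq> 0" using t0[of b] ab by (simp add: scan_def m_def)
  qed
  moreover have "?u m = \<tau>"
    unfolding assms(2) using ab t0 by (auto simp: fun_eq_iff m_def)
  ultimately have 4: "runs (erase i) (?u 0) (m * 2 + 1) \<tau>" by (simp only: one_add_one)
  have "n \<le> L + 1" "m \<le> L + 1" using ab by (auto simp: n_def m_def)
  then show ?thesis unfolding clean_def
    by (intro runs_mono[OF runs_Seq[OF 1 runs_Seq[OF 2 runs_Seq[OF 3 4]]]]) simp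
qed

definition clean_all :: "nat list \<Rightarrow> prog" where
  "clean_all is = foldr (\<lambda>i p. Seq (clean i) p) is skip"

lemma runs_clean_all:
  assumes "\<And>i. i \<in> set is \<Longrightarrow> spans L (\<sigma> i)"
    and "\<tau> = (\<lambda>j. if j \<in> set is then blank_tape else \<sigma> j)"
  shows "runs (clean_all is) \<sigma> (length is * (4 * L + 13) + 1) \<tau>"
  using assms
proof (induction "is" arbitrary: \<sigma>)
  case Nil
  then show ?case using runs_skip[of \<sigma>] by (simp add: clean_all_def)
next
  case (Cons i "is")
  let ?\<rho> = "\<sigma>(i := blank_tape)"
  have 1: "runs (clean i) \<sigma> (4 * L + 12) ?\<rho>" by (rule runs_clean) (use Cons.prems in auto)
  have 2: "runs (clean_all is) ?\<rho> (length is * (4 * L + 13) + 1) \<tau>"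
    by (rule Cons.IH) (use Cons.prems spans_blank in \<open>auto simp: fun_eq_iff\<close>)
  have "clean_all (i # is) = Seq (clean i) (clean_all is)" by (simp add: clean_all_def)
  then show ?case using runs_Seq[OF 1 2] by (simp add: algebra_simps)
qed

text \<open>Advances on both tapes as long as they agree on a letter. Only the symbols 1 and 2 count as letters on
  tape \<open>i\<close>, where a blank may be represented by a larger symbol.\<close>

definition compare :: "nat \<Rightarrow> nat \<Rightarrow> prog" where
  "compare i j = Loop (\<lambda>r. (r i = 1 \<or> r i = 2) \<and> r j = r i)
     (Act (\<lambda>r. (stay r)(i := (r i, Right_Move), j := (r j, Right_Move))))"

lemma runs_compare:
  assumes ij: "i \<noteq> j" and D: "3 \<le> D" and i: "unmark D \<circ> \<sigma> i = word_tape (c @ y)" and j: "\<sigma> j = split_tape [] (c @ u)"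
    and diff: "y = [] \<or> u = [] \<or> hd y \<noteq> hd u"
    and \<tau>: "\<tau> = \<sigma>(i := (\<lambda>k. \<sigma> i (k + int (length c))), j := split_tape c u)"
  shows "runs (compare i j) \<sigma> (2 * length c + 1) \<tau>"
proof -
  define s where "s k = \<sigma>(i := (\<lambda>l. \<sigma> i (l + int k)), j := split_tape (take k c) (drop k c @ u))" for k
  have un: "\<sigma> i l = (if \<sigma> i l = D then D else word_tape (c @ y) l)" for l
    using fun_cong[OF i, of l] by (auto simp: unmark_def)
  let ?A = "\<lambda>r. (stay r)(i := (r i, Right_Move), j := (r j, Right_Move))"
  have "runs (compare i j) (s 0) (length c * (1 + 1) + 1) (s (length c))"
    unfolding compare_def
  proof (rule runs_Loop)
    fix k assume k: "k < length c"
    have "unmark D (\<sigma> i (int k)) = symbol (c ! k)"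
      using fun_cong[OF i, of "int k"] k by (simp add: word_tape_def symbol_def nth_append)
    then have \<sigma>k: "\<sigma> i (int k) = symbol (c ! k)" by (auto simp: unmark_def split: if_splits)
    have dr: "drop k c @ u = c ! k # (drop (Suc k) c @ u)" using k by (simp add: Cons_nth_drop_Suc)
    have tk: "take (Suc k) c = take k c @ [c ! k]" using k by (simp add: take_Suc_conv_app_nth)
    have scan: "scan (s k) i = symbol (c ! k)" "scan (s k) j = symbol (c ! k)"
      using ij \<sigma>k by (simp_all add: s_def scan_def dr)
    have "acts (s k) (?A (scan (s k))) = s (Suc k)"
    proof
      fix l
      have "act (\<lambda>l. \<sigma> i (l + int k)) (symbol (c ! k), Right_Move) = (\<lambda>l. \<sigma> i (l + int (Suc k)))"
      proof
        fix x show "act (\<lambda>l. \<sigma> i (l + int k)) (symbol (c ! k), Right_Move) x = \<sigma> i (x + int (Suc k))"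
          using \<sigma>k by (cases "x = - 1") (simp_all add: ac_simps)
      qed
      then show "acts (s k) (?A (scan (s k))) l = s (Suc k) l"
        using ij scan split_tape_right[of "take k c" "c ! k" "drop (Suc k) c @ u" "c ! k"]
        by (cases "l = i"; cases "l = j")
          (simp_all add: s_def dr tk acts_def del: act.simps(1,3) of_nat_Suc, simp_all add: stay_def scan_def)
    qed
    then have "runs (Act ?A) (s k) 1 (s (Suc k))" using runs_Act[of ?A "s k"] by simp
    then show "((scan (s k) i = 1 \<or> scan (s k) i = 2) \<and> scan (s k) j = scan (s k) i) \<and>
        runs (Act ?A) (s k) 1 (s (Suc k))" using scan symbol_simps(5) by simp
  next
    have scan: "scan (s (length c)) i = \<sigma> i (int (length c))" "scan (s (length c)) j = split_tape c u 0"
      using ij by (simp_all add: s_def scan_def)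
    have "\<sigma> i (int (length c)) = D \<or> \<sigma> i (int (length c)) = letter_at y 0"
    proof -
      have "word_tape (c @ y) (int (length c)) = letter_at y 0"
        by (simp add: word_tape_def letter_at_def symbol_def nth_append)
      then show ?thesis using un[of "int (length c)"] by presburger
    qed
    moreover have "split_tape c u 0 = letter_at u 0" using split_tape_nonneg[of c u 0] by simp
    ultimately show "\<not> ((scan (s (length c)) i = 1 \<or> scan (s (length c)) i = 2) \<and>
        scan (s (length c)) j = scan (s (length c)) i)"
      using diff D scan by (cases y; cases u) auto
  qed
  moreover have "s 0 = \<sigma>" using j by (auto simp: s_def fun_eq_iff)
  moreover have "s (length c) = \<tau>" by (simp add: s_def \<tau>)
  ultimately have "runs (compare i j) \<sigma> (length c * (1 + 1) + 1) \<tau>" by simp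
  then show ?thesis by (rule runs_mono) simp
qed

lemma spans_shift:
  assumes "spans L t" "\<And>k. k < m \<Longrightarrow> t (int k) \<noteq> 0"
  shows "spans L (\<lambda>j. t (j + int m))"
proof -
  obtain a b where ab: "a \<le> 1" "0 \<le> b" "a \<le> b" "b - a \<le> int L" "\<And>j. t j \<noteq> 0 \<longleftrightarrow> a \<le> j \<and> j < b"
    using assms(1) unfolding spans_def by blast
  have mb: "int m \<le> b"
    using ab(2) assms(2)[of "m - 1"] ab(5)[of "int (m - 1)"] by (cases m) auto
  have *: "t (j + int m) \<noteq> 0 \<longleftrightarrow> a - int m \<le> j \<and> j < b - int m" for j
    unfolding ab(5) by auto
  show ?thesis unfolding spans_def
    by (rule exI[of _ "a - int m"], rule exI[of _ "b - int m"]) (use mb ab(1-4) * in simp)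
qed

section \<open>Enumeration of words\<close>

definition nth_word :: "nat \<Rightarrow> word" where
  "nth_word i = (succ_word ^^ i) []"

text \<open>The value of a bijective base-2 numeral.\<close>

fun word_index :: "word \<Rightarrow> nat" where
  "word_index [] = 0"
| "word_index (b # w) = (if b then 2 else 1) + 2 * word_index w"

lemma nth_word_Suc: "nth_word (Suc i) = succ_word (nth_word i)"
  by (simp add: nth_word_def)

lemma length_nth_word: "length (nth_word i) \<le> i"
proof (induction i)
  case (Suc i)
  have "length (succ_word w) \<le> Suc (length w)" for w
    by (induction w rule: succ_word.induct) auto
  then show ?case using Suc by (metis Suc_le_mono le_trans nth_word_Suc)
qed (simp add: nth_word_def)

lemma nth_word_index: "nth_word (word_index w) = w"
proof -
  have "word_index (succ_word w) = Suc (word_index w)" for w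
    by (induction w rule: succ_word.induct) auto
  then have "word_index (nth_word i) = i" for i
    by (induction i) (auto simp: nth_word_Suc, simp add: nth_word_def)
  moreover have "word_index v = word_index w \<Longrightarrow> v = w" for v w
  proof (induction v arbitrary: w)
    case Nil
    then show ?case by (cases w) (auto split: if_splits)
  next
    case (Cons b v)
    then obtain c w' where w: "w = c # w'" by (cases w) (auto split: if_splits)
    have "b = c \<and> word_index v = word_index w'"
      using Cons.prems unfolding w by (cases b; cases c; simp) presburger+
    then show ?case using Cons.IH w by simp
  qed
  ultimately show ?thesis by blast
qed

lemma word_index_less: "word_index w < 2 ^ Suc (length w)"
proof -
  have "word_index w + 2 \<le> 2 ^ Suc (length w)" by (induction w) auto
  then show ?thesis by simp
qed

section \<open>Inversion by search\<close>

definition hits :: "pfun \<Rightarrow> word \<Rightarrow> nat \<Rightarrow> bool" where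
  "hits f u i \<longleftrightarrow> (\<exists>y. f (nth_word i) = Some y \<and> pref_comparable y u)"

text \<open>The number of trials is bounded by the length of the input, which is what makes this computable in
  polynomial time. If the first candidate that hits has an image properly longer than \<open>u\<close>, then the
  value is undefined even if later candidates would do.\<close>

definition padded_inverse :: "pfun \<Rightarrow> pfun" where
  "padded_inverse f u =
     (if \<exists>i<length u. hits f u i then
        let i = (LEAST i. hits f u i); y = the (f (nth_word i))
        in if prefix y u then Some (nth_word i @ drop (length y) u) else None
      else None)"

lemma padded_inverse_at:
  assumes "i < length u" "\<And>j. j < i \<Longrightarrow> \<not> hits f u j" "f (nth_word i) = Some y" "pref_comparable y u"
  shows "padded_inverse f u = (if prefix y u then Some (nth_word i @ drop (length y) u) else None)"
proof -
  have hit: "hits f u i" using assms(3,4) by (auto simp: hits_def)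
  then have "(LEAST i. hits f u i) = i"
    by (intro Least_equality) (use assms(2) in \<open>auto simp: not_less[symmetric]\<close>)
  then show ?thesis using hit assms(1,3) by (auto simp: padded_inverse_def Let_def)
qed

text \<open>Tape 0 holds the input, serves as a clock, and receives the output; tape 1 holds a copy of the input and
  tape 2 the current candidate. Tape 3 is a flag, which is 0 during the search, 1 after a success and 2
  after a failure. Tape 4 is the state register of the simulated machine, and the remaining tapes are
  its tapes.\<close>

definition machine_tapes :: "tm \<Rightarrow> nat list" where
  "machine_tapes M = 5 # [6..<5 + tm_tapes M]"

text \<open>A symbol that the simulated machine does not have.\<close>

definition dirty :: "tm \<Rightarrow> nat" where
  "dirty M = tm_symbols M"

definition run_candidate :: "tm \<Rightarrow> prog" where
  "run_candidate M = Seq (copy 2 5) (Seq (rewind 2) (Seq (rewind 5) (Seq (put 4 (tm_start M))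
     (simulate M (dirty M) 4 (machine_tapes M)))))"

definition judge_candidate :: "tm \<Rightarrow> prog" where
  "judge_candidate M = Cond (\<lambda>r. r 4 = tm_accept M)
     (Seq (compare 5 1) (Cond (\<lambda>r. r 5 \<noteq> 1 \<and> r 5 \<noteq> 2) (put 3 1) (Cond (\<lambda>r. r 1 = 0) (put 3 2) (rewind 1))))
     skip"

definition next_candidate :: "tm \<Rightarrow> prog" where
  "next_candidate M = Seq (put 4 0) (Seq (clean_all (machine_tapes M)) (increment 2))"

text \<open>Each trial uses up one letter of the input on tape 0, and the search fails when none is left.\<close>

definition try_candidate :: "tm \<Rightarrow> prog" where
  "try_candidate M = Cond (\<lambda>r. r 0 = 0) (put 3 2)
     (Seq (act1 0 (\<lambda>s. (0, Right_Move))) (Seq (run_candidate M) (Seq (judge_candidate M)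
        (Cond (\<lambda>r. r 3 = 0) (next_candidate M) skip))))"

definition emit_result :: prog where
  "emit_result = Seq (erase 0) (Seq (copy 2 0) (Seq (copy 1 0) (rewind 0)))"

definition search :: "tm \<Rightarrow> prog" where
  "search M = Seq (copy 0 1) (Seq (rewind 0) (Seq (rewind 1)
     (Seq (Loop (\<lambda>r. r 3 = 0) (try_candidate M)) (Cond (\<lambda>r. r 3 = 1) emit_result Fail))))"

lemma wf_prog_basic:
  "i < K \<Longrightarrow> wf_prog K S (shift i d)"
  "i < K \<Longrightarrow> wf_prog K S (rewind i)"
  "i < K \<Longrightarrow> 0 < S \<Longrightarrow> wf_prog K S (erase i)"
  "i < K \<Longrightarrow> 3 \<le> S \<Longrightarrow> wf_prog K S (increment i)"
  "i < K \<Longrightarrow> 3 \<le> S \<Longrightarrow> wf_prog K S (clean i)"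
  "i < K \<Longrightarrow> j < K \<Longrightarrow> wf_prog K S (compare i j)"
  by (auto simp: shift_def rewind_def erase_def increment_def clean_def compare_def act1_def put_def stay_def)

lemma wf_prog_clean_all: "\<forall>i\<in>set is. i < K \<Longrightarrow> 3 \<le> S \<Longrightarrow> wf_prog K S (clean_all is)"
  by (induction "is") (auto simp: clean_all_def wf_prog_basic wf_prog_skip)

lemma layout_search: "wf_tm M \<Longrightarrow> layout M (dirty M) 4 (machine_tapes M)"
  by (auto simp: layout_def machine_tapes_def dirty_def wf_tm_def)

lemma wf_prog_search:
  assumes M: "wf_tm M"
  shows "wf_prog (5 + tm_tapes M) (tm_states M + tm_symbols M + 3) (search M)"
proof -
  have "tm_start M < tm_states M" "1 \<le> tm_tapes M" using M by (auto simp: wf_tm_def)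
  then show ?thesis
    unfolding search_def emit_result_def try_candidate_def next_candidate_def judge_candidate_def run_candidate_def
      wf_prog.simps
    by (intro conjI wf_prog_basic wf_prog_clean_all wf_prog_copy wf_prog_put wf_prog_act1 wf_prog_skip
        wf_prog_simulate[OF layout_search[OF M]] TrueI)
      (auto simp: machine_tapes_def dirty_def)
qed

lemma runs_candidate:
  assumes M: "computes M p f" and \<sigma>: "\<sigma> 2 = split_tape [] x" "\<forall>j\<ge>3. \<sigma> j = blank_tape"
  shows "\<exists>\<tau>. runs (run_candidate M) \<sigma> (6 * length x + 2 * poly p (length x) + 17) \<tau> \<and>
    (\<exists>q. \<tau> 4 = cell q \<and> (case f x of None \<Rightarrow> q = tm_reject M
        | Some y \<Rightarrow> q = tm_accept M \<and> unmark (dirty M) \<circ> \<tau> 5 = word_tape y)) \<and>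
    (\<forall>j. j \<notin> set (machine_tapes M) \<longrightarrow> j \<noteq> 4 \<longrightarrow> \<tau> j = \<sigma> j) \<and>
    (\<forall>l\<in>set (machine_tapes M). spans (length x + poly p (length x)) (\<tau> l))"
proof -
  have wf: "wf_tm M" using M by (simp add: computes_def)
  then have D0: "dirty M \<noteq> 0" by (auto simp: dirty_def wf_tm_def)
  have \<sigma>5: "\<sigma> 5 = split_tape [] []" using \<sigma>(2) by (simp add: split_tape_Nil)
  let ?\<rho>1 = "\<sigma>(2 := split_tape x [], 5 := split_tape x [])"
  have 1: "runs (copy 2 5) \<sigma> (2 * length x + 1) ?\<rho>1"
    by (rule runs_copy[OF _ \<sigma>(1) \<sigma>5]) auto
  let ?\<rho>2 = "\<sigma>(5 := split_tape x [])"
  have 2: "runs (rewind 2) ?\<rho>1 (2 * length x + 5) ?\<rho>2"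
    by (rule runs_rewind[of _ _ x "[]"]) (auto simp: fun_eq_iff \<sigma>(1))
  let ?\<rho>3 = "\<sigma>(5 := word_tape x)"
  have 3: "runs (rewind 5) ?\<rho>2 (2 * length x + 5) ?\<rho>3"
    by (rule runs_rewind[of _ _ x "[]"]) (auto simp: split_tape_Nil)
  let ?\<rho>4 = "?\<rho>3(4 := cell (tm_start M))"
  have 4: "runs (put 4 (tm_start M)) ?\<rho>3 1 ?\<rho>4"
    by (rule runs_put) (simp add: \<sigma>(2) cell_def)
  have "?\<rho>4 4 = cell (tm_start M)" "?\<rho>4 5 = word_tape x"
    "k \<in> set [6..<5 + tm_tapes M] \<Longrightarrow> ?\<rho>4 k = blank_tape" for k
    by (auto simp: \<sigma>(2))
  from simulate_computes[OF M layout_search[OF wf, unfolded machine_tapes_def] this] obtain \<tau> where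
    5: "runs (simulate M (dirty M) 4 (machine_tapes M)) ?\<rho>4 (2 * poly p (length x) + 1) \<tau>"
    and res: "case f x of None \<Rightarrow> \<tau> 4 = cell (tm_reject M)
        | Some y \<Rightarrow> \<tau> 4 = cell (tm_accept M) \<and> unmark (dirty M) \<circ> \<tau> 5 = word_tape y"
    and rest: "\<And>j. j \<notin> set (machine_tapes M) \<Longrightarrow> j \<noteq> 4 \<Longrightarrow> \<tau> j = ?\<rho>4 j"
    and spans: "\<And>l. l \<in> set (machine_tapes M) \<Longrightarrow> spans (length x + poly p (length x)) (\<tau> l)"
    unfolding machine_tapes_def[symmetric] using D0 by blast
  have "runs (run_candidate M) \<sigma> (6 * length x + 2 * poly p (length x) + 17) \<tau>"
    unfolding run_candidate_def
    by (rule runs_mono[OF runs_Seq[OF 1 runs_Seq[OF 2 runs_Seq[OF 3 runs_Seq[OF 4 5]]]]]) simp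
  moreover have "\<exists>q. \<tau> 4 = cell q \<and> (case f x of None \<Rightarrow> q = tm_reject M
        | Some y \<Rightarrow> q = tm_accept M \<and> unmark (dirty M) \<circ> \<tau> 5 = word_tape y)"
    using res by (cases "f x") auto
  moreover have "\<tau> j = \<sigma> j" if "j \<notin> set (machine_tapes M)" "j \<noteq> 4" for j
    using rest[OF that] that by (simp add: machine_tapes_def)
  ultimately show ?thesis using spans by blast
qed

lemma longest_common_prefix_split:
  obtains c y' u' where "y = c @ y'" "u = c @ u'" "y' = [] \<or> u' = [] \<or> hd y' \<noteq> hd u'"
  using longest_common_prefix[of y u] by metis

text \<open>After the common prefix of the image \<open>y\<close> and the input \<open>u\<close>, tape 5 shows no letter iff \<open>y\<close> is a prefix of
  \<open>u\<close>; otherwise tape 1 shows a blank iff \<open>u\<close> is a proper prefix of \<open>y\<close>. After a success, the head on tape 1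
  is where the rest of the input begins that must be appended to the candidate. After a
  mismatch, tape 5 remains in a state that can be cleaned.\<close>

lemma runs_judge:
  assumes wf: "wf_tm M" and \<tau>3: "\<tau> 3 = blank_tape" and \<tau>1: "\<tau> 1 = split_tape [] u"
    and q: "\<tau> 4 = cell q" and res: "case z of None \<Rightarrow> q = tm_reject M
        | Some y \<Rightarrow> q = tm_accept M \<and> unmark (dirty M) \<circ> \<tau> 5 = word_tape y"
    and sp: "spans L (\<tau> 5)"
  shows "\<exists>\<rho>. runs (judge_candidate M) \<tau> (4 * length u + 12) \<rho> \<and> (\<forall>j. j \<noteq> 1 \<longrightarrow> j \<noteq> 3 \<longrightarrow> j \<noteq> 5 \<longrightarrow> \<rho> j = \<tau> j) \<and>
    (case z of None \<Rightarrow> \<rho> = \<tau>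
     | Some y \<Rightarrow>
        if prefix y u then scan \<rho> 3 = 1 \<and> \<rho> 1 = split_tape y (drop (length y) u)
        else if prefix u y then scan \<rho> 3 = 2
        else \<rho> 1 = \<tau> 1 \<and> \<rho> 3 = \<tau> 3 \<and> spans L (\<rho> 5))"
proof (cases z)
  case None
  have "runs (judge_candidate M) \<tau> (1 + 1) \<tau>"
    unfolding judge_candidate_def
    by (rule runs_Cond_False[OF _ runs_skip]) (use None q res wf in \<open>simp add: scan_def cell_def wf_tm_def\<close>)
  then have "runs (judge_candidate M) \<tau> (4 * length u + 12) \<tau>" by (rule runs_mono) simp
  then show ?thesis using None by (intro exI[of _ \<tau>]) simp
next
  case (Some y)
  have acc: "scan \<tau> 4 = tm_accept M" and F: "unmark (dirty M) \<circ> \<tau> 5 = word_tape y"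
    using q res Some by (auto simp: scan_def cell_def)
  obtain c y' u' where c: "y = c @ y'" "u = c @ u'" "y' = [] \<or> u' = [] \<or> hd y' \<noteq> hd u'"
    by (rule longest_common_prefix_split)
  have D3: "3 \<le> dirty M" using wf by (auto simp: dirty_def wf_tm_def)
  let ?\<rho> = "\<tau>(5 := (\<lambda>k. \<tau> 5 (k + int (length c))), 1 := split_tape c u')"
  have 1: "runs (compare 5 1) \<tau> (2 * length c + 1) ?\<rho>"
    by (rule runs_compare[OF _ D3 F[unfolded c(1)] \<tau>1[unfolded c(2)] c(3)]) auto
  have F_at: "unmark (dirty M) (\<tau> 5 (int k)) = letter_at y k" for k
    using fun_cong[OF F, of "int k"] by (simp add: word_tape_def letter_at_def symbol_def)
  have read5: "scan ?\<rho> 5 = dirty M \<or> scan ?\<rho> 5 = letter_at y' 0"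
    using F_at[of "length c"] by (auto simp: scan_def unmark_def c(1) letter_at_def nth_append split: if_splits)
  have unm: "unmark (dirty M) (scan ?\<rho> 5) = letter_at y' 0"
    using F_at[of "length c"] by (simp add: scan_def c(1) letter_at_def nth_append)
  have read1: "scan ?\<rho> 1 = letter_at u' 0"
    using split_tape_nonneg[of c u' 0] by (simp add: scan_def)
  have pre: "prefix y u \<longleftrightarrow> y' = []" "prefix u y \<longleftrightarrow> u' = []"
    using c by (cases y'; cases u'; auto)+
  define inner where "inner = Cond (\<lambda>r. r 5 \<noteq> 1 \<and> r 5 \<noteq> 2) (put 3 1) (Cond (\<lambda>r. r 1 = 0) (put 3 2) (rewind 1))"
  have fin: "runs (judge_candidate M) \<tau> (4 * length u + 12) \<rho>'"
    if "runs inner ?\<rho> (2 * length c + 7) \<rho>'" for \<rho>'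
    unfolding judge_candidate_def inner_def[symmetric]
    by (rule runs_mono[OF runs_Cond_True[where b = "\<lambda>r. r 4 = tm_accept M", OF acc runs_Seq[OF 1 that]]])
      (simp add: c(2))
  show ?thesis
  proof (cases "y' = []")
    case True
    let ?\<rho>' = "?\<rho>(3 := blank_tape(0 := 1))"
    have "runs (put 3 1) ?\<rho> 1 ?\<rho>'" by (rule runs_put) (simp add: \<tau>3)
    moreover have "scan ?\<rho> 5 \<noteq> 1 \<and> scan ?\<rho> 5 \<noteq> 2" using read5 D3 True by auto
    ultimately have "runs inner ?\<rho> (1 + 1) ?\<rho>'"
      unfolding inner_def using runs_Cond_True[of "\<lambda>r. r 5 \<noteq> 1 \<and> r 5 \<noteq> 2"] by blast
    then have "runs inner ?\<rho> (2 * length c + 7) ?\<rho>'" by (rule runs_mono) simp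
    from fin[OF this] show ?thesis
      using Some pre True c by (intro exI[of _ ?\<rho>']) (simp add: scan_def)
  next
    case y'_ne: False
    have "letter_at y' 0 = 1 \<or> letter_at y' 0 = 2" using y'_ne symbol_simps(5) by (cases y') auto
    moreover have "scan ?\<rho> 5 = letter_at y' 0"
      using unm read5 \<open>letter_at y' 0 = 1 \<or> letter_at y' 0 = 2\<close> by (auto simp: unmark_def split: if_splits)
    ultimately have not_end: "\<not> (scan ?\<rho> 5 \<noteq> 1 \<and> scan ?\<rho> 5 \<noteq> 2)" by auto
    note skip_first = runs_Cond_False[where b = "\<lambda>r. r 5 \<noteq> 1 \<and> r 5 \<noteq> 2", OF not_end]
    show ?thesis
    proof (cases "u' = []")
      case True
      let ?\<rho>' = "?\<rho>(3 := blank_tape(0 := 2))"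
      have p: "runs (put 3 2) ?\<rho> 1 ?\<rho>'" by (rule runs_put) (simp add: \<tau>3)
      have "scan ?\<rho> 1 = 0" using read1 True by simp
      from skip_first[OF runs_Cond_True[where b = "\<lambda>r. r 1 = 0", OF this p]]
      have "runs inner ?\<rho> (1 + 1 + 1) ?\<rho>'" unfolding inner_def .
      then have "runs inner ?\<rho> (2 * length c + 7) ?\<rho>'" by (rule runs_mono) simp
      from fin[OF this] show ?thesis
        using Some pre True y'_ne by (intro exI[of _ ?\<rho>']) (simp add: scan_def)
    next
      case False
      let ?\<rho>' = "?\<rho>(1 := split_tape [] u)"
      have p: "runs (rewind 1) ?\<rho> (2 * length c + 5) ?\<rho>'"
        by (rule runs_rewind[of _ _ c u']) (simp_all add: c(2))
      have "scan ?\<rho> 1 \<noteq> 0" using read1 False by (cases u') auto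
      from skip_first[OF runs_Cond_False[where b = "\<lambda>r. r 1 = 0", OF this p]]
      have "runs inner ?\<rho> (2 * length c + 5 + 1 + 1) ?\<rho>'" unfolding inner_def .
      then have "runs inner ?\<rho> (2 * length c + 7) ?\<rho>'" by (rule runs_mono) simp
      moreover have "spans L (\<lambda>k. \<tau> 5 (k + int (length c)))"
      proof (rule spans_shift[OF sp])
        fix k assume "k < length c"
        then have "letter_at y k \<noteq> 0" by (simp add: letter_at_def c(1))
        then show "\<tau> 5 (int k) \<noteq> 0" using F_at[of k] by (auto simp: unmark_def split: if_splits)
      qed
      ultimately show ?thesis
        using fin[of ?\<rho>'] Some pre False y'_ne \<tau>1 by (intro exI[of _ ?\<rho>']) simp
    qed
  qed
qed

lemma runs_next:
  assumes x: "\<rho> 2 = split_tape [] x" and q: "\<rho> 4 = cell q"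
    and sp: "\<And>l. l \<in> set (machine_tapes M) \<Longrightarrow> spans L (\<rho> l)"
    and \<tau>: "\<tau> = (\<lambda>j. if j \<in> set (machine_tapes M) then blank_tape else \<rho> j)
      (4 := blank_tape, 2 := split_tape [] (succ_word x))"
    and wf: "wf_tm M"
  shows "runs (next_candidate M) \<rho> (tm_tapes M * (4 * L + 13) + 4 * length x + 13) \<tau>"
proof -
  have 1: "runs (put 4 0) \<rho> 1 (\<rho>(4 := blank_tape))"
    by (rule runs_put) (simp add: q cell_def fun_upd_idem)
  let ?\<rho>2 = "(\<lambda>j. if j \<in> set (machine_tapes M) then blank_tape else \<rho> j)(4 := blank_tape)"
  have 2: "runs (clean_all (machine_tapes M)) (\<rho>(4 := blank_tape))
      (length (machine_tapes M) * (4 * L + 13) + 1) ?\<rho>2"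
    by (rule runs_clean_all) (use sp in \<open>auto simp: machine_tapes_def fun_eq_iff\<close>)
  have 3: "runs (increment 2) ?\<rho>2 (4 * length x + 9) \<tau>"
    by (rule runs_increment) (auto simp: \<tau> x machine_tapes_def)
  have "length (machine_tapes M) = tm_tapes M"
    using layout_search[OF wf] by (simp add: layout_def)
  then show ?thesis unfolding next_candidate_def
    by (intro runs_mono[OF runs_Seq[OF 1 runs_Seq[OF 2 3]]]) simp
qed

text \<open>The store before trial number \<open>i\<close>, if all earlier candidates missed.\<close>

definition search_store :: "word \<Rightarrow> nat \<Rightarrow> store" where
  "search_store u i = (\<lambda>_. blank_tape)(0 := split_tape [] (drop i u), 1 := split_tape [] u,
     2 := split_tape [] (nth_word i))"

definition try_time :: "tm \<Rightarrow> nat poly \<Rightarrow> nat \<Rightarrow> nat" where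
  "try_time M p n = 14 * n + 2 * poly p n + tm_tapes M * (4 * n + 4 * poly p n + 13) + 50"

lemma runs_try:
  assumes M: "computes M p f" and i: "i < length u"
  shows "\<not> hits f u i \<Longrightarrow>
      runs (try_candidate M) (search_store u i) (try_time M p (length u)) (search_store u (Suc i))"
    and "f (nth_word i) = Some y \<Longrightarrow> prefix y u \<Longrightarrow> \<exists>\<rho>.
      runs (try_candidate M) (search_store u i) (try_time M p (length u)) \<rho> \<and> scan \<rho> 3 = 1 \<and>
      \<rho> 0 = split_tape [] (drop (Suc i) u) \<and> \<rho> 1 = split_tape y (drop (length y) u) \<and>
      \<rho> 2 = split_tape [] (nth_word i)"
    and "f (nth_word i) = Some y \<Longrightarrow> \<not> prefix y u \<Longrightarrow> prefix u y \<Longrightarrow> \<exists>\<rho>.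
      runs (try_candidate M) (search_store u i) (try_time M p (length u)) \<rho> \<and> scan \<rho> 3 = 2"
proof -
  have wf: "wf_tm M" using M by (simp add: computes_def)
  define x where "x = nth_word i"
  define P where "P = poly p (length x)"
  let ?n = "length u"
  have x_len: "length x \<le> ?n" using length_nth_word[of i] i by (simp add: x_def)
  then have P_le: "P \<le> poly p ?n" unfolding P_def by (rule poly_nat_mono)
  let ?\<sigma> = "(search_store u i)(0 := split_tape [] (drop (Suc i) u))"
  obtain c where c: "drop i u = c # drop (Suc i) u" using i by (metis Cons_nth_drop_Suc)
  have read0: "scan (search_store u i) 0 \<noteq> 0" by (simp add: scan_def search_store_def c)
  have s0: "search_store u i 0 = split_tape [] (c # drop (Suc i) u)" by (simp add: search_store_def c)
  have 1: "runs (act1 0 (\<lambda>s. (0, Right_Move))) (search_store u i) 1 ?\<sigma>"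
    using runs_act1[of 0 "\<lambda>s. (0, Right_Move)" "search_store u i"] unfolding s0 split_tape_erase .
  have "?\<sigma> 2 = split_tape [] x" "\<forall>j\<ge>3. ?\<sigma> j = blank_tape"
    by (auto simp: search_store_def x_def)
  note candidate = runs_candidate[where \<sigma> = ?\<sigma> and x = x, OF M this, folded P_def]
  obtain \<tau> q where
    2: "runs (run_candidate M) ?\<sigma> (6 * length x + 2 * P + 17) \<tau>" and
    q: "\<tau> 4 = cell q" and res: "case f x of None \<Rightarrow> q = tm_reject M
        | Some y \<Rightarrow> q = tm_accept M \<and> unmark (dirty M) \<circ> \<tau> 5 = word_tape y" and
    all: "\<forall>j. j \<notin> set (machine_tapes M) \<longrightarrow> j \<noteq> 4 \<longrightarrow> \<tau> j = ?\<sigma> j"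
      "\<forall>l\<in>set (machine_tapes M). spans (length x + P) (\<tau> l)"
    using candidate by (elim exE conjE) (rule that)
  have rest: "\<And>j. j \<notin> set (machine_tapes M) \<Longrightarrow> j \<noteq> 4 \<Longrightarrow> \<tau> j = ?\<sigma> j"
    and sp: "\<And>l. l \<in> set (machine_tapes M) \<Longrightarrow> spans (length x + P) (\<tau> l)"
    using all by blast+
  have \<tau>: "\<tau> 0 = split_tape [] (drop (Suc i) u)" "\<tau> 1 = split_tape [] u" "\<tau> 2 = split_tape [] x"
    "\<tau> 3 = blank_tape"
    using rest by (auto simp: machine_tapes_def search_store_def x_def)
  have "5 \<in> set (machine_tapes M)" by (simp add: machine_tapes_def)
  from runs_judge[OF wf \<tau>(4,2) q res sp[OF this]] obtain \<rho> where
    3: "runs (judge_candidate M) \<tau> (4 * ?n + 12) \<rho>" and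
    keep: "\<And>j. j \<noteq> 1 \<Longrightarrow> j \<noteq> 3 \<Longrightarrow> j \<noteq> 5 \<Longrightarrow> \<rho> j = \<tau> j" and
    verdict: "case f x of None \<Rightarrow> \<rho> = \<tau>
     | Some y \<Rightarrow>
        if prefix y u then scan \<rho> 3 = 1 \<and> \<rho> 1 = split_tape y (drop (length y) u)
        else if prefix u y then scan \<rho> 3 = 2
        else \<rho> 1 = \<tau> 1 \<and> \<rho> 3 = \<tau> 3 \<and> spans (length x + P) (\<rho> 5)"
    by blast
  let ?L = "tm_tapes M * (4 * (length x + P) + 13) + 4 * length x + 13"
  have L: "?L \<le> tm_tapes M * (4 * ?n + 4 * poly p ?n + 13) + 4 * ?n + 13"
    using x_len P_le by (intro add_mono mult_le_mono) auto
  have fin: "runs (try_candidate M) (search_store u i) (try_time M p ?n) \<tau>'"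
    if "runs (Cond (\<lambda>r. r 3 = 0) (next_candidate M) skip) \<rho> (?L + 1) \<tau>'" for \<tau>'
    unfolding try_candidate_def
    by (rule runs_mono[OF runs_Cond_False[where b = "\<lambda>r. r 0 = 0", OF read0
        runs_Seq[OF 1 runs_Seq[OF 2 runs_Seq[OF 3 that]]]]])
      (use L x_len P_le in \<open>simp add: try_time_def\<close>)
  have stop: "runs (try_candidate M) (search_store u i) (try_time M p ?n) \<rho>" if "scan \<rho> 3 \<noteq> 0"
    by (rule fin, rule runs_mono[OF runs_Cond_False[where b = "\<lambda>r. r 3 = 0", OF that runs_skip]]) simp
  show "\<exists>\<rho>. runs (try_candidate M) (search_store u i) (try_time M p (length u)) \<rho> \<and> scan \<rho> 3 = 1 \<and>
      \<rho> 0 = split_tape [] (drop (Suc i) u) \<and> \<rho> 1 = split_tape y (drop (length y) u) \<and>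
      \<rho> 2 = split_tape [] (nth_word i)" if "f (nth_word i) = Some y" "prefix y u"
    using verdict stop keep \<tau> that by (intro exI[of _ \<rho>]) (simp add: x_def[symmetric])
  show "\<exists>\<rho>. runs (try_candidate M) (search_store u i) (try_time M p (length u)) \<rho> \<and> scan \<rho> 3 = 2"
    if "f (nth_word i) = Some y" "\<not> prefix y u" "prefix u y"
    using verdict stop that by (intro exI[of _ \<rho>]) (simp add: x_def[symmetric])
  show "runs (try_candidate M) (search_store u i) (try_time M p (length u)) (search_store u (Suc i))"
    if "\<not> hits f u i"
  proof -
    have same: "\<rho> 1 = \<tau> 1 \<and> \<rho> 3 = \<tau> 3 \<and> spans (length x + P) (\<rho> 5)"
      using verdict that sp[of 5] by (auto simp: hits_def pref_comparable_def x_def machine_tapes_def split: option.splits)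
    have "search_store u (Suc i) = (\<lambda>j. if j \<in> set (machine_tapes M) then blank_tape else \<rho> j)
      (4 := blank_tape, 2 := split_tape [] (succ_word x))" (is "_ = ?R")
    proof
      fix j show "search_store u (Suc i) j = ?R j"
        using same keep[of j] rest[of j] \<tau>
        by (cases "j \<in> {0, 1, 2, 3, 4, 5}")
          (auto simp: search_store_def nth_word_Suc x_def[symmetric] machine_tapes_def keep)
    qed
    have nx: "runs (next_candidate M) \<rho> ?L (search_store u (Suc i))"
      by (rule runs_next[OF _ _ _ \<open>search_store u (Suc i) = ?R\<close> wf])
        (use keep \<tau> q sp same in \<open>auto simp: machine_tapes_def\<close>)
    have "scan \<rho> 3 = 0" using same \<tau> by (simp add: scan_def)
    from fin[OF runs_Cond_True[where b = "\<lambda>r. r 3 = 0", OF this nx]] show ?thesis .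
  qed
qed

lemma runs_try_exhausted:
  "\<exists>\<rho>. runs (try_candidate M) (search_store u (length u)) (try_time M p (length u)) \<rho> \<and> scan \<rho> 3 = 2"
proof -
  let ?\<rho> = "(search_store u (length u))(3 := blank_tape(0 := 2))"
  have "runs (put 3 2) (search_store u (length u)) 1 ?\<rho>"
    by (rule runs_put) (simp add: search_store_def)
  then have "runs (try_candidate M) (search_store u (length u)) (1 + 1) ?\<rho>"
    unfolding try_candidate_def by (rule runs_Cond_True[rotated]) (simp add: scan_def search_store_def)
  then have "runs (try_candidate M) (search_store u (length u)) (try_time M p (length u)) ?\<rho>"
    by (rule runs_mono) (simp add: try_time_def)
  then show ?thesis by (intro exI[of _ ?\<rho>]) (simp add: scan_def)
qed

lemma runs_search_loop:
  assumes M: "computes M p f" and i: "i \<le> length u" "\<And>j. j < i \<Longrightarrow> \<not> hits f u j"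
    and last: "runs (try_candidate M) (search_store u i) (try_time M p (length u)) \<rho>" "scan \<rho> 3 \<noteq> 0"
  shows "runs (Loop (\<lambda>r. r 3 = 0) (try_candidate M)) (search_store u 0)
    (Suc (length u) * (try_time M p (length u) + 1) + 1) \<rho>"
proof -
  let ?s = "\<lambda>j. if j \<le> i then search_store u j else \<rho>"
  have "runs (Loop (\<lambda>r. r 3 = 0) (try_candidate M)) (?s 0) (Suc i * (try_time M p (length u) + 1) + 1) (?s (Suc i))"
  proof (rule runs_Loop)
    fix j assume "j < Suc i"
    then have "j < i \<or> j = i" by auto
    then have "runs (try_candidate M) (?s j) (try_time M p (length u)) (?s (Suc j))"
      using runs_try(1)[OF M, of j u] i last(1) by auto
    moreover have "scan (search_store u j) 3 = 0" for j by (simp add: scan_def search_store_def)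
    ultimately show "scan (?s j) 3 = 0 \<and> runs (try_candidate M) (?s j) (try_time M p (length u)) (?s (Suc j))"
      using \<open>j < Suc i\<close> by simp
  qed (use last(2) in simp)
  then have "runs (Loop (\<lambda>r. r 3 = 0) (try_candidate M)) (search_store u 0)
      (Suc i * (try_time M p (length u) + 1) + 1) \<rho>" by simp
  then show ?thesis by (rule runs_mono) (use i(1) in \<open>intro add_mono mult_le_mono; simp\<close>)
qed

lemma runs_emit:
  assumes "\<rho> 0 = split_tape [] v" "\<rho> 1 = split_tape y z" "\<rho> 2 = split_tape [] x"
  shows "\<exists>\<tau>. runs emit_result \<rho> (2 * length v + 4 * length x + 4 * length z + 11) \<tau> \<and> \<tau> 0 = word_tape (x @ z)"
proof -
  have 1: "runs (erase 0) \<rho> (2 * length v + 1) (\<rho>(0 := blank_tape))"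
    by (rule runs_erase[where \<sigma> = \<rho> and i = 0, OF assms(1)]) simp
  let ?\<rho>2 = "\<rho>(2 := split_tape x [], 0 := split_tape x [])"
  have 2: "runs (copy 2 0) (\<rho>(0 := blank_tape)) (2 * length x + 1) ?\<rho>2"
    by (rule runs_copy[of _ _ _ "[]" x "[]"]) (auto simp: assms split_tape_Nil fun_eq_iff)
  let ?\<rho>3 = "?\<rho>2(1 := split_tape (y @ z) [], 0 := split_tape (x @ z) [])"
  have 3: "runs (copy 1 0) ?\<rho>2 (2 * length z + 1) ?\<rho>3"
    by (rule runs_copy[of _ _ _ y z x]) (auto simp: assms simp del: One_nat_def)
  let ?\<rho>4 = "?\<rho>3(0 := split_tape [] (x @ z))"
  have 4: "runs (rewind 0) ?\<rho>3 (2 * length (x @ z) + 5) ?\<rho>4"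
    by (rule runs_rewind[of _ _ "x @ z" "[]"]) auto
  have "runs emit_result \<rho> (2 * length v + 4 * length x + 4 * length z + 11) ?\<rho>4"
    unfolding emit_result_def
    by (rule runs_mono[OF runs_Seq[OF 1 runs_Seq[OF 2 runs_Seq[OF 3 4]]]]) simp
  then show ?thesis by (intro exI[of _ ?\<rho>4]) (simp add: split_tape_Nil)
qed

text \<open>At most \<open>length u + 1\<close> trials are made, the last of which only finds the clock expired. Candidate
  number \<open>i\<close> has at most \<open>i\<close> letters (\<open>length_nth_word\<close>), so every trial takes time polynomial in the
  length of \<open>u\<close>.\<close>

lemma polytime_computable_padded_inverse:
  assumes "polytime_computable f"
  shows "polytime_computable (padded_inverse f)"
proof -
  obtain M p where M: "computes M p f" using assms unfolding polytime_computable_def computes_def by blast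
  then have wf: "wf_tm M" by (simp add: computes_def)
  let ?X = "[:0, 1:] :: nat poly"
  define B where "B = [:14:] * ?X + 2 * p + [:tm_tapes M:] * ([:4:] * ?X + [:4:] * p + [:13:]) + [:50:]"
  define T where "T = (?X + 1) * (B + 1) + [:60:] * ?X + [:60:]"
  have B: "poly B n = try_time M p n" for n
    by (simp add: B_def try_time_def numeral_poly)
  have T: "poly T n = Suc n * (try_time M p n + 1) + 60 * n + 60" for n
    by (simp add: T_def B)
  let ?tail = "Cond (\<lambda>r. r 3 = 1) emit_result Fail"
  have init: "runs (copy 0 1) (input_store u) (2 * length u + 1) ((input_store u)(0 := split_tape u [], 1 := split_tape u []))"
    "runs (rewind 0) ((input_store u)(0 := split_tape u [], 1 := split_tape u [])) (2 * length u + 5)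
       ((input_store u)(1 := split_tape u []))"
    "runs (rewind 1) ((input_store u)(1 := split_tape u [])) (2 * length u + 5) (search_store u 0)" for u
  proof -
    show "runs (copy 0 1) (input_store u) (2 * length u + 1) ((input_store u)(0 := split_tape u [], 1 := split_tape u []))"
      by (rule runs_copy[of _ _ _ "[]" u "[]"]) (auto simp: input_store_def split_tape_Nil)
    show "runs (rewind 0) ((input_store u)(0 := split_tape u [], 1 := split_tape u [])) (2 * length u + 5)
       ((input_store u)(1 := split_tape u []))"
      by (rule runs_rewind[of _ _ u "[]"]) (auto simp: input_store_def split_tape_Nil fun_eq_iff)
    show "runs (rewind 1) ((input_store u)(1 := split_tape u [])) (2 * length u + 5) (search_store u 0)"
      by (rule runs_rewind[of _ _ u "[]"])
        (auto simp: input_store_def search_store_def split_tape_Nil fun_eq_iff nth_word_def)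
  qed
  have succeed: "runs (search M) (input_store u) (poly T (length u)) \<tau>"
    if "runs (Loop (\<lambda>r. r 3 = 0) (try_candidate M)) (search_store u 0)
      (Suc (length u) * (try_time M p (length u) + 1) + 1) \<rho>" "scan \<rho> 3 = 1"
      "runs emit_result \<rho> (10 * length u + 20) \<tau>" for u \<rho> \<tau>
    unfolding search_def
    by (rule runs_mono[OF runs_Seq[OF init(1) runs_Seq[OF init(2) runs_Seq[OF init(3)
        runs_Seq[OF that(1) runs_Cond_True[where b = "\<lambda>r. r 3 = 1", OF that(2,3)]]]]]])
      (simp add: T)
  have fail: "fails (search M) (input_store u) (poly T (length u))"
    if "runs (Loop (\<lambda>r. r 3 = 0) (try_candidate M)) (search_store u 0)
      (Suc (length u) * (try_time M p (length u) + 1) + 1) \<rho>" "scan \<rho> 3 = 2" for u \<rho>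
  proof -
    have "scan \<rho> 3 \<noteq> 1" using that(2) by simp
    then show ?thesis unfolding search_def
      by (intro fails_mono[OF fails_Seq[OF init(1) fails_Seq[OF init(2) fails_Seq[OF init(3)
        fails_Seq[OF that(1) fails_Cond_False[where b = "\<lambda>r. r 3 = 1", OF _ fails_Fail]]]]]])
        (simp_all add: T)
  qed
  have outcome: "case padded_inverse f u of None \<Rightarrow> fails (search M) (input_store u) (poly T (length u))
      | Some v \<Rightarrow> \<exists>\<tau>. runs (search M) (input_store u) (poly T (length u)) \<tau> \<and> \<tau> 0 = word_tape v" for u
  proof (cases "\<exists>i<length u. hits f u i")
    case False
    then have "padded_inverse f u = None" by (auto simp: padded_inverse_def)
    moreover obtain \<rho> where "runs (try_candidate M) (search_store u (length u)) (try_time M p (length u)) \<rho>"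
      "scan \<rho> 3 = 2" using runs_try_exhausted by blast
    then have "fails (search M) (input_store u) (poly T (length u))"
      by (intro fail[OF runs_search_loop[OF M order.refl]]) (use False in auto)
    ultimately show ?thesis by simp
  next
    case True
    define i where "i = (LEAST i. hits f u i)"
    obtain k where k: "k < length u" "hits f u k" using True by blast
    have hit: "hits f u i" unfolding i_def using k(2) by (rule LeastI)
    have least: "\<not> hits f u j" if "j < i" for j using that not_less_Least unfolding i_def by blast
    have "i \<le> k" unfolding i_def using k(2) by (rule Least_le)
    then have i: "i < length u" using k(1) by simp
    obtain y where y: "f (nth_word i) = Some y" "pref_comparable y u" using hit by (auto simp: hits_def)
    note val = padded_inverse_at[OF i least y]
    show ?thesis
    proof (cases "prefix y u")
      case pre: True
      from runs_try(2)[OF M i y(1) pre] obtain \<rho> where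
        \<rho>: "runs (try_candidate M) (search_store u i) (try_time M p (length u)) \<rho>" "scan \<rho> 3 = 1"
        "\<rho> 0 = split_tape [] (drop (Suc i) u)" "\<rho> 1 = split_tape y (drop (length y) u)"
        "\<rho> 2 = split_tape [] (nth_word i)" by blast
      from runs_emit[OF \<rho>(3-5)] obtain \<tau> where
        \<tau>: "runs emit_result \<rho> (2 * length (drop (Suc i) u) + 4 * length (nth_word i) +
          4 * length (drop (length y) u) + 11) \<tau>" "\<tau> 0 = word_tape (nth_word i @ drop (length y) u)" by blast
      have "length (nth_word i) \<le> length u" using length_nth_word[of i] i by simp
      then have "runs emit_result \<rho> (10 * length u + 20) \<tau>"
        by (intro runs_mono[OF \<tau>(1)]) simp
      then have "runs (search M) (input_store u) (poly T (length u)) \<tau>"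
        by (intro succeed[OF runs_search_loop[OF M _ least \<rho>(1)]]) (use i \<rho>(2) in auto)
      then show ?thesis using val pre \<tau>(2) by auto
    next
      case npre: False
      then have "prefix u y" using y(2) by (auto simp: pref_comparable_def)
      from runs_try(3)[OF M i y(1) npre this] obtain \<rho> where
        \<rho>: "runs (try_candidate M) (search_store u i) (try_time M p (length u)) \<rho>" "scan \<rho> 3 = 2" by blast
      have "fails (search M) (input_store u) (poly T (length u))"
        by (rule fail[OF runs_search_loop[OF M _ least \<rho>(1)]]) (use i \<rho>(2) in auto)
      then show ?thesis using val npre by simp
    qed
  qed
  show ?thesis
  proof (rule polytime_computable_by_prog[OF wf_prog_search[OF wf], of _ T])
    fix x assume "padded_inverse f x = None"
    then show "fails (search M) (input_store x) (poly T (length x))" using outcome[of x] by simp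
  next
    fix x y assume "padded_inverse f x = Some y"
    then show "\<exists>\<tau>. runs (search M) (input_store x) (poly T (length x)) \<tau> \<and> \<tau> 0 = word_tape y"
      using outcome[of x] by simp
  qed simp_all
qed

section \<open>Padded inverses\<close>

lemma padded_inverse_SomeE:
  assumes "padded_inverse f u = Some v"
  obtains i y where "i < length u" "\<forall>j<i. \<not> hits f u j" "f (nth_word i) = Some y" "prefix y u"
    "v = nth_word i @ drop (length y) u"
proof -
  from assms obtain k where k: "k < length u" "hits f u k" by (auto simp: padded_inverse_def split: if_splits)
  define i where "i = (LEAST i. hits f u i)"
  have hit: "hits f u i" unfolding i_def using k(2) by (rule LeastI)
  have least: "\<not> hits f u j" if "j < i" for j using that not_less_Least unfolding i_def by blast
  have "i \<le> k" unfolding i_def using k(2) by (rule Least_le)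
  then have i: "i < length u" using k(1) by simp
  obtain y where y: "f (nth_word i) = Some y" "pref_comparable y u" using hit by (auto simp: hits_def)
  show ?thesis
    using padded_inverse_at[OF i least y] assms least by (intro that[OF i _ y(1)]) (auto split: if_splits)
qed

text \<open>Candidates that are incomparable with \<open>u\<close> remain so when \<open>u\<close> is extended, and the successful one
  remains successful. So the search on \<open>u @ w\<close> stops at the same candidate.\<close>

lemma morphism_padded_inverse: "right_ideal_morphism (padded_inverse f)"
  unfolding morphism_iff
proof (intro allI impI)
  fix u v w assume "padded_inverse f u = Some v"
  then obtain i y where i: "i < length u" "\<forall>j<i. \<not> hits f u j" "f (nth_word i) = Some y" "prefix y u"
    and v: "v = nth_word i @ drop (length y) u" by (rule padded_inverse_SomeE)
  have pre: "prefix y (u @ w)" using i(4) by (rule prefix_prefix)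
  have "pref_comparable z u" if "pref_comparable z (u @ w)" for z
    using that unfolding pref_comparable_iff_common_extension by (meson append_prefixD)
  then have "\<not> hits f (u @ w) j" if "j < i" for j
    using i(2) that by (auto simp: hits_def)
  from padded_inverse_at[OF _ this i(3)] pre i(1)
  have "padded_inverse f (u @ w) = Some (nth_word i @ drop (length y) (u @ w))"
    by (simp add: pref_comparable_def)
  then show "padded_inverse f (u @ w) = Some (v @ w)"
    using prefix_length_le[OF i(4)] v by simp
qed

lemma padded_inverse_inverts:
  assumes "right_ideal_morphism f" "padded_inverse f u = Some v"
  shows "f v = Some u"
proof -
  obtain i y where "f (nth_word i) = Some y" "prefix y u" "v = nth_word i @ drop (length y) u"
    by (rule padded_inverse_SomeE[OF assms(2)])
  then show ?thesis using morphismD(2)[OF assms(1)] by (auto simp: prefix_def)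
qed

lemma balanced_padded_inverse:
  assumes "polynomially_balanced f"
  shows "polynomially_balanced (padded_inverse f)"
proof -
  obtain p where p: "\<And>x y. f x = Some y \<Longrightarrow> length y \<le> poly p (length x)"
    using assms unfolding polynomially_balanced_def by blast
  have "length v \<le> poly (p + [:0, 2:]) (length u) \<and> length u \<le> poly (p + [:0, 2:]) (length v)"
    if uv: "padded_inverse f u = Some v" for u v
  proof -
    obtain i y where i: "i < length u" "f (nth_word i) = Some y" "prefix y u"
      and v: "v = nth_word i @ drop (length y) u" by (rule padded_inverse_SomeE[OF uv])
    have "length v \<le> 2 * length u" using length_nth_word[of i] i(1) v by simp
    moreover have "length y \<le> poly p (length v)"
      using p[OF i(2)] poly_nat_mono[of "length (nth_word i)" "length v" p] v by simp
    moreover have "length u \<le> length y + length v" using v by simp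
    ultimately show ?thesis by simp
  qed
  then show ?thesis unfolding polynomially_balanced_def by blast
qed

text \<open>The preimage \<open>x\<close> is among the first \<open>2 * 2 ^ length x\<close> candidates, so the padding leaves enough time to
  reach it. The search may stop earlier, at some other candidate; its image is no longer than
  \<open>poly p (2 * 2 ^ length x)\<close>, hence shorter than the padded word, and the search succeeds there.\<close>

lemma padded_inverse_defined:
  assumes p: "\<And>x y. f x = Some y \<Longrightarrow> length y \<le> poly p (length x)"
    and x: "f x = Some y" and w: "poly p (2 * 2 ^ length x) + 2 * 2 ^ length x < length w"
  shows "y @ w \<in> dom (padded_inverse f)"
proof -
  let ?u = "y @ w"
  define k where "k = word_index x"
  have k: "k < 2 * 2 ^ length x" using word_index_less[of x] by (simp add: k_def)
  define i where "i = (LEAST i. hits f ?u i)"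
  have hit_k: "hits f ?u k"
    using x by (auto simp: hits_def k_def nth_word_index pref_comparable_def)
  have hit: "hits f ?u i" unfolding i_def using hit_k by (rule LeastI)
  have least: "\<not> hits f ?u j" if "j < i" for j using that not_less_Least unfolding i_def by blast
  have ik: "i \<le> k" unfolding i_def using hit_k by (rule Least_le)
  obtain z where z: "f (nth_word i) = Some z" "pref_comparable z ?u" using hit by (auto simp: hits_def)
  have "length (nth_word i) \<le> 2 * 2 ^ length x" using length_nth_word[of i] ik k by simp
  then have "length z \<le> poly p (2 * 2 ^ length x)"
    using p[OF z(1)] poly_nat_mono[of _ _ p] le_trans by blast
  then have "length z < length ?u" using w by simp
  then have pre: "prefix z ?u" using z(2) prefix_length_le[of ?u z] unfolding pref_comparable_def by auto
  have "i < length ?u" using ik k w by simp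
  from padded_inverse_at[OF this least z] pre show ?thesis by auto
qed

section \<open>Regularity\<close>

lemma map_comp_assoc: "(f \<circ>\<^sub>m g) \<circ>\<^sub>m h = f \<circ>\<^sub>m (g \<circ>\<^sub>m h)"
  by (rule ext) (auto simp: map_comp_def split: option.split)

lemma RM_P_comp: "f \<in> carrier RM_P \<Longrightarrow> g \<in> carrier RM_P \<Longrightarrow> f \<circ>\<^sub>m g \<in> carrier RM_P"
  by (simp add: fP_def morphism_comp balanced_comp polytime_computable_comp)

lemma monoid_RM_P: "monoid RM_P"
proof (rule monoidI)
  have "polynomially_balanced Some"
    unfolding polynomially_balanced_def by (rule exI[of _ "[:0, 1:]"]) simp
  then show "\<one>\<^bsub>RM_P\<^esub> \<in> carrier RM_P"
    by (simp add: fP_def polytime_computable_Some morphism_iff)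
qed (use RM_P_comp in \<open>auto simp: map_comp_assoc map_comp_def fun_eq_iff split: option.split\<close>)

lemma padded_inverse_in_RM_P:
  "f \<in> carrier RM_P \<Longrightarrow> padded_inverse f \<in> carrier RM_P"
  by (simp add: fP_def morphism_padded_inverse balanced_padded_inverse polytime_computable_padded_inverse)

text \<open>The composite is a restriction of \<open>f\<close> whose domain contains all words of \<open>dom f\<close> extended by enough
  letters. A word of its domain code thus extends the comparable word \<open>y\<close> of \<open>domC f\<close>, and by minimality the
  extension is not longer than the sufficient padding for \<open>y\<close>, which is a polynomial in
  \<open>2 ^ length y\<close>.\<close>

lemma padded_inverse_E3_inverse:
  assumes f: "f \<in> carrier RM_P"
  shows "((f \<circ>\<^sub>m padded_inverse f) \<circ>\<^sub>m f, f) \<in> E3_equiv"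
proof -
  let ?g = "(f \<circ>\<^sub>m padded_inverse f) \<circ>\<^sub>m f"
  have g: "?g \<in> carrier RM_P" using RM_P_comp padded_inverse_in_RM_P f by blast
  have mor: "right_ideal_morphism f" "right_ideal_morphism ?g" using f g by auto
  note ideal = mor[THEN morphismD(1)]
  have "polynomially_balanced f" using f by (simp add: fP_def)
  then obtain p where p: "\<And>x y. f x = Some y \<Longrightarrow> length y \<le> poly p (length x)"
    unfolding polynomially_balanced_def by blast
  define q where "q = pcompose p [:0, 2:] + [:1, 2:]"
  have q: "poly q m = poly p (2 * m) + 2 * m + 1" for m
    by (simp add: q_def poly_pcompose mult.commute)
  have restr: "f x = Some y" if "?g x = Some y" for x y
    using that padded_inverse_inverts[OF mor(1)] by (auto simp: map_comp_Some_iff)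
  have ext: "x @ w \<in> dom ?g" if x: "x \<in> dom f" and w: "poly q (2 ^ length x) \<le> length w" for x w
  proof -
    obtain y where y: "f x = Some y" using x by blast
    have "y @ w \<in> dom (padded_inverse f)"
      by (rule padded_inverse_defined[where f = f, OF p y]) (use w in \<open>auto simp: q\<close>)
    then obtain v where v: "padded_inverse f (y @ w) = Some v" by blast
    have "?g (x @ w) = Some (y @ w)"
      using morphismD(2)[OF mor(1) y, of w] v padded_inverse_inverts[OF mor(1) v]
      by (simp add: map_comp_Some_iff)
    then show ?thesis by blast
  qed
  have \<tau>: "(\<lambda>n. n + (2 ^ n + poly q (2 ^ n))) \<in> E3"
    using E3_add[OF E3_id E3_comp[OF E3_add_poly[OF E3_id] E3_exp]] .
  show ?thesis
  proof (rule E3_equivI[OF g f _ _ _ \<tau>])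
    show "\<exists>w. x @ w \<in> dom f" if "x \<in> dom ?g" for x
      using that restr by (intro exI[of _ "[]"]) auto
    show "\<exists>w. x @ w \<in> dom ?g" if "x \<in> dom f" for x
      using ext[OF that, of "replicate (poly q (2 ^ length x)) False"] by auto
    show "y = z" if "?g x = Some y" "f x = Some z" for x y z
      using restr[OF that(1)] that(2) by simp
    fix x y assume x: "x \<in> domC ?g" and y: "y \<in> domC f" and xy: "pref_comparable x y"
    have "x \<in> dom f" using domC_subset_dom[OF ideal(2) x] restr by blast
    then obtain y' where y': "y' \<in> domC f" "prefix y' x" using in_dom_iff_domC[OF ideal(1)] by blast
    then have "pref_comparable y' y"
      using xy by (meson pref_comparable_iff_common_extension prefix_order.trans)
    then have "y' = y" using y y'(1) domC_generates(1)[OF ideal(1)] by (simp add: prefix_code_def)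
    then obtain v where v: "x = y @ v" using y'(2) by (auto simp: prefix_def)
    let ?n = "poly q (2 ^ length y)"
    have "length v \<le> ?n"
    proof (rule ccontr)
      assume "\<not> length v \<le> ?n"
      then have n: "?n < length v" by simp
      have "y @ take ?n v \<in> dom ?g" using ext[OF domC_subset_dom[OF ideal(1) y]] n by simp
      moreover have "prefix (y @ take ?n v) x" by (simp add: v take_is_prefix)
      ultimately have "y @ take ?n v = x" using domC_minimal[OF ideal(2) x] by blast
      then show False using n v by (metis append_take_drop_id drop_eq_Nil2 leD same_append_eq self_append_conv)
    qed
    then show "length x \<le> length y + (2 ^ length y + ?n) \<and>
        length y \<le> length x + (2 ^ length x + poly q (2 ^ length x))"
      using v by simp
  qed
qed

theorem proposition4p9:
  shows "regular_monoid M_E3"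
proof -
  have cong: "(a \<otimes>\<^bsub>RM_P\<^esub> c, b \<otimes>\<^bsub>RM_P\<^esub> d) \<in> E3_equiv" if "(a, b) \<in> E3_equiv" "(c, d) \<in> E3_equiv" for a b c d
  proof -
    have "a \<circ>\<^sub>m c \<in> carrier RM_P" "b \<circ>\<^sub>m d \<in> carrier RM_P"
      using RM_P_comp E3_equiv_carrier[OF that(1)] E3_equiv_carrier[OF that(2)] by blast+
    from E3_equiv_comp[OF that this] show ?thesis by simp
  qed
  have "\<exists>s'\<in>carrier M_E3. s \<otimes>\<^bsub>M_E3\<^esub> s' \<otimes>\<^bsub>M_E3\<^esub> s = s" if "s \<in> carrier M_E3" for s
  proof -
    obtain f where f: "f \<in> carrier RM_P" and s: "s = E3_equiv `` {f}"
    proof -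
      have "s \<in> carrier RM_P // E3_equiv"
        using \<open>s \<in> carrier M_E3\<close> by (simp add: M_E3_def quotient_monoid_def del: RM_P_simps)
      then show ?thesis using that by (rule quotientE)
    qed
    let ?s' = "E3_equiv `` {padded_inverse f}"
    note f' = padded_inverse_in_RM_P[OF f]
    have mult: "E3_equiv `` {a} \<otimes>\<^bsub>quotient_monoid RM_P E3_equiv\<^esub> E3_equiv `` {b} =
        E3_equiv `` {a \<otimes>\<^bsub>RM_P\<^esub> b}" if "a \<in> carrier RM_P" "b \<in> carrier RM_P" for a b
      by (rule quotient_mult_class[OF equiv_E3 _ that]) (rule cong)
    have "?s' \<in> carrier M_E3"
      unfolding M_E3_def quotient_monoid_def using quotientI[OF f'] by (simp del: RM_P_simps)
    moreover have "s \<otimes>\<^bsub>M_E3\<^esub> ?s' \<otimes>\<^bsub>M_E3\<^esub> s = E3_equiv `` {(f \<circ>\<^sub>m padded_inverse f) \<circ>\<^sub>m f}"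
      unfolding M_E3_def s using mult[OF f f'] mult[OF RM_P_comp[OF f f'] f] by simp
    moreover have "\<dots> = s"
      unfolding s using equiv_class_eq[OF equiv_E3 padded_inverse_E3_inverse[OF f]] .
    ultimately show ?thesis by auto
  qed
  then show ?thesis
    unfolding regular_monoid_def M_E3_def using monoid_quotient[OF monoid_RM_P equiv_E3 cong] by blast
qed

end
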